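(* Let $d=2$, $0\le m\le M-1$, let $\Gamma^m\subset\overline\Omega$ be a closed regular polygon (i.e. its vertices are equidistributed on a circle), and let $\mathbb P^m$ contain the constant functions and the characteristic function $\mathcal X_{\Omega^m_-}$. Then $\Gamma^m$ has constant discrete curvature, i.e. there exists $\overline\kappa\in\mathbb R$ such that $$\overline\kappa\,\langle\vec\nu^m,\vec\eta\rangle_{\Gamma^m}+\langle\nabla_s\vec X^m,\nabla_s\vec\eta\rangle_{\Gamma^m}=0\qquad\forall\,\vec\eta\in\underline V(\Gamma^m),$$ and $(\vec U^{m+1},\vec X^{m+1},\kappa^{m+1})=(\vec 0,\vec X^m,\overline\kappa)$ is the unique solution in $\mathbb U^m_0\times\underline V(\Gamma^m)\times W(\Gamma^m)$ to the reduced discrete system with $\vec f^{m+1}=\vec 0$.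
   Context: Bulk. $\Omega\subset\mathbb R^2$ is a bounded polygonal domain, $0=t_0<\dots<t_M=T$, $\tau_m=t_{m+1}-t_m>0$. $\mathcal T^m$ is a regular partitioning of $\Omega$ into disjoint open triangles; $S^m_0$ is the space of piecewise constants on $\mathcal T^m$. $\mathbb U^m\subset H^1_0(\Omega,\mathbb R^2)$ is a finite-dimensional finite element space of continuous functions on $\mathcal T^m$, $\mathbb P^m\subset L^2(\Omega)$ is a finite-dimensional pressure space, $\widehat{\mathbb P}^m=\{\varphi\in\mathbb P^m:\int_\Omega\varphi=0\}$, and $\mathbb U^m_0=\{\vec U\in\mathbb U^m:(\nabla\cdot\vec U,\varphi)=0\ \forall\varphi\in\widehat{\mathbb P}^m\}$. $(\cdot,\cdot)$ is the $L^2$ inner product on $\Omega$, $\underline{\underline D}(\vec u)=\frac12(\nabla\vec u+(\nabla\vec u)^T)$. Interface. $\Gamma^m=\bigcup_j\overline{\sigma^m_j}$ is a closed polygonal curve with open edges $\sigma^m_j$. $\Omega^m_-$ is its interior, $\Omega^m_+$ its exterior (in $\Omega$), and $\vec\nu^m$ is the piecewise constant unit normal on $\Gamma^m$ pointing into $\Omega^m_+$. $W(\Gamma^m)$ is the space of scalar continuous functions on $\Gamma^m$ that are affine on each $\sigma^m_j$, and $\underline V(\Gamma^m)=[W(\Gamma^m)]^2$. $\vec X^m\in\underline V(\Gamma^m)$ is the identity function on $\Gamma^m$. $\langle v,w\rangle_{\Gamma^m}=\int_{\Gamma^m}v\cdot w\,d\mathcal H^{1}$, $\nabla_s$ is the surface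 (tangential) gradient on $\Gamma^m$, and the mass lumped product for piecewise continuous $v,w$ is $\langle v,w\rangle^h_{\Gamma^m}=\frac12\sum_j\mathcal H^{1}(\sigma^m_j)\sum_{k=1}^2 (v\cdot w)((\vec q^m_{j_k})^-)$, where $\vec q^m_{j_1},\vec q^m_{j_2}$ are the endpoints of $\sigma^m_j$ and $(\cdot)^-$ denotes the limit from within $\sigma^m_j$. Data. $\gamma>0$, $\mu_\pm>0$; $\mu^m\in S^m_0$ equals $\mu_-$ on elements contained in $\Omega^m_-$, $\mu_+$ on elements contained in $\Omega^m_+$, and $\frac12(\mu_-+\mu_+)$ on elements intersecting $\Gamma^m$. Reduced discrete system: find $(\vec U^{m+1},\vec X^{m+1},\kappa^{m+1})\in\mathbb U^m_0\times\underline V(\Gamma^m)\times W(\Gamma^m)$ with (a) $2(\mu^m\underline{\underline D}(\vec U^{m+1}),\underline{\underline D}(\vec\xi))-\gamma\langle\kappa^{m+1}\vec\nu^m,\vec\xi\rangle_{\Gamma^m}=(\vec f^{m+1},\vec\xi)$ for all $\vec\xi\in\mathbb U^m_0$; (c) $\big\langle\frac{\vec X^{m+1}-\vec X^m}{\tau_m},\chi\vec\nu^m\big\rangle^h_{\Gamma^m}-\langle\vec U^{m+1},\chi\vec\nu^m\rangle_{\Gamma^m}=0$ for all $\chi\in W(\Gamma^m)$; (d) $\langle\kappa^{m+1}\vec\nu^m,\vec\eta\rangle^h_{\Gamma^m}+\langle\nabla_s\vec X^{m+1},\nabla_s\vec\eta\rangle_{\Gamma^m}=0$ for all $\vec\eta\in\underline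 V(\Gamma^m)$. *)

theory Defs
  imports "HOL-Analysis.Analysis"
begin

section \<open>Function spaces on a planar domain\<close>

text \<open>Elements of \<open>L\<^sup>2\<close> and \<open>H\<^sup>1\<close> are represented by functions on the whole plane; the notions
  of this section depend only on their values almost everywhere in \<open>\<Omega>\<close>.\<close>

definition L2 :: "(real^2) set \<Rightarrow> (real^2 \<Rightarrow> 'b::euclidean_space) set" where
  "L2 \<Omega> = {f. f \<in> borel_measurable (lebesgue_on \<Omega>) \<and>
              integrable (lebesgue_on \<Omega>) (\<lambda>x. (norm (f x))\<^sup>2)}"

definition L2_inner :: "(real^2) set \<Rightarrow> (real^2 \<Rightarrow> 'b::euclidean_space) \<Rightarrow> (real^2 \<Rightarrow> 'b) \<Rightarrow> real" where
  "L2_inner \<Omega> f g = (LINT x|lebesgue_on \<Omega>. f x \<bullet> g x)"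

definition partial_deriv :: "2 \<Rightarrow> (real^2 \<Rightarrow> real) \<Rightarrow> real^2 \<Rightarrow> real" where
  "partial_deriv j \<phi> x = frechet_derivative \<phi> (at x) (axis j 1)"

primrec Ck :: "nat \<Rightarrow> (real^2 \<Rightarrow> real) \<Rightarrow> bool" where
  "Ck 0 \<phi> = continuous_on UNIV \<phi>"
| "Ck (Suc k) \<phi> = ((\<forall>x. \<phi> differentiable (at x)) \<and> (\<forall>j. Ck k (partial_deriv j \<phi>)))"

text \<open>The space \<open>C\<^sub>c\<^sup>\<infinity>(\<Omega>)\<close>:\<close>

definition test_function :: "(real^2) set \<Rightarrow> (real^2 \<Rightarrow> real) \<Rightarrow> bool" where
  "test_function \<Omega> \<phi> \<longleftrightarrow> (\<forall>k. Ck k \<phi>) \<and>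
     compact (closure {x. \<phi> x \<noteq> 0}) \<and> closure {x. \<phi> x \<noteq> 0} \<subseteq> \<Omega>"

text \<open>\<open>G x $ i $ j\<close> is the weak derivative of the \<open>i\<close>-th component in the \<open>j\<close>-th direction.\<close>

definition is_weak_grad :: "(real^2) set \<Rightarrow> (real^2 \<Rightarrow> real^2) \<Rightarrow> (real^2 \<Rightarrow> real^2^2) \<Rightarrow> bool" where
  "is_weak_grad \<Omega> u G \<longleftrightarrow> G \<in> L2 \<Omega> \<and>
     (\<forall>\<phi> i j. test_function \<Omega> \<phi> \<longrightarrow>
        (LINT x|lebesgue_on \<Omega>. u x $ i * partial_deriv j \<phi> x)
          = - (LINT x|lebesgue_on \<Omega>. G x $ i $ j * \<phi> x))"

definition H1 :: "(real^2) set \<Rightarrow> (real^2 \<Rightarrow> real^2) set" where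
  "H1 \<Omega> = {u \<in> L2 \<Omega>. \<exists>G. is_weak_grad \<Omega> u G}"

text \<open>Any representative; it is unique up to null sets.\<close>

definition weak_grad :: "(real^2) set \<Rightarrow> (real^2 \<Rightarrow> real^2) \<Rightarrow> real^2 \<Rightarrow> real^2^2" where
  "weak_grad \<Omega> u = (SOME G. is_weak_grad \<Omega> u G)"

definition H1_norm :: "(real^2) set \<Rightarrow> (real^2 \<Rightarrow> real^2) \<Rightarrow> real" where
  "H1_norm \<Omega> u = sqrt (L2_inner \<Omega> u u + L2_inner \<Omega> (weak_grad \<Omega> u) (weak_grad \<Omega> u))"

text \<open>The closure of \<open>C\<^sub>c\<^sup>\<infinity>(\<Omega>)\<close> in \<open>H\<^sup>1(\<Omega>)\<close>:\<close>

definition H10 :: "(real^2) set \<Rightarrow> (real^2 \<Rightarrow> real^2) set" where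
  "H10 \<Omega> = {u \<in> H1 \<Omega>. \<exists>\<Phi>. (\<forall>n i. test_function \<Omega> (\<lambda>x. \<Phi> n x $ i)) \<and>
                         (\<lambda>n. H1_norm \<Omega> (\<lambda>x. \<Phi> n x - u x)) \<longlonglongrightarrow> 0}"

definition divg :: "(real^2) set \<Rightarrow> (real^2 \<Rightarrow> real^2) \<Rightarrow> real^2 \<Rightarrow> real" where
  "divg \<Omega> u x = trace (weak_grad \<Omega> u x)"

definition sym_grad :: "(real^2) set \<Rightarrow> (real^2 \<Rightarrow> real^2) \<Rightarrow> real^2 \<Rightarrow> real^2^2" where
  "sym_grad \<Omega> u x = (1/2) *\<^sub>R (weak_grad \<Omega> u x + transpose (weak_grad \<Omega> u x))"


section \<open>Bulk discretization\<close>

definition polygonal_domain :: "(real^2) set \<Rightarrow> bool" where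
  "polygonal_domain \<Omega> \<longleftrightarrow> \<Omega> \<noteq> {} \<and> open \<Omega> \<and> connected \<Omega> \<and> bounded \<Omega> \<and>
     (\<exists>E. finite E \<and> (\<forall>(a, b) \<in> E. a \<noteq> b) \<and> frontier \<Omega> = (\<Union>(a, b) \<in> E. closed_segment a b))"

text \<open>Regularity is conformity: the closed triangles meet only in common faces.\<close>

definition regular_partitioning :: "(real^2) set \<Rightarrow> (real^2) set set \<Rightarrow> bool" where
  "regular_partitioning \<Omega> \<T> \<longleftrightarrow>
     (\<forall>A\<in>\<T>. A \<subseteq> \<Omega> \<and> (\<exists>K. 2 simplex K \<and> A = interior K)) \<and>
     pairwise disjnt \<T> \<and>
     triangulation (closure ` \<T>) \<and>
     (\<Union>A\<in>\<T>. closure A) = closure \<Omega>"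

definition fin_dim_space :: "(real^2 \<Rightarrow> 'b::real_vector) set \<Rightarrow> bool" where
  "fin_dim_space V \<longleftrightarrow> (\<exists>B. finite B \<and> V = {(\<lambda>x. \<Sum>b\<in>B. c b *\<^sub>R b x) | c :: (real^2 \<Rightarrow> 'b) \<Rightarrow> real. True})"

definition finite_element_space ::
    "(real^2) set \<Rightarrow> (real^2) set set \<Rightarrow> (real^2 \<Rightarrow> real^2) set \<Rightarrow> bool" where
  "finite_element_space \<Omega> \<T> \<U> \<longleftrightarrow> fin_dim_space \<U> \<and>
     (\<forall>u\<in>\<U>. continuous_on (closure \<Omega>) u \<and>
            (\<forall>A\<in>\<T>. \<exists>p. polynomial_function p \<and> (\<forall>x\<in>A. u x = p x)))"

text \<open>Membership of an \<open>L\<^sup>2\<close> class in a space of representatives:\<close>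

definition contains_ae :: "(real^2) set \<Rightarrow> (real^2 \<Rightarrow> real) set \<Rightarrow> (real^2 \<Rightarrow> real) \<Rightarrow> bool" where
  "contains_ae \<Omega> \<P> f \<longleftrightarrow> (\<exists>\<phi>\<in>\<P>. AE x in lebesgue_on \<Omega>. \<phi> x = f x)"

definition mean_free :: "(real^2) set \<Rightarrow> (real^2 \<Rightarrow> real) set \<Rightarrow> (real^2 \<Rightarrow> real) set" where
  "mean_free \<Omega> \<P> = {\<phi> \<in> \<P>. (LINT x|lebesgue_on \<Omega>. \<phi> x) = 0}"

definition div_free ::
    "(real^2) set \<Rightarrow> (real^2 \<Rightarrow> real^2) set \<Rightarrow> (real^2 \<Rightarrow> real) set \<Rightarrow> (real^2 \<Rightarrow> real^2) set" where
  "div_free \<Omega> \<U> \<P> = {u \<in> \<U>. \<forall>\<phi> \<in> mean_free \<Omega> \<P>. L2_inner \<Omega> (divg \<Omega> u) \<phi> = 0}"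


section \<open>Closed polygonal curves\<close>

text \<open>A closed polygonal curve is given by its vertices \<open>q 0, \<dots>, q (N - 1)\<close> in cyclic order.\<close>

definition vnext :: "nat \<Rightarrow> (nat \<Rightarrow> real^2) \<Rightarrow> nat \<Rightarrow> real^2" where
  "vnext N q j = q (Suc j mod N)"

definition edge :: "nat \<Rightarrow> (nat \<Rightarrow> real^2) \<Rightarrow> nat \<Rightarrow> (real^2) set" where
  "edge N q j = open_segment (q j) (vnext N q j)"

definition edge_length :: "nat \<Rightarrow> (nat \<Rightarrow> real^2) \<Rightarrow> nat \<Rightarrow> real" where
  "edge_length N q j = dist (q j) (vnext N q j)"

definition polygon :: "nat \<Rightarrow> (nat \<Rightarrow> real^2) \<Rightarrow> (real^2) set" where
  "polygon N q = (\<Union>j<N. closure (edge N q j))"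

definition regular_polygon :: "nat \<Rightarrow> (nat \<Rightarrow> real^2) \<Rightarrow> bool" where
  "regular_polygon N q \<longleftrightarrow> 3 \<le> N \<and>
     (\<exists>c r \<theta>. 0 < r \<and> (\<forall>j<N. q j = c + r *\<^sub>R vector [cos (\<theta> + 2 * pi * real j / real N),
                                                     sin (\<theta> + 2 * pi * real j / real N)]))"

text \<open>The values of the normal at the vertices are irrelevant and left open.\<close>

definition is_outer_unit_normal :: "nat \<Rightarrow> (nat \<Rightarrow> real^2) \<Rightarrow> (real^2 \<Rightarrow> real^2) \<Rightarrow> bool" where
  "is_outer_unit_normal N q \<nu> \<longleftrightarrow>
     (\<forall>j<N. \<forall>x\<in>edge N q j. norm (\<nu> x) = 1 \<and> \<nu> x \<bullet> (vnext N q j - q j) = 0 \<and>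
        (\<forall>\<^sub>F \<epsilon> in at_right 0. x + \<epsilon> *\<^sub>R \<nu> x \<in> outside (polygon N q)))"

definition W_space :: "nat \<Rightarrow> (nat \<Rightarrow> real^2) \<Rightarrow> (real^2 \<Rightarrow> real) set" where
  "W_space N q = {\<zeta>. continuous_on (polygon N q) \<zeta> \<and>
     (\<forall>j<N. \<exists>l c. linear l \<and> (\<forall>x\<in>edge N q j. \<zeta> x = l x + c))}"

definition V_space :: "nat \<Rightarrow> (nat \<Rightarrow> real^2) \<Rightarrow> (real^2 \<Rightarrow> real^2) set" where
  "V_space N q = {\<eta>. \<forall>i. (\<lambda>x. \<eta> x $ i) \<in> W_space N q}"

text \<open>The integral over an edge with respect to arc length, that is, with respect to
  \<open>\<H>\<^sup>1\<close>, which the library does not provide:\<close>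

definition edge_integral :: "nat \<Rightarrow> (nat \<Rightarrow> real^2) \<Rightarrow> nat \<Rightarrow> (real^2 \<Rightarrow> real) \<Rightarrow> real" where
  "edge_integral N q j g =
     edge_length N q j * integral {0..1} (\<lambda>t. g (q j + t *\<^sub>R (vnext N q j - q j)))"

definition curve_inner ::
    "nat \<Rightarrow> (nat \<Rightarrow> real^2) \<Rightarrow> (real^2 \<Rightarrow> real^2) \<Rightarrow> (real^2 \<Rightarrow> real^2) \<Rightarrow> real" where
  "curve_inner N q v w = (\<Sum>j<N. edge_integral N q j (\<lambda>x. v x \<bullet> w x))"

definition lumped_inner ::
    "nat \<Rightarrow> (nat \<Rightarrow> real^2) \<Rightarrow> (real^2 \<Rightarrow> real^2) \<Rightarrow> (real^2 \<Rightarrow> real^2) \<Rightarrow> real" where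
  "lumped_inner N q v w = (1/2) * (\<Sum>j<N. edge_length N q j *
     (Lim (at (q j) within edge N q j) (\<lambda>x. v x \<bullet> w x) +
      Lim (at (vnext N q j) within edge N q j) (\<lambda>x. v x \<bullet> w x)))"

definition edge_tangent :: "nat \<Rightarrow> (nat \<Rightarrow> real^2) \<Rightarrow> nat \<Rightarrow> real^2" where
  "edge_tangent N q j = (1 / edge_length N q j) *\<^sub>R (vnext N q j - q j)"

text \<open>Row \<open>i\<close> of the surface gradient is \<open>(\<partial>\<^sub>\<tau> f\<^sub>i) \<tau>\<close> for the unit tangent \<open>\<tau>\<close>; this does not
  depend on the sign of \<open>\<tau>\<close>.\<close>

definition surface_grad ::
    "nat \<Rightarrow> (nat \<Rightarrow> real^2) \<Rightarrow> nat \<Rightarrow> (real^2 \<Rightarrow> real^2) \<Rightarrow> real^2 \<Rightarrow> real^2^2" where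
  "surface_grad N q j f x =
     (\<chi> i k. vector_derivative (\<lambda>s. f (x + s *\<^sub>R edge_tangent N q j)) (at 0) $ i
              * edge_tangent N q j $ k)"

definition surface_grad_inner ::
    "nat \<Rightarrow> (nat \<Rightarrow> real^2) \<Rightarrow> (real^2 \<Rightarrow> real^2) \<Rightarrow> (real^2 \<Rightarrow> real^2) \<Rightarrow> real" where
  "surface_grad_inner N q f g =
     (\<Sum>j<N. edge_integral N q j (\<lambda>x. surface_grad N q j f x \<bullet> surface_grad N q j g x))"


section \<open>The reduced discrete system\<close>

definition interior_phase :: "nat \<Rightarrow> (nat \<Rightarrow> real^2) \<Rightarrow> (real^2) set" where
  "interior_phase N q = inside (polygon N q)"

definition exterior_phase :: "(real^2) set \<Rightarrow> nat \<Rightarrow> (nat \<Rightarrow> real^2) \<Rightarrow> (real^2) set" where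
  "exterior_phase \<Omega> N q = \<Omega> \<inter> outside (polygon N q)"

text \<open>Off the open triangles, a null set, the viscosity is left open.\<close>

definition is_discrete_viscosity ::
    "(real^2) set \<Rightarrow> (real^2) set set \<Rightarrow> nat \<Rightarrow> (nat \<Rightarrow> real^2) \<Rightarrow> real \<Rightarrow> real
      \<Rightarrow> (real^2 \<Rightarrow> real) \<Rightarrow> bool" where
  "is_discrete_viscosity \<Omega> \<T> N q \<mu>m \<mu>p \<mu> \<longleftrightarrow> (\<forall>A\<in>\<T>.
     (A \<subseteq> interior_phase N q \<longrightarrow> (\<forall>x\<in>A. \<mu> x = \<mu>m)) \<and>
     (A \<subseteq> exterior_phase \<Omega> N q \<longrightarrow> (\<forall>x\<in>A. \<mu> x = \<mu>p)) \<and>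
     (A \<inter> polygon N q \<noteq> {} \<longrightarrow> (\<forall>x\<in>A. \<mu> x = (\<mu>m + \<mu>p) / 2)))"

text \<open>Here \<open>\<tau>\<close> is the time step size, and \<open>X\<^sup>m\<close> is the identity.\<close>

definition reduced_system_solution ::
    "(real^2) set \<Rightarrow> (real^2 \<Rightarrow> real^2) set \<Rightarrow> (real^2 \<Rightarrow> real) set \<Rightarrow> nat \<Rightarrow> (nat \<Rightarrow> real^2)
      \<Rightarrow> (real^2 \<Rightarrow> real^2) \<Rightarrow> (real^2 \<Rightarrow> real) \<Rightarrow> real \<Rightarrow> real \<Rightarrow> (real^2 \<Rightarrow> real^2)
      \<Rightarrow> (real^2 \<Rightarrow> real^2) \<times> (real^2 \<Rightarrow> real^2) \<times> (real^2 \<Rightarrow> real) \<Rightarrow> bool" where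
  "reduced_system_solution \<Omega> \<U> \<P> N q \<nu> \<mu> \<gamma> \<tau> f = (\<lambda>(U, X, \<kappa>).
     U \<in> div_free \<Omega> \<U> \<P> \<and> X \<in> V_space N q \<and> \<kappa> \<in> W_space N q \<and>
     (\<forall>\<xi> \<in> div_free \<Omega> \<U> \<P>.
        2 * L2_inner \<Omega> (\<lambda>x. \<mu> x *\<^sub>R sym_grad \<Omega> U x) (sym_grad \<Omega> \<xi>)
          - \<gamma> * curve_inner N q (\<lambda>x. \<kappa> x *\<^sub>R \<nu> x) \<xi> = L2_inner \<Omega> f \<xi>) \<and>
     (\<forall>\<zeta> \<in> W_space N q.
        lumped_inner N q (\<lambda>x. (1 / \<tau>) *\<^sub>R (X x - x)) (\<lambda>x. \<zeta> x *\<^sub>R \<nu> x)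
          - curve_inner N q U (\<lambda>x. \<zeta> x *\<^sub>R \<nu> x) = 0) \<and>
     (\<forall>\<eta> \<in> V_space N q.
        lumped_inner N q (\<lambda>x. \<kappa> x *\<^sub>R \<nu> x) \<eta> + surface_grad_inner N q X \<eta> = 0))"

end

theory Submission
  imports Defs
begin

text \<open>
  Testing the system with the solution itself gives
  \<open>2 (\<mu> D(U), D(U)) + (\<gamma> / \<tau>) \<parallel>\<nabla>\<^sub>s (X - id)\<parallel>\<^sup>2 = 0\<close>, because
  \<open>\<langle>\<nabla>\<^sub>s id, \<nabla>\<^sub>s (X - id)\<rangle> = - \<kappa>bar \<tau> \<langle>U, \<nu>\<rangle> = 0\<close> for discretely divergence-free \<open>U\<close>. Hence
  \<open>D(U) = 0\<close> and \<open>X - id\<close> is constant, and nodal hat functions determine the curvature and this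
  constant. Korn's inequality is not needed: \<open>D(U) = 0\<close> contains \<open>\<partial>\<^sub>k U\<^sub>k = 0\<close>, and a Poincare
  inequality in the direction \<open>k\<close> gives \<open>U\<^sub>k = 0\<close>.

  That \<open>\<langle>U, \<nu>\<rangle> = 0\<close> follows from the divergence theorem inside the polygon, since the
  characteristic function of the interior minus its mean is an admissible pressure. The polygon
  may run along the boundary of \<open>\<Omega>\<close> and may surround holes of \<open>\<Omega>\<close>, so the divergence theorem is
  obtained by testing the weak gradient with Lipschitz cutoffs that increase to the characteristic
  function. Almost every point of the polygon either has \<open>\<Omega>\<close> on its inner side, or has \<open>\<Omega>\<close> on
  one side only; in the latter case an \<open>H\<^sub>0\<^sup>1\<close> function that is continuous up to the boundary
  vanishes there.
\<close>

section \<open>Integration by parts for Lipschitz functions\<close>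

text \<open>What is special about the regular polygon: at each vertex the two adjacent normals add
  up to a multiple of the radial direction, and the two adjacent tangents differ by one. Summation
  by parts therefore turns the product with \<open>\<nu>\<close> and the surface gradient product
  with the identity into multiples of one number, \<open>vertex_sum\<close>, with factors
  \<open>side * cos (pi / real N)\<close> and \<open>2 * sin (pi / real N)\<close>. Their ratio
  gives the curvature \<open>- (1 / apothem)\<close>. The cutoffs are products of clipped distances
  to the edge lines. Their gradient is explicit off finitely many lines and concentrates on strips
  along the edges; stretching each strip to unit width turns the limit of the flux into pointwise
  convergence under a fixed majorant. For uniqueness, mass lumping decouples the vertices: a hat
  function tests only the radial component at its own vertex. A constant displacement is thus
  orthogonal to all radial directions, hence zero.\<close>

lemma bounded_support_lipschitz_bounded:
  fixes f :: "'a::euclidean_space \<Rightarrow> real"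
  assumes lip: "L-lipschitz_on UNIV f"
  shows "\<exists>B\<ge>0. \<forall>x\<in>cball 0 R. \<bar>f x\<bar> \<le> B"
proof -
  have "continuous_on (cball 0 R) f"
    using lipschitz_on_continuous_on[OF lip] continuous_on_subset by blast
  then have "bounded (f ` cball 0 R)"
    by (intro compact_imp_bounded compact_continuous_image) auto
  then obtain B where "B > 0" "\<forall>y\<in>f ` cball 0 R. norm y \<le> B" unfolding bounded_pos by blast
  then show ?thesis by (intro exI[of _ B]) auto
qed

lemma lipschitz_on_mult_bounded_support:
  fixes f g :: "'a::euclidean_space \<Rightarrow> real"
  assumes f: "L-lipschitz_on UNIV f" and g: "K-lipschitz_on UNIV g"
    and supp: "\<And>x. x \<notin> cball 0 R \<Longrightarrow> f x = 0"
  shows "\<exists>M. M-lipschitz_on UNIV (\<lambda>x. f x * g x)"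
proof -
  obtain B where B: "B \<ge> 0" "\<forall>x\<in>cball 0 R. \<bar>f x\<bar> \<le> B"
    using bounded_support_lipschitz_bounded[OF f] by blast
  then have Bf: "\<bar>f x\<bar> \<le> B" for x using supp[of x] by (cases "x \<in> cball 0 R") auto
  obtain C where C: "C \<ge> 0" "\<forall>x\<in>cball 0 R. \<bar>g x\<bar> \<le> C"
    using bounded_support_lipschitz_bounded[OF g] by blast
  have L: "L \<ge> 0" and K: "K \<ge> 0" using f g lipschitz_on_nonneg by blast+
  have ineq: "\<bar>f x * g x - f y * g y\<bar> \<le> (L * C + B * K) * dist x y" if "x \<in> cball 0 R" for x y
  proof -
    \<comment> \<open>\<open>g\<close> may be unbounded. In this splitting it occurs without a
      difference only at \<open>x\<close>, which lies in the ball where \<open>C\<close> bounds it;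
      \<open>f\<close> is bounded by \<open>B\<close> everywhere.\<close>
    have "f x * g x - f y * g y = (f x - f y) * g x + f y * (g x - g y)" by algebra
    then have "\<bar>f x * g x - f y * g y\<bar> \<le> \<bar>f x - f y\<bar> * \<bar>g x\<bar> + \<bar>f y\<bar> * \<bar>g x - g y\<bar>"
      by (metis abs_mult abs_triangle_ineq)
    also have "\<dots> \<le> (L * dist x y) * C + B * (K * dist x y)"
      using lipschitz_onD[OF f, of x y] lipschitz_onD[OF g, of x y] that C Bf B L K
      by (intro add_mono mult_mono) (auto simp: dist_real_def)
    finally show ?thesis by (simp add: algebra_simps)
  qed
  have "(L * C + B * K)-lipschitz_on UNIV (\<lambda>x. f x * g x)"
  proof (rule lipschitz_onI)
    fix x y :: 'a
    consider "x \<in> cball 0 R" | "y \<in> cball 0 R" | "x \<notin> cball 0 R" "y \<notin> cball 0 R" by blast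
    then show "dist (f x * g x) (f y * g y) \<le> (L * C + B * K) * dist x y"
    proof cases
      case 1 then show ?thesis using ineq by (simp add: dist_real_def)
    next
      case 2 then show ?thesis using ineq[of y x] by (simp add: dist_real_def dist_commute abs_minus_commute)
    next
      case 3 then show ?thesis using supp L C B K by simp
    qed
  qed (use L C B K in simp)
  then show ?thesis by blast
qed

text \<open>The integral of a difference quotient vanishes by translation invariance.\<close>

lemma integral_directional_derivative:
  fixes f g :: "'a::euclidean_space \<Rightarrow> real"
  assumes lip: "L-lipschitz_on UNIV f" and supp: "\<And>x. x \<notin> cball 0 R \<Longrightarrow> f x = 0"
    and der: "AE x in lborel. ((\<lambda>h. f (x + h *\<^sub>R e)) has_real_derivative g x) (at 0)"
    and g[measurable]: "g \<in> borel_measurable borel"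
  shows "integrable lborel g" "integral\<^sup>L lborel g = 0"
proof -
  have cont: "continuous_on UNIV f" using lipschitz_on_continuous_on[OF lip] .
  have [measurable]: "f \<in> borel_measurable borel" by (rule borel_measurable_continuous_onI[OF cont])
  \<comment> \<open>Difference quotients with steps 1/(n+1). As the steps never exceed 1, all
    quotients vanish outside one enlarged ball, and inside it the Lipschitz constant gives the
    majorant \<open>w\<close>.\<close>
  define D where "D n x = (f (x + (1 / real (Suc n)) *\<^sub>R e) - f x) * real (Suc n)" for n x
  define w :: "'a \<Rightarrow> real" where "w = (\<lambda>x. L * norm e * indicator (cball 0 (R + norm e)) x)"
  have L: "L \<ge> 0" using lip lipschitz_on_nonneg by blast
  have fint: "integrable lborel f"
  proof -
    have "integrable lborel (\<lambda>x. indicator (cball 0 R) x *\<^sub>R f x)"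
      by (rule borel_integrable_compact) (auto intro: continuous_on_subset[OF cont])
    moreover have "(\<lambda>x. indicator (cball 0 R) x *\<^sub>R f x) = f"
      using supp by (auto simp: indicator_def fun_eq_iff)
    ultimately show ?thesis by simp
  qed
  have wint: "integrable lborel w" unfolding w_def
    by (intro integrable_mult_right integrable_real_indicator) (use emeasure_lborel_cball_finite in \<open>auto simp: less_top\<close>)
  have bound: "norm (D n x) \<le> w x" for n x
  proof (cases "x \<in> cball 0 (R + norm e)")
    case True
    have "\<bar>f (x + (1 / real (Suc n)) *\<^sub>R e) - f x\<bar> \<le> L * ((1 / real (Suc n)) * norm e)"
      using lipschitz_onD[OF lip, of "x + (1 / real (Suc n)) *\<^sub>R e" x] by (simp add: dist_norm)
    then have "\<bar>D n x\<bar> \<le> L * ((1 / real (Suc n)) * norm e) * real (Suc n)"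
      unfolding D_def abs_mult by (intro mult_mono) auto
    moreover have "L * ((1 / real (Suc n)) * norm e) * real (Suc n) = L * norm e" by simp
    ultimately show ?thesis using True by (simp add: w_def)
  next
    case False
    then have nx: "norm x > R + norm e" by simp
    moreover have "norm ((1 / real (Suc n)) *\<^sub>R e) \<le> norm e"
      using mult_left_le_one_le[of "norm e" "1 / real (Suc n)"] by simp
    moreover have "norm x - norm ((1 / real (Suc n)) *\<^sub>R e) \<le> norm (x + (1 / real (Suc n)) *\<^sub>R e)"
      using norm_triangle_ineq4[of "x + (1 / real (Suc n)) *\<^sub>R e" "(1 / real (Suc n)) *\<^sub>R e"] by simp
    ultimately have "norm (x + (1 / real (Suc n)) *\<^sub>R e) > R" by linarith
    moreover have "norm x > R" using nx norm_ge_zero[of e] by linarith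
    ultimately show ?thesis using supp L by (simp add: D_def w_def)
  qed
  have lim: "AE x in lborel. (\<lambda>n. D n x) \<longlonglongrightarrow> g x"
    using der
  proof eventually_elim
    case (elim x)
    have "((\<lambda>h. (f (x + h *\<^sub>R e) - f x) / h) \<longlongrightarrow> g x) (at 0)"
      using elim by (simp add: DERIV_def)
    moreover have "filterlim (\<lambda>n. 1 / real (Suc n)) (at 0) sequentially"
      unfolding filterlim_at using LIMSEQ_inverse_real_of_nat by (auto simp: inverse_eq_divide)
    ultimately have "(\<lambda>n. (f (x + (1 / real (Suc n)) *\<^sub>R e) - f x) / (1 / real (Suc n))) \<longlonglongrightarrow> g x"
      by (rule filterlim_compose)
    then show ?case by (simp add: D_def)
  qed
  have trans: "integrable lborel (\<lambda>x. f (x + v)) \<and> integral\<^sup>L lborel (\<lambda>x. f (x + v)) = integral\<^sup>L lborel f" for v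
  proof -
    have "integrable (distr lborel borel ((+) v)) f" by (simp add: lborel_distr_plus fint)
    then have "integrable lborel (\<lambda>x. f (v + x))" by (subst (asm) integrable_distr_eq) auto
    moreover have "integral\<^sup>L (distr lborel borel ((+) v)) f = integral\<^sup>L lborel (\<lambda>x. f (v + x))"
      by (subst integral_distr) auto
    ultimately show ?thesis by (simp add: lborel_distr_plus add.commute)
  qed
  have "integral\<^sup>L lborel (D n) = 0" for n
    unfolding D_def using trans fint by simp
  moreover have "(\<lambda>n. integral\<^sup>L lborel (D n)) \<longlonglongrightarrow> integral\<^sup>L lborel g"
    by (rule integral_dominated_convergence[OF _ _ wint lim]) (use bound in \<open>auto simp: D_def[abs_def]\<close>)
  ultimately show "integral\<^sup>L lborel g = 0" by (simp add: LIMSEQ_const_iff)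
  show "integrable lborel g"
    by (rule integrable_dominated_convergence[OF _ _ wint lim]) (use bound in \<open>auto simp: D_def[abs_def]\<close>)
qed

lemma lipschitz_directional_derivative_bound:
  fixes f :: "'a::real_normed_vector \<Rightarrow> real"
  assumes lip: "L-lipschitz_on UNIV f" and der: "((\<lambda>h. f (x + h *\<^sub>R e)) has_real_derivative g) (at 0)"
  shows "\<bar>g\<bar> \<le> L * norm e"
proof -
  have "((\<lambda>h. (f (x + h *\<^sub>R e) - f x) / h) \<longlongrightarrow> g) (at 0)" using der by (simp add: DERIV_def)
  then have "((\<lambda>h. \<bar>(f (x + h *\<^sub>R e) - f x) / h\<bar>) \<longlongrightarrow> \<bar>g\<bar>) (at 0)" by (rule tendsto_rabs)
  moreover have "\<forall>\<^sub>F h in at 0. \<bar>(f (x + h *\<^sub>R e) - f x) / h\<bar> \<le> L * norm e"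
  proof (rule eventually_at_topological[THEN iffD2], intro exI[of _ UNIV] conjI ballI impI)
    fix h :: real assume "h \<noteq> 0"
    then show "\<bar>(f (x + h *\<^sub>R e) - f x) / h\<bar> \<le> L * norm e"
      using lipschitz_onD[OF lip, of "x + h *\<^sub>R e" x]
      by (simp add: dist_norm field_simps abs_divide)
  qed auto
  ultimately show ?thesis by (intro tendsto_upperbound) auto
qed

text \<open>The product is Lipschitz with the bounded support of \<open>f\<close>, so the integral
  of its derivative vanishes. The almost everywhere derivatives are hypotheses because they are
  explicit in every application. \<open>f * g'\<close> is bounded with bounded support, hence
  integrable; \<open>f' * g\<close> follows by subtraction, since \<open>g\<close> has no global
  bound.\<close>

lemma integration_by_parts_lipschitz:
  fixes f g f' g' :: "'a::euclidean_space \<Rightarrow> real"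
  assumes f: "L-lipschitz_on UNIV f" and g: "K-lipschitz_on UNIV g"
    and supp: "\<And>x. x \<notin> cball 0 R \<Longrightarrow> f x = 0"
    and f': "AE x in lborel. ((\<lambda>h. f (x + h *\<^sub>R e)) has_real_derivative f' x) (at 0)"
    and g': "AE x in lborel. ((\<lambda>h. g (x + h *\<^sub>R e)) has_real_derivative g' x) (at 0)"
    and [measurable]: "f' \<in> borel_measurable borel" "g' \<in> borel_measurable borel"
  shows "integrable lborel (\<lambda>x. f' x * g x)" "integrable lborel (\<lambda>x. f x * g' x)"
    "(\<integral>x. f' x * g x \<partial>lborel) = - (\<integral>x. f x * g' x \<partial>lborel)"
proof -
  have [measurable]: "f \<in> borel_measurable borel" "g \<in> borel_measurable borel"
    using lipschitz_on_continuous_on[OF f] lipschitz_on_continuous_on[OF g]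
    by (auto intro: borel_measurable_continuous_onI)
  obtain M where M: "M-lipschitz_on UNIV (\<lambda>x. f x * g x)"
    using lipschitz_on_mult_bounded_support[OF f g supp] by blast
  have der: "AE x in lborel. ((\<lambda>h. f (x + h *\<^sub>R e) * g (x + h *\<^sub>R e))
      has_real_derivative f' x * g x + f x * g' x) (at 0)"
    using f' g'
  proof eventually_elim
    case (elim x)
    from DERIV_mult[OF this] show ?case by (simp add: algebra_simps)
  qed
  have meas: "(\<lambda>x. f' x * g x + f x * g' x) \<in> borel_measurable borel" by measurable
  have IBP: "integrable lborel (\<lambda>x. f' x * g x + f x * g' x)" "(\<integral>x. f' x * g x + f x * g' x \<partial>lborel) = 0"
    by (rule integral_directional_derivative[OF M _ der meas, of R], use supp in simp)+
  obtain B where B: "B \<ge> 0" "\<forall>x\<in>cball 0 R. \<bar>f x\<bar> \<le> B"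
    using bounded_support_lipschitz_bounded[OF f] by blast
  show 2: "integrable lborel (\<lambda>x. f x * g' x)"
  proof (rule Bochner_Integration.integrable_bound)
    show "integrable lborel (\<lambda>x. B * (K * norm e) * indicator (cball 0 R) x :: real)"
      by (intro integrable_mult_right integrable_real_indicator) (use emeasure_lborel_cball_finite in \<open>auto simp: less_top\<close>)
    show "AE x in lborel. norm (f x * g' x) \<le> norm (B * (K * norm e) * indicator (cball 0 R) x)"
      using g'
    proof eventually_elim
      case (elim x)
      have g'b: "\<bar>g' x\<bar> \<le> K * norm e" using lipschitz_directional_derivative_bound[OF g elim] .
      show ?case
      proof (cases "x \<in> cball 0 R")
        case True
        then have "\<bar>f x\<bar> * \<bar>g' x\<bar> \<le> B * (K * norm e)" using B g'b by (intro mult_mono) auto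
        then show ?thesis using True B lipschitz_on_nonneg[OF g] by (simp add: abs_mult)
      qed (use supp in simp)
    qed
  qed measurable
  show 1: "integrable lborel (\<lambda>x. f' x * g x)"
    using Bochner_Integration.integrable_diff[OF IBP(1) 2] by simp
  show "(\<integral>x. f' x * g x \<partial>lborel) = - (\<integral>x. f x * g' x \<partial>lborel)"
    using IBP(2) Bochner_Integration.integral_add[OF 1 2] by linarith
qed

section \<open>The fundamental lemma of the calculus of variations\<close>

text \<open>Open boxes are an intersection-stable generator of the Borel sets, so a Dynkin argument
  carries the vanishing from boxes to Borel sets. Completion extends it to Lebesgue sets, in
  particular to those where \<open>G\<close> is positive or negative.\<close>

lemma integral_boxes_zero_imp_AE_zero:
  fixes G :: "'a::euclidean_space \<Rightarrow> real"
  assumes G: "integrable lebesgue G"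
    and boxes: "\<And>a b. (\<integral>x. indicator (box a b) x * G x \<partial>lebesgue) = 0"
  shows "AE x in lebesgue. G x = 0"
proof -
  have Gm[measurable]: "G \<in> borel_measurable lebesgue" using G by auto
  have Gi: "integrable lebesgue (\<lambda>x. indicator A x * G x)" if "A \<in> sets lebesgue" for A
    using integrable_mult_indicator[OF that G] by simp
  \<comment> \<open>Complements in the induction below need the integral over the whole space;
    exhausting it by boxes shows that it vanishes too.\<close>
  have UN: "(\<integral>x. G x \<partial>lebesgue) = 0"
  proof -
    have "(\<lambda>n. \<integral>x. indicator (box (- real n *\<^sub>R One) (real n *\<^sub>R One)) x * G x \<partial>lebesgue)
        \<longlonglongrightarrow> (\<integral>x. G x \<partial>lebesgue)"
    proof (rule integral_dominated_convergence[where w = "\<lambda>x. norm (G x)"])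
      show "AE x in lebesgue. (\<lambda>n. indicator (box (- real n *\<^sub>R One) (real n *\<^sub>R One)) x * G x) \<longlonglongrightarrow> G x"
      proof (rule AE_I2)
        fix x :: 'a
        obtain n0 :: nat where n0: "norm x < real n0" using reals_Archimedean2 by blast
        have "indicator (box (- real n *\<^sub>R One) (real n *\<^sub>R One)) x * G x = G x" if "n \<ge> n0" for n
        proof -
          have "\<bar>x \<bullet> i\<bar> < real n" if "i \<in> Basis" for i
            using Basis_le_norm[OF that, of x] n0 \<open>n \<ge> n0\<close> by linarith
          then have "x \<in> box (- real n *\<^sub>R One) (real n *\<^sub>R One)"
            by (force simp: mem_box abs_less_iff)
          then show ?thesis by simp
        qed
        then show "(\<lambda>n. indicator (box (- real n *\<^sub>R One) (real n *\<^sub>R One)) x * G x) \<longlonglongrightarrow> G x"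
          by (intro tendsto_eventually) (auto simp: eventually_sequentially)
      qed
    next
      show "(\<lambda>x. indicator (box (- real n *\<^sub>R One) (real n *\<^sub>R One)) x * G x) \<in> borel_measurable lebesgue" for n
        by (intro borel_measurable_integrable Gi) auto
    qed (use G in \<open>auto simp: indicator_def\<close>)
    then show ?thesis using boxes by (simp add: LIMSEQ_const_iff)
  qed
  have borel: "(\<integral>x. indicator A x * G x \<partial>lebesgue) = 0" if "A \<in> sets borel" for A
  proof -
    have "Int_stable (range (\<lambda> (a, b). box a b :: 'a set))"
      by (auto simp: Int_stable_def box_Int_box)
    moreover have "range (\<lambda> (a, b). box a b :: 'a set) \<subseteq> Pow UNIV" by simp
    moreover have "A \<in> sigma_sets UNIV (range (\<lambda> (a, b). box a b))"
      using that by (simp add: borel_eq_box)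
    ultimately show ?thesis
    proof (induct rule: sigma_sets_induct_disjoint)
      fix A assume "A \<in> range (\<lambda> (a, b). box a b :: 'a set)"
      then show "(\<integral>x. indicator A x * G x \<partial>lebesgue) = 0" using boxes by auto
    next
      fix A :: "'a set" assume A: "A \<in> sigma_sets UNIV (range (\<lambda> (a, b). box a b))"
        and 0: "(\<integral>x. indicator A x * G x \<partial>lebesgue) = 0"
      have "A \<in> sets borel" using A by (simp add: borel_eq_box)
      then have "(\<integral>x. G x - indicator A x * G x \<partial>lebesgue) = 0"
        using Bochner_Integration.integral_diff[OF G Gi[of A]] UN 0 by simp
      moreover have "(\<lambda>x. G x - indicator A x * G x) = (\<lambda>x. indicator (UNIV - A) x * G x)"
        by (auto simp: indicator_def fun_eq_iff)
      ultimately show "(\<integral>x. indicator (UNIV - A) x * G x \<partial>lebesgue) = 0" by simp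
    next
      fix A :: "nat \<Rightarrow> 'a set"
      assume disj: "disjoint_family A" and A: "range A \<subseteq> sigma_sets UNIV (range (\<lambda> (a, b). box a b))"
        and 0: "\<And>i. (\<integral>x. indicator (A i) x * G x \<partial>lebesgue) = 0"
      have Ab: "A i \<in> sets borel" for i using A by (auto simp add: borel_eq_box)
      have "(LINT x:(\<Union>i. A i)|lebesgue. G x) = (\<Sum>i. (LINT x:(A i)|lebesgue. G x))"
        using disj Ab G by (intro lebesgue_integral_countable_add)
          (auto simp: disjoint_family_on_def set_integrable_def intro!: Gi integrable_mult_indicator)
      then show "(\<integral>x. indicator (\<Union>(range A)) x * G x \<partial>lebesgue) = 0"
        by (simp add: set_lebesgue_integral_def 0)
    qed simp_all
  qed
  have leb: "(\<integral>x. indicator A x * G x \<partial>lebesgue) = 0" if Al: "A \<in> sets lebesgue" for A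
  proof -
    obtain S N N' where A: "A = S \<union> N" "N \<subseteq> N'" "N' \<in> null_sets lborel" "S \<in> sets lborel"
      using Al by (rule sets_completionE)
    have "AE x in lebesgue. x \<notin> N'"
      using A(3) AE_completion AE_not_in by blast
    then have "AE x in lebesgue. indicator A x * G x = indicator S x * G x"
      by eventually_elim (use A in \<open>auto simp: indicator_def\<close>)
    then have "(\<integral>x. indicator A x * G x \<partial>lebesgue) = (\<integral>x. indicator S x * G x \<partial>lebesgue)"
      using Gi[OF Al] Gi[of S] A(4) by (intro integral_cong_AE) auto
    then show ?thesis using borel A(4) by simp
  qed
  have sets: "{x. 0 < G x} \<in> sets lebesgue" "{x. G x < 0} \<in> sets lebesgue"
    using Gm[unfolded borel_measurable_iff_greater] Gm[unfolded borel_measurable_iff_less] by simp_all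
  have "AE x in lebesgue. indicator {x. 0 < G x} x * G x = 0"
    using integral_nonneg_eq_0_iff_AE[OF Gi[OF sets(1)]] leb[OF sets(1)] by (auto simp: indicator_def)
  moreover have "AE x in lebesgue. - (indicator {x. G x < 0} x * G x) = 0"
    using integral_nonneg_eq_0_iff_AE[OF integrable_minus[OF Gi[OF sets(2)]]] leb[OF sets(2)]
    by (auto simp: indicator_def)
  ultimately show ?thesis
    by eventually_elim (auto simp: indicator_def split: if_splits)
qed

section \<open>Smooth bump functions on boxes\<close>

lemma Ck_mono: "Ck (Suc k) \<phi> \<Longrightarrow> Ck k \<phi>"
proof (induction k arbitrary: \<phi>)
  case 0
  then show ?case
    by (auto simp: continuous_on_eq_continuous_at intro: differentiable_imp_continuous_within)
qed auto

lemma partial_deriv_unique: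
  "(\<phi> has_derivative \<phi>') (at x) \<Longrightarrow> partial_deriv j \<phi> x = \<phi>' (axis j 1)"
  unfolding partial_deriv_def by (metis frechet_derivative_at)

lemma has_derivative_partial:
  "\<phi> differentiable (at x) \<Longrightarrow> (\<phi> has_derivative frechet_derivative \<phi> (at x)) (at x)"
  by (simp add: frechet_derivative_works)

lemma Ck_const: "Ck k (\<lambda>x. c)"
proof (induction k arbitrary: c)
  case (Suc k)
  have "partial_deriv j (\<lambda>x. c) = (\<lambda>x. 0)" for j
    by (rule ext, subst partial_deriv_unique[where \<phi>' = "\<lambda>h. 0"]) auto
  then show ?case using Suc by simp
qed simp

lemma Ck_add: "Ck k \<phi> \<Longrightarrow> Ck k \<psi> \<Longrightarrow> Ck k (\<lambda>x. \<phi> x + \<psi> x)"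
proof (induction k arbitrary: \<phi> \<psi>)
  case (Suc k)
  have "partial_deriv j (\<lambda>x. \<phi> x + \<psi> x) = (\<lambda>x. partial_deriv j \<phi> x + partial_deriv j \<psi> x)" for j
    using Suc.prems
    by (intro ext, subst partial_deriv_unique[OF has_derivative_add[OF has_derivative_partial has_derivative_partial]])
      (auto simp: partial_deriv_def)
  then show ?case using Suc by (auto intro!: derivative_intros)
qed (auto intro: continuous_intros)

lemma Ck_mult: "Ck k \<phi> \<Longrightarrow> Ck k \<psi> \<Longrightarrow> Ck k (\<lambda>x. \<phi> x * \<psi> x)"
proof (induction k arbitrary: \<phi> \<psi>)
  case (Suc k)
  have "partial_deriv j (\<lambda>x. \<phi> x * \<psi> x) = (\<lambda>x. \<phi> x * partial_deriv j \<psi> x + partial_deriv j \<phi> x * \<psi> x)" for j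
    using Suc.prems
    by (intro ext, subst partial_deriv_unique[OF has_derivative_mult[OF has_derivative_partial has_derivative_partial]])
      (auto simp: partial_deriv_def)
  then show ?case using Suc.prems Suc.IH Ck_mono[OF Suc.prems(1)] Ck_mono[OF Suc.prems(2)]
    by (auto intro!: derivative_intros Ck_add)
qed (auto intro: continuous_intros)

text \<open>The classical function exp(-1/x), flat at 0, divided by powers of \<open>x\<close>. The
  powers are included because the derivative of one member is a combination of the next two, so that
  smoothness follows by induction for the whole family at once.\<close>

definition flat_exp :: "nat \<Rightarrow> real \<Rightarrow> real" where
  "flat_exp n x = (if x > 0 then exp (- 1 / x) / x ^ n else 0)"

text \<open>With y = 1/x this is the decay of y^n / exp y at infinity.\<close>

lemma flat_exp_limit: "((\<lambda>x. flat_exp n x) \<longlongrightarrow> 0) (at_right 0)"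
proof -
  have "((\<lambda>x. inverse x ^ n / exp (inverse x)) \<longlongrightarrow> (0::real)) (at_right 0)"
    by (rule filterlim_compose[OF tendsto_power_div_exp_0 filterlim_inverse_at_top_right])
  moreover have "\<forall>\<^sub>F x in at_right 0. inverse x ^ n / exp (inverse x) = flat_exp n x"
    by (rule eventually_at_right_less[THEN eventually_mono])
      (simp add: flat_exp_def exp_minus field_simps)
  ultimately show ?thesis by (rule Lim_transform_eventually)
qed

lemma flat_exp_deriv:
  "(flat_exp n has_real_derivative - real n * flat_exp (Suc n) x + flat_exp (Suc (Suc n)) x) (at x)"
proof -
  consider "x > 0" | "x < 0" | "x = 0" by linarith
  then show ?thesis
  proof cases
    case 1
    have "((\<lambda>x. exp (- 1 / x) / x ^ n) has_real_derivative
        (exp (- 1 / x) * (1 / x^2) * x ^ n - exp (- 1 / x) * (real n * x ^ (n - 1))) / (x ^ n * x ^ n)) (at x)"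
      using 1 by (auto intro!: derivative_eq_intros simp: power2_eq_square)
    moreover have "(exp (- 1 / x) * (1 / x^2) * x ^ n - exp (- 1 / x) * (real n * x ^ (n - 1))) / (x ^ n * x ^ n)
        = - real n * flat_exp (Suc n) x + flat_exp (Suc (Suc n)) x"
      using 1 by (cases n) (auto simp: flat_exp_def field_simps power2_eq_square)
    moreover have "\<forall>\<^sub>F y in nhds x. exp (- 1 / y) / y ^ n = flat_exp n y"
      using eventually_nhds_in_open[of "{0<..}" x] 1 by (auto elim!: eventually_mono simp: flat_exp_def)
    ultimately show ?thesis using DERIV_cong_ev[OF refl _ refl] by fastforce
  next
    case 2
    have "\<forall>\<^sub>F y in nhds x. 0 = flat_exp n y"
      using eventually_nhds_in_open[of "{..<0}" x] 2 by (auto elim!: eventually_mono simp: flat_exp_def)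
    then have "(flat_exp n has_real_derivative 0) (at x)"
      using DERIV_cong_ev[OF refl, of "\<lambda>x. 0" "flat_exp n" x 0 0] by simp
    then show ?thesis using 2 by (simp add: flat_exp_def)
  next
    case 3
    \<comment> \<open>The right difference quotient at 0 is the next member of the family, which
      tends to 0; the left one is zero.\<close>
    have "((\<lambda>h. (flat_exp n (0 + h) - flat_exp n 0) / h) \<longlongrightarrow> 0) (at 0)"
    proof (rule filterlim_split_at)
      have "\<forall>\<^sub>F h in at_left 0. 0 = (flat_exp n (0 + h) - flat_exp n 0) / h"
        by (auto simp: eventually_at_filter flat_exp_def)
      then show "((\<lambda>h. (flat_exp n (0 + h) - flat_exp n 0) / h) \<longlongrightarrow> 0) (at_left 0)"
        by (rule Lim_transform_eventually[OF tendsto_const])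
      have "\<forall>\<^sub>F h in at_right 0. flat_exp (Suc n) h = (flat_exp n (0 + h) - flat_exp n 0) / h"
        by (auto simp: eventually_at_filter flat_exp_def)
      then show "((\<lambda>h. (flat_exp n (0 + h) - flat_exp n 0) / h) \<longlongrightarrow> 0) (at_right 0)"
        by (rule Lim_transform_eventually[OF flat_exp_limit])
    qed
    then show ?thesis using 3 by (simp add: DERIV_def flat_exp_def)
  qed
qed

text \<open>An affine function of one coordinate covers both opposite faces of a box and the scaling
  in \<open>box_bump\<close>. The exponent \<open>n\<close> varies in the induction because
  differentiation raises it.\<close>

lemma Ck_flat_exp: "Ck k (\<lambda>x. flat_exp n (\<alpha> * x $ i + \<beta>))"
proof (induction k arbitrary: n)
  case 0
  have "continuous_on UNIV (flat_exp n)"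
    by (meson flat_exp_deriv DERIV_isCont continuous_at_imp_continuous_on)
  then show ?case
    by (auto intro!: continuous_intros continuous_on_compose2[of UNIV "flat_exp n"])
next
  case (Suc k)
  have D: "((\<lambda>x. flat_exp n (\<alpha> * x $ i + \<beta>)) has_derivative
     (\<lambda>h. (\<alpha> * h $ i) * (- real n * flat_exp (Suc n) (\<alpha> * x $ i + \<beta>) + flat_exp (Suc (Suc n)) (\<alpha> * x $ i + \<beta>)))) (at x)" for x
    by (rule has_derivative_compose[OF _ flat_exp_deriv[THEN has_field_derivative_imp_has_derivative], THEN has_derivative_eq_rhs])
      (auto intro!: derivative_eq_intros bounded_linear_imp_has_derivative bounded_linear_vec_nth simp: mult_ac)
  have "partial_deriv j (\<lambda>x. flat_exp n (\<alpha> * x $ i + \<beta>)) =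
     (\<lambda>x. (if j = i then \<alpha> else 0) * (- real n * flat_exp (Suc n) (\<alpha> * x $ i + \<beta>) + flat_exp (Suc (Suc n)) (\<alpha> * x $ i + \<beta>)))" for j
    by (rule ext, subst partial_deriv_unique[OF D]) (auto simp: axis_def)
  moreover have "(\<lambda>x. flat_exp n (\<alpha> * x $ i + \<beta>)) differentiable (at x)" for x
    using D differentiable_def by blast
  moreover have "Ck k (\<lambda>x. c * (- real n * flat_exp (Suc n) (\<alpha> * x $ i + \<beta>) + flat_exp (Suc (Suc n)) (\<alpha> * x $ i + \<beta>)))" for c
    by (intro Ck_mult Ck_add Ck_const Suc.IH)
  ultimately show ?case by simp
qed

text \<open>One flat factor per face, vanishing beyond that face. Scaling by \<open>Suc n\<close>
  steepens the factors, so that the bumps tend to the indicator of the open box while their supports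
  stay in the closed box.\<close>

definition box_bump :: "real^2 \<Rightarrow> real^2 \<Rightarrow> nat \<Rightarrow> real^2 \<Rightarrow> real" where
  "box_bump a b n x =
     (flat_exp 0 (real (Suc n) * (x $ 1 - a $ 1)) * flat_exp 0 (real (Suc n) * (b $ 1 - x $ 1))) *
     (flat_exp 0 (real (Suc n) * (x $ 2 - a $ 2)) * flat_exp 0 (real (Suc n) * (b $ 2 - x $ 2)))"

lemma flat_exp_0_bounds: "0 \<le> flat_exp 0 x" "flat_exp 0 x \<le> 1"
  by (auto simp: flat_exp_def)

lemma box_bump_bounds: "0 \<le> box_bump a b n x" "box_bump a b n x \<le> 1"
  unfolding box_bump_def by (intro mult_nonneg_nonneg mult_le_one flat_exp_0_bounds)+

lemma mem_box_2: "x \<in> box a b \<longleftrightarrow> a $ 1 < x $ 1 \<and> x $ 1 < b $ 1 \<and> a $ 2 < x $ 2 \<and> x $ 2 < (b :: real^2) $ 2"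
  by (auto simp: mem_box_cart forall_2)

lemma box_bump_eq_0: "x \<notin> box a b \<Longrightarrow> box_bump a b n x = 0"
  by (auto simp: mem_box_2 box_bump_def flat_exp_def zero_less_mult_iff not_less)

lemma test_function_box_bump:
  assumes "cbox a b \<subseteq> \<Omega>"
  shows "test_function \<Omega> (box_bump a b n)"
proof -
  have "Ck k (box_bump a b n)" for k
  proof -
    have "box_bump a b n = (\<lambda>x. (flat_exp 0 (real (Suc n) * x $ 1 + - real (Suc n) * a $ 1) * flat_exp 0 (- real (Suc n) * x $ 1 + real (Suc n) * b $ 1)) *
       (flat_exp 0 (real (Suc n) * x $ 2 + - real (Suc n) * a $ 2) * flat_exp 0 (- real (Suc n) * x $ 2 + real (Suc n) * b $ 2)))"
      unfolding box_bump_def by (simp add: algebra_simps)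
    then show ?thesis by (simp only:) (intro Ck_mult Ck_flat_exp)
  qed
  moreover have "closure {x. box_bump a b n x \<noteq> 0} \<subseteq> cbox a b"
    using box_bump_eq_0 box_subset_cbox by (intro closure_minimal closed_cbox) blast
  moreover have "compact (closure {x. box_bump a b n x \<noteq> 0})"
    using calculation(2) bounded_subset[OF bounded_cbox] by (auto simp: compact_eq_bounded_closed)
  ultimately show ?thesis using assms by (auto simp: test_function_def)
qed

lemma box_bump_limit: "(\<lambda>n. box_bump a b n x) \<longlonglongrightarrow> indicator (box a b) x"
proof (cases "x \<in> box a b")
  case True
  have lim: "(\<lambda>n. flat_exp 0 (real (Suc n) * y)) \<longlonglongrightarrow> 1" if "y > 0" for y
  proof -
    have "(\<lambda>n. exp (- (inverse y * inverse (real (Suc n))))) \<longlonglongrightarrow> exp (- (inverse y * 0))"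
      by (intro tendsto_intros LIMSEQ_inverse_real_of_nat)
    moreover have "flat_exp 0 (real (Suc n) * y) = exp (- (inverse y * inverse (real (Suc n))))" for n
      using that by (simp add: flat_exp_def inverse_eq_divide mult.commute)
    ultimately show ?thesis by simp
  qed
  have "(\<lambda>n. box_bump a b n x) \<longlonglongrightarrow> (1 * 1) * (1 * 1)"
    unfolding box_bump_def using True by (intro tendsto_mult lim) (auto simp: mem_box_2)
  then show ?thesis using True by simp
qed (simp add: box_bump_eq_0)

section \<open>Elementary properties of test functions\<close>

lemma continuous_on_test_function: "test_function \<Omega> \<phi> \<Longrightarrow> continuous_on UNIV \<phi>"
  by (metis Ck.simps(1) test_function_def)

lemma test_function_differentiable: "test_function \<Omega> \<phi> \<Longrightarrow> \<phi> differentiable (at x)"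
  by (metis Ck.simps(2) test_function_def)

lemma continuous_on_partial_deriv: "test_function \<Omega> \<phi> \<Longrightarrow> continuous_on UNIV (partial_deriv j \<phi>)"
  by (metis Ck.simps test_function_def)

lemma test_function_zero: "test_function \<Omega> \<phi> \<Longrightarrow> x \<notin> \<Omega> \<Longrightarrow> \<phi> x = 0"
  using closure_subset[of "{x. \<phi> x \<noteq> 0}"] by (auto simp: test_function_def)

lemma partial_deriv_zero_outside_support:
  assumes "x \<notin> closure {x. \<phi> x \<noteq> 0}"
  shows "partial_deriv j \<phi> x = 0"
proof -
  have "(\<phi> has_derivative (\<lambda>h. 0)) (at x)"
  proof (rule has_derivative_transform_within_open)
    show "((\<lambda>x. 0) has_derivative (\<lambda>h. 0)) (at x)" by simp
    show "0 = \<phi> y" if "y \<in> - closure {x. \<phi> x \<noteq> 0}" for y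
      using that closure_subset[of "{x. \<phi> x \<noteq> 0}"] by auto
  qed (use assms in auto)
  then show ?thesis using partial_deriv_unique by fastforce
qed

lemma test_function_partial_deriv_zero: "test_function \<Omega> \<phi> \<Longrightarrow> x \<notin> \<Omega> \<Longrightarrow> partial_deriv j \<phi> x = 0"
  by (rule partial_deriv_zero_outside_support) (auto simp: test_function_def)

text \<open>Links \<open>partial_deriv\<close>, defined by the Frechet derivative, to derivatives
  along lines, in which integration by parts is phrased.\<close>

lemma test_function_directional_derivative:
  assumes "test_function \<Omega> \<phi>"
  shows "((\<lambda>h. \<phi> (x + h *\<^sub>R axis j 1)) has_real_derivative partial_deriv j \<phi> x) (at 0)"
proof -
  have D: "(\<phi> has_derivative frechet_derivative \<phi> (at x)) (at (x + 0 *\<^sub>R axis j 1))"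
    using test_function_differentiable[OF assms] by (simp add: frechet_derivative_works)
  have "((\<lambda>h. x + h *\<^sub>R axis j 1) has_derivative (\<lambda>h. h *\<^sub>R axis j 1)) (at (0::real))"
    by (auto intro!: derivative_eq_intros)
  from has_derivative_compose[OF this D]
  have "((\<lambda>h. \<phi> (x + h *\<^sub>R axis j 1)) has_derivative (\<lambda>h. frechet_derivative \<phi> (at x) (h *\<^sub>R axis j 1))) (at 0)" .
  moreover have "frechet_derivative \<phi> (at x) (h *\<^sub>R axis j 1) = h * partial_deriv j \<phi> x" for h
    using linear_frechet_derivative[OF test_function_differentiable[OF assms]]
    by (simp add: linear_scale partial_deriv_def)
  ultimately show ?thesis by (simp add: has_field_derivative_def mult_commute_abs)
qed

lemma test_function_bounded_support:
  assumes "test_function \<Omega> \<phi>"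
  shows "\<exists>R. \<forall>x. x \<notin> cball 0 R \<longrightarrow> \<phi> x = 0 \<and> (\<forall>j. partial_deriv j \<phi> x = 0)"
proof -
  have "bounded (closure {x. \<phi> x \<noteq> 0})"
    using assms compact_imp_bounded by (auto simp: test_function_def)
  then obtain R where R: "\<And>x. x \<in> closure {x. \<phi> x \<noteq> 0} \<Longrightarrow> norm x \<le> R"
    unfolding bounded_iff by blast
  show ?thesis
  proof (intro exI[of _ R] allI impI conjI)
    fix x :: "real^2" assume "x \<notin> cball 0 R"
    then have x: "x \<notin> closure {x. \<phi> x \<noteq> 0}" using R by (meson mem_cball_0)
    then show "\<phi> x = 0" using closure_subset[of "{x. \<phi> x \<noteq> 0}"] by auto
    show "partial_deriv j \<phi> x = 0" for j using partial_deriv_zero_outside_support[OF x] .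
  qed
qed

text \<open>The partial derivatives are continuous with bounded support, hence bounded, and the mean
  value inequality applies.\<close>

lemma test_function_lipschitz:
  assumes \<phi>: "test_function \<Omega> \<phi>"
  shows "\<exists>L. L-lipschitz_on UNIV \<phi>"
proof -
  obtain R where R: "x \<notin> cball 0 R \<Longrightarrow> partial_deriv j \<phi> x = 0" for x j
    using test_function_bounded_support[OF \<phi>] by metis
  have "\<exists>B\<ge>0. \<forall>x. \<bar>partial_deriv j \<phi> x\<bar> \<le> B" for j
  proof -
    have "continuous_on (cball 0 R) (partial_deriv j \<phi>)"
      by (rule continuous_on_subset[OF continuous_on_partial_deriv[OF \<phi>] subset_UNIV])
    then have "bounded (partial_deriv j \<phi> ` cball 0 R)"
      by (intro compact_imp_bounded compact_continuous_image compact_cball)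
    then obtain B where B: "B > 0" "\<forall>y\<in>partial_deriv j \<phi> ` cball 0 R. norm y \<le> B" unfolding bounded_pos by blast
    then have "\<bar>partial_deriv j \<phi> x\<bar> \<le> B" for x using R[of x j] by (cases "x \<in> cball 0 R") auto
    then show ?thesis using B(1) by (intro exI[of _ B]) auto
  qed
  then obtain B where B: "\<And>j. B j \<ge> 0" "\<And>j x. \<bar>partial_deriv j \<phi> x\<bar> \<le> B j" by metis
  have "(B 1 + B 2)-lipschitz_on UNIV \<phi>"
  proof (rule lipschitz_onI)
    fix x y :: "real^2"
    have "norm (\<phi> x - \<phi> y) \<le> (B 1 + B 2) * norm (x - y)"
    proof (rule differentiable_bound[OF convex_UNIV])
      fix z :: "real^2"
      show D: "(\<phi> has_derivative frechet_derivative \<phi> (at z)) (at z within UNIV)"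
        using test_function_differentiable[OF \<phi>] by (simp add: frechet_derivative_works)
      have lin: "linear (frechet_derivative \<phi> (at z))"
        using linear_frechet_derivative[OF test_function_differentiable[OF \<phi>]] .
      show "onorm (frechet_derivative \<phi> (at z)) \<le> B 1 + B 2"
      proof (rule onorm_le)
        fix h :: "real^2"
        have "h = h $ 1 *\<^sub>R axis 1 1 + h $ 2 *\<^sub>R axis 2 1"
          by (simp add: vec_eq_iff forall_2 axis_def)
        then have "frechet_derivative \<phi> (at z) h = frechet_derivative \<phi> (at z) (h $ 1 *\<^sub>R axis 1 1 + h $ 2 *\<^sub>R axis 2 1)"
          by (rule arg_cong)
        also have "\<dots> = h $ 1 * partial_deriv 1 \<phi> z + h $ 2 * partial_deriv 2 \<phi> z"
          by (simp only: linear_add[OF lin] linear_scale[OF lin] partial_deriv_def real_scaleR_def)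
        also have "\<bar>\<dots>\<bar> \<le> \<bar>h $ 1\<bar> * \<bar>partial_deriv 1 \<phi> z\<bar> + \<bar>h $ 2\<bar> * \<bar>partial_deriv 2 \<phi> z\<bar>"
          by (metis abs_mult abs_triangle_ineq)
        also have "\<dots> \<le> norm h * B 1 + norm h * B 2"
          by (intro add_mono mult_mono component_le_norm_cart B) auto
        finally show "norm (frechet_derivative \<phi> (at z) h) \<le> (B 1 + B 2) * norm h"
          by (simp add: algebra_simps)
      qed
    qed auto
    then show "dist (\<phi> x) (\<phi> y) \<le> (B 1 + B 2) * dist x y" by (simp add: dist_norm)
  qed (use B in simp)
  then show ?thesis by blast
qed

text \<open>Integrals over \<Omega> of functions that vanish off \<Omega> become integrals over the
  plane, where translation invariance is available.\<close>

lemma integral_lebesgue_on_eq_lborel: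
  assumes "\<Omega> \<in> sets borel" and f: "f \<in> borel_measurable borel" and 0: "\<And>x. x \<notin> \<Omega> \<Longrightarrow> f x = (0::real)"
  shows "(\<integral>x. f x \<partial>lebesgue_on \<Omega>) = (\<integral>x. f x \<partial>lborel)"
    "integrable (lebesgue_on \<Omega>) f \<longleftrightarrow> integrable lborel f"
proof -
  have *: "(\<lambda>x. indicator \<Omega> x *\<^sub>R f x) = f" using 0 by (auto simp: indicator_def fun_eq_iff)
  have "\<Omega> \<inter> space lebesgue \<in> sets lebesgue" using assms by simp
  note R = integral_restrict_space[OF this, of f] integrable_restrict_space[OF this, of f]
  show "(\<integral>x. f x \<partial>lebesgue_on \<Omega>) = (\<integral>x. f x \<partial>lborel)"
    using R(1) unfolding * using f by (simp add: integral_completion)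
  show "integrable (lebesgue_on \<Omega>) f \<longleftrightarrow> integrable lborel f"
    using R(2) unfolding * using f by (simp add: integrable_completion)
qed

text \<open>Bumps tend to indicators of boxes, so \<open>E\<close> integrates to zero over every box
  whose closure lies in \<Omega>. Inside such a box the box criterion applies, and countably many
  rational boxes cover \<Omega>.\<close>

lemma AE_zero_if_orthogonal_to_test_functions:
  assumes \<Omega>: "open \<Omega>" and E: "integrable (lebesgue_on \<Omega>) E"
    and orth: "\<And>\<phi>. test_function \<Omega> \<phi> \<Longrightarrow> (\<integral>x. E x * \<phi> x \<partial>lebesgue_on \<Omega>) = 0"
  shows "AE x in lebesgue_on \<Omega>. E x = (0::real)"
proof -
  have \<Omega>s: "\<Omega> \<in> sets lebesgue" "\<Omega> \<inter> space lebesgue \<in> sets lebesgue" using \<Omega> by auto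
  define G where "G x = indicator \<Omega> x *\<^sub>R E x" for x
  have G: "integrable lebesgue G" unfolding G_def using E integrable_restrict_space[OF \<Omega>s(2), of E] by simp
  have inner_box: "(\<integral>x. indicator (box a b) x * G x \<partial>lebesgue) = 0" if sub: "cbox a b \<subseteq> \<Omega>" for a b
  proof -
    have "(\<integral>x. box_bump a b n x * G x \<partial>lebesgue) = 0" for n
    proof -
      have "(\<integral>x. box_bump a b n x * G x \<partial>lebesgue) = (\<integral>x. indicator \<Omega> x *\<^sub>R (E x * box_bump a b n x) \<partial>lebesgue)"
        by (simp add: G_def mult_ac)
      also have "\<dots> = (\<integral>x. E x * box_bump a b n x \<partial>lebesgue_on \<Omega>)"
        by (rule integral_restrict_space[OF \<Omega>s(2), symmetric])
      finally show ?thesis using orth[OF test_function_box_bump[OF sub]] by simp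
    qed
    moreover have "(\<lambda>n. \<integral>x. box_bump a b n x * G x \<partial>lebesgue) \<longlonglongrightarrow> (\<integral>x. indicator (box a b) x * G x \<partial>lebesgue)"
    proof (rule integral_dominated_convergence[where w = "\<lambda>x. norm (G x)"])
      show "AE x in lebesgue. norm (box_bump a b n x * G x) \<le> norm (G x)" for n
        using box_bump_bounds[of a b n] by (intro AE_I2) (auto simp: abs_mult intro!: mult_left_le_one_le)
      show "AE x in lebesgue. (\<lambda>n. box_bump a b n x * G x) \<longlonglongrightarrow> indicator (box a b) x * G x"
        by (intro AE_I2 tendsto_intros box_bump_limit)
      have "box_bump a b n \<in> borel_measurable lebesgue" for n
        using continuous_on_test_function[OF test_function_box_bump[OF sub]]
        by (intro measurable_completion) (simp add: borel_measurable_continuous_onI)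
      then show "(\<lambda>x. box_bump a b n x * G x) \<in> borel_measurable lebesgue" for n
        using G by auto
      show "(\<lambda>x. indicator (box a b) x * G x) \<in> borel_measurable lebesgue"
        using G by (intro borel_measurable_times borel_measurable_indicator) auto
    qed (use G in auto)
    ultimately show ?thesis by (simp add: LIMSEQ_const_iff)
  qed
  have AE_box: "AE x in lebesgue. x \<in> cbox a b \<longrightarrow> G x = 0" if sub: "cbox a b \<subseteq> \<Omega>" for a b
  proof -
    have "AE x in lebesgue. indicator (box a b) x * G x = 0"
    proof (rule integral_boxes_zero_imp_AE_zero)
      show "integrable lebesgue (\<lambda>x. indicator (box a b) x * G x)"
        using integrable_mult_indicator[OF _ G, of "box a b"] by simp
      fix c d :: "real^2"
      obtain a' b' where ab: "box a b \<inter> box c d = box a' b'" by (simp add: box_Int_box)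
      \<comment> \<open>An empty open box may come with a nonempty closed box that leaves \<Omega>,
        hence the separate case.\<close>
      have "cbox a' b' \<subseteq> \<Omega> \<or> box a' b' = {}"
      proof (cases "box a' b' = {}")
        case False
        then have "cbox a' b' = closure (box a' b')" by (simp add: closure_box)
        also have "\<dots> \<subseteq> cbox a b" using ab box_subset_cbox[of a b] by (intro closure_minimal) auto
        finally show ?thesis using sub by blast
      qed simp
      then have "(\<integral>x. indicator (box a' b') x * G x \<partial>lebesgue) = 0" using inner_box by auto
      moreover have "indicator (box c d) x * (indicator (box a b) x * G x) = indicator (box a' b') x * G x" for x
        unfolding ab[symmetric] by (auto simp: indicator_def)
      ultimately show "(\<integral>x. indicator (box c d) x * (indicator (box a b) x * G x) \<partial>lebesgue) = 0" by (simp only:)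
    qed
    moreover have "AE x in lebesgue. x \<notin> cbox a b - box a b"
      by (intro AE_not_in) (metis negligible_iff_null_sets negligible_frontier_interval)
    ultimately show ?thesis by eventually_elim (auto simp: indicator_def)
  qed
  define a' :: "(real^2 \<Rightarrow> real \<times> real) \<Rightarrow> real^2" where "a' = (\<lambda>f. (\<Sum>i\<in>Basis. fst (f i) *\<^sub>R i))"
  define b' :: "(real^2 \<Rightarrow> real \<times> real) \<Rightarrow> real^2" where "b' = (\<lambda>f. (\<Sum>i\<in>Basis. snd (f i) *\<^sub>R i))"
  define I where "I = {f\<in>Basis \<rightarrow>\<^sub>E \<rat> \<times> \<rat>. cbox (a' f) (b' f) \<subseteq> \<Omega>}"
  have un: "\<Omega> = (\<Union>f\<in>I. cbox (a' f) (b' f))"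
    unfolding I_def a'_def b'_def by (rule open_UNION_cbox[OF \<Omega>])
  have "countable I" unfolding I_def
    by (rule countable_subset[OF _ countable_PiE, of _ Basis "\<lambda>_. \<rat> \<times> \<rat>"]) (auto simp: countable_rat)
  then have "AE x in lebesgue. \<forall>f\<in>I. x \<in> cbox (a' f) (b' f) \<longrightarrow> G x = 0"
    using AE_box by (subst AE_ball_countable) (auto simp: I_def)
  then have "AE x in lebesgue. x \<in> \<Omega> \<longrightarrow> E x = 0"
    by eventually_elim (use un in \<open>auto simp: G_def indicator_def split: if_splits\<close>)
  then show ?thesis using AE_restrict_space_iff[OF \<Omega>s(2)] by simp
qed

section \<open>Weak gradients and approximation by test functions\<close>

text \<open>The scalar counterpart of \<open>L2\<close> over any measure; vector and matrix fields
  are handled through their entries.\<close>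

definition square_integrable :: "'a measure \<Rightarrow> ('a \<Rightarrow> real) \<Rightarrow> bool" where
  "square_integrable M f \<longleftrightarrow> f \<in> borel_measurable M \<and> integrable M (\<lambda>x. (f x)\<^sup>2)"

text \<open>Young's inequality supplies the majorant
  \<open>(f x)\<^sup>2 + (g x)\<^sup>2\<close>.\<close>

lemma square_integrable_mult:
  assumes "square_integrable M f" "square_integrable M g"
  shows "integrable M (\<lambda>x. f x * g x)"
proof (rule Bochner_Integration.integrable_bound)
  show "integrable M (\<lambda>x. (f x)\<^sup>2 + (g x)\<^sup>2)" using assms by (simp add: square_integrable_def)
  show "AE x in M. norm (f x * g x) \<le> norm ((f x)\<^sup>2 + (g x)\<^sup>2)"
  proof (rule AE_I2)
    fix x
    have "2 * (\<bar>f x\<bar> * \<bar>g x\<bar>) \<le> (f x)\<^sup>2 + (g x)\<^sup>2"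
      using sum_squares_bound[of "\<bar>f x\<bar>" "\<bar>g x\<bar>"] by (simp add: mult.assoc)
    moreover have "0 \<le> \<bar>f x\<bar> * \<bar>g x\<bar>" by simp
    ultimately have "\<bar>f x\<bar> * \<bar>g x\<bar> \<le> (f x)\<^sup>2 + (g x)\<^sup>2" by linarith
    then show "norm (f x * g x) \<le> norm ((f x)\<^sup>2 + (g x)\<^sup>2)" by (simp add: abs_mult)
  qed
qed (use assms in \<open>auto simp: square_integrable_def\<close>)

lemma square_integrable_add:
  assumes "square_integrable M f" "square_integrable M g"
  shows "square_integrable M (\<lambda>x. f x + g x)"
  using assms square_integrable_mult[OF assms] unfolding square_integrable_def
  by (auto simp: power2_sum mult.assoc)

lemma square_integrable_cmult:
  "square_integrable M f \<Longrightarrow> square_integrable M (\<lambda>x. c * f x)"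
  unfolding square_integrable_def by (auto simp: power_mult_distrib)

lemma square_integrable_diff:
  assumes "square_integrable M f" "square_integrable M g"
  shows "square_integrable M (\<lambda>x. f x - g x)"
  using square_integrable_add[OF assms(1) square_integrable_cmult[OF assms(2), of "-1"]] by simp

lemma (in finite_measure) square_integrable_bounded:
  assumes "f \<in> borel_measurable M" "AE x in M. \<bar>f x\<bar> \<le> B"
  shows "square_integrable M f"
  unfolding square_integrable_def
proof
  show "integrable M (\<lambda>x. (f x)\<^sup>2)"
  proof (rule integrable_const_bound[where B = "B\<^sup>2"])
    show "AE x in M. norm ((f x)\<^sup>2) \<le> B\<^sup>2"
      using assms(2) by eventually_elim (simp add: abs_le_square_iff[symmetric])
  qed (use assms in simp)
qed fact

lemma (in finite_measure) square_integrable_imp_integrable: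
  assumes "square_integrable M f"
  shows "integrable M f"
  using square_integrable_mult[OF assms square_integrable_bounded[of "\<lambda>x. 1" 1]] by simp

text \<open>The Cauchy-Schwarz inequality against a constant, read off from the nonnegative integral
  of (|h| - c)^2. Adding 1 to the total mass keeps the division in \<open>c\<close> safe even for
  the zero measure.\<close>

lemma (in finite_measure) integral_abs_square_le:
  assumes "square_integrable M h"
  shows "(\<integral>x. \<bar>h x\<bar> \<partial>M)\<^sup>2 \<le> (measure M (space M) + 1) * (\<integral>x. (h x)\<^sup>2 \<partial>M)"
proof -
  define I where "I = (\<integral>x. \<bar>h x\<bar> \<partial>M)"
  define m where "m = measure M (space M) + 1"
  \<comment> \<open>This value maximises 2 c I - c^2 m, the maximum being I^2 / m.\<close>
  define c where "c = I / m"
  have m: "m > 0" unfolding m_def by (simp add: add_nonneg_pos)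
  have ints: "integrable M (\<lambda>x. \<bar>h x\<bar>)" "integrable M (\<lambda>x. (h x)\<^sup>2)"
    using square_integrable_imp_integrable[OF assms] assms by (auto simp: square_integrable_def)
  have "0 \<le> (\<integral>x. (\<bar>h x\<bar> - c)\<^sup>2 \<partial>M)" by simp
  also have "(\<integral>x. (\<bar>h x\<bar> - c)\<^sup>2 \<partial>M) = (\<integral>x. (h x)\<^sup>2 - (2 * c) * \<bar>h x\<bar> + c\<^sup>2 \<partial>M)"
    by (simp add: power2_diff mult_ac add.commute add_diff_eq)
  also have "\<dots> = (\<integral>x. (h x)\<^sup>2 \<partial>M) - 2 * c * I + c\<^sup>2 * (m - 1)"
    using ints by (simp add: I_def m_def)
  finally have "2 * c * I - c\<^sup>2 * m \<le> (\<integral>x. (h x)\<^sup>2 \<partial>M)"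
    by (simp add: algebra_simps) (use zero_le_power2[of c] in linarith)
  moreover have "2 * c * I - c\<^sup>2 * m = I\<^sup>2 / m"
    using m by (simp add: c_def power2_eq_square field_simps)
  ultimately have "I\<^sup>2 / m \<le> (\<integral>x. (h x)\<^sup>2 \<partial>M)" by simp
  then show ?thesis using m by (simp add: I_def m_def field_simps)
qed

text \<open>On a finite measure, convergence in square mean implies convergence in mean, which
  suffices against a bounded factor.\<close>

lemma (in finite_measure) L2_limit_integral:
  assumes f: "\<And>n. square_integrable M (f n)" and F: "square_integrable M F"
    and lim: "(\<lambda>n. \<integral>x. (f n x - F x)\<^sup>2 \<partial>M) \<longlonglongrightarrow> 0"
    and g: "g \<in> borel_measurable M" "AE x in M. \<bar>g x\<bar> \<le> B"
  shows "(\<lambda>n. \<integral>x. f n x * g x \<partial>M) \<longlonglongrightarrow> (\<integral>x. F x * g x \<partial>M)"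
proof -
  define m where "m = measure M (space M) + 1"
  have G: "square_integrable M g" using square_integrable_bounded[OF g] .
  have d: "square_integrable M (\<lambda>x. f n x - F x)" for n by (intro square_integrable_diff f F)
  \<comment> \<open>The modulus of \<open>B\<close> guards against a negative \<open>B\<close>,
    which the hypothesis admits on a space of measure zero.\<close>
  have bnd: "\<bar>(\<integral>x. f n x * g x \<partial>M) - (\<integral>x. F x * g x \<partial>M)\<bar> \<le> \<bar>B\<bar> * sqrt (m * (\<integral>x. (f n x - F x)\<^sup>2 \<partial>M))" for n
  proof -
    have "(\<integral>x. f n x * g x \<partial>M) - (\<integral>x. F x * g x \<partial>M) = (\<integral>x. (f n x - F x) * g x \<partial>M)"
      using square_integrable_mult[OF f G] square_integrable_mult[OF F G] by (simp add: left_diff_distrib)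
    also have "\<bar>\<dots>\<bar> \<le> (\<integral>x. \<bar>(f n x - F x) * g x\<bar> \<partial>M)" by (rule integral_abs_bound)
    also have "\<dots> \<le> (\<integral>x. \<bar>B\<bar> * \<bar>f n x - F x\<bar> \<partial>M)"
    proof (rule integral_mono_AE)
      show "integrable M (\<lambda>x. \<bar>(f n x - F x) * g x\<bar>)" using square_integrable_mult[OF d G] by simp
      show "integrable M (\<lambda>x. \<bar>B\<bar> * \<bar>f n x - F x\<bar>)" using square_integrable_imp_integrable[OF d] by simp
      show "AE x in M. \<bar>(f n x - F x) * g x\<bar> \<le> \<bar>B\<bar> * \<bar>f n x - F x\<bar>"
        using g(2)
      proof eventually_elim
        case (elim x)
        then have "\<bar>g x\<bar> * \<bar>f n x - F x\<bar> \<le> \<bar>B\<bar> * \<bar>f n x - F x\<bar>" by (intro mult_right_mono) auto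
        then show ?case by (simp add: abs_mult mult.commute)
      qed
    qed
    also have "\<dots> = \<bar>B\<bar> * (\<integral>x. \<bar>f n x - F x\<bar> \<partial>M)" by simp
    also have "\<dots> \<le> \<bar>B\<bar> * sqrt (m * (\<integral>x. (f n x - F x)\<^sup>2 \<partial>M))"
      using integral_abs_square_le[OF d] by (intro mult_left_mono real_le_rsqrt) (auto simp: m_def)
    finally show ?thesis .
  qed
  have "(\<lambda>n. \<bar>B\<bar> * sqrt (m * (\<integral>x. (f n x - F x)\<^sup>2 \<partial>M))) \<longlonglongrightarrow> \<bar>B\<bar> * sqrt (m * 0)"
    by (intro tendsto_intros lim)
  then have 0: "(\<lambda>n. \<bar>B\<bar> * sqrt (m * (\<integral>x. (f n x - F x)\<^sup>2 \<partial>M))) \<longlonglongrightarrow> 0" by simp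
  have "(\<lambda>n. (\<integral>x. f n x * g x \<partial>M) - (\<integral>x. F x * g x \<partial>M)) \<longlonglongrightarrow> 0"
  proof (rule Lim_null_comparison[OF always_eventually 0], rule allI)
    show "norm ((\<integral>x. f n x * g x \<partial>M) - (\<integral>x. F x * g x \<partial>M)) \<le> \<bar>B\<bar> * sqrt (m * (\<integral>x. (f n x - F x)\<^sup>2 \<partial>M))" for n
      using bnd[of n] unfolding real_norm_def .
  qed
  then show ?thesis by (simp add: LIM_zero_iff)
qed

section \<open>Square integrable fields through their entries\<close>

lemma L2_D:
  assumes "f \<in> L2 \<Omega>" shows "square_integrable (lebesgue_on \<Omega>) (\<lambda>x. norm (f x))"
    "f \<in> borel_measurable (lebesgue_on \<Omega>)"
  using assms by (auto simp: L2_def square_integrable_def)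

lemma square_integrable_dominated:
  assumes "square_integrable M g" "f \<in> borel_measurable M" "\<And>x. \<bar>f x\<bar> \<le> g x"
  shows "square_integrable M f"
  unfolding square_integrable_def
proof
  show "integrable M (\<lambda>x. (f x)\<^sup>2)"
  proof (rule Bochner_Integration.integrable_bound)
    show "integrable M (\<lambda>x. (g x)\<^sup>2)" using assms by (simp add: square_integrable_def)
    show "AE x in M. norm ((f x)\<^sup>2) \<le> norm ((g x)\<^sup>2)"
      using power_mono[OF assms(3) abs_ge_zero, of _ 2] by auto
  qed (use assms in simp)
qed fact

lemma L2_component:
  assumes "(f :: real^2 \<Rightarrow> real^2) \<in> L2 \<Omega>"
  shows "square_integrable (lebesgue_on \<Omega>) (\<lambda>x. f x $ i)"
proof (rule square_integrable_dominated[OF L2_D(1)[OF assms]])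
  show "(\<lambda>x. f x $ i) \<in> borel_measurable (lebesgue_on \<Omega>)"
    by (rule borel_measurable_continuous_on[OF _ L2_D(2)[OF assms]]) (intro continuous_intros)
  show "\<bar>f x $ i\<bar> \<le> norm (f x)" for x by (rule component_le_norm_cart)
qed

lemma borel_measurable_matrix_entry:
  assumes "(f :: 'a \<Rightarrow> real^2^2) \<in> borel_measurable M"
  shows "(\<lambda>x. f x $ i $ j) \<in> borel_measurable M"
proof -
  have "continuous_on UNIV (\<lambda>A :: real^2^2. A $ i $ j)" by (intro continuous_intros)
  then show ?thesis using assms by (rule borel_measurable_continuous_on)
qed

lemma L2_component2:
  assumes "(f :: real^2 \<Rightarrow> real^2^2) \<in> L2 \<Omega>"
  shows "square_integrable (lebesgue_on \<Omega>) (\<lambda>x. f x $ i $ j)"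
proof (rule square_integrable_dominated[OF L2_D(1)[OF assms]])
  show "(\<lambda>x. f x $ i $ j) \<in> borel_measurable (lebesgue_on \<Omega>)"
    using L2_D(2)[OF assms] by (rule borel_measurable_matrix_entry)
  show "\<bar>f x $ i $ j\<bar> \<le> norm (f x)" for x
    using component_le_norm_cart[of "f x $ i" j] Finite_Cartesian_Product.norm_nth_le[of "f x" i] by linarith
qed

lemma norm_vec_sq: "(norm (v :: 'a::real_inner^2))\<^sup>2 = (norm (v $ 1))\<^sup>2 + (norm (v $ 2))\<^sup>2"
  by (simp add: power2_norm_eq_inner inner_vec_def sum_2)

lemma L2_vecI:
  assumes "\<And>i. square_integrable (lebesgue_on \<Omega>) (\<lambda>x. f x $ i)"
  shows "(f :: real^2 \<Rightarrow> real^2) \<in> L2 \<Omega>"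
proof -
  have eq: "f = (\<lambda>x. f x $ 1 *\<^sub>R axis 1 1 + f x $ 2 *\<^sub>R axis 2 1)"
    by (auto simp: fun_eq_iff vec_eq_iff forall_2 axis_def)
  have m: "(\<lambda>x. f x $ i) \<in> borel_measurable (lebesgue_on \<Omega>)" for i
    using assms by (auto simp: square_integrable_def)
  have "(\<lambda>x. f x $ 1 *\<^sub>R axis 1 1 + f x $ 2 *\<^sub>R axis 2 1 :: real^2) \<in> borel_measurable (lebesgue_on \<Omega>)"
    by (intro borel_measurable_add borel_measurable_scaleR m borel_measurable_const)
  then show ?thesis using assms eq by (simp add: L2_def norm_vec_sq square_integrable_def)
qed

lemma L2_matI:
  assumes "\<And>i j. square_integrable (lebesgue_on \<Omega>) (\<lambda>x. f x $ i $ j)"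
  shows "(f :: real^2 \<Rightarrow> real^2^2) \<in> L2 \<Omega>"
proof -
  have eq: "f = (\<lambda>x. f x $ 1 $ 1 *\<^sub>R axis 1 (axis 1 1) + f x $ 1 $ 2 *\<^sub>R axis 1 (axis 2 1)
     + f x $ 2 $ 1 *\<^sub>R axis 2 (axis 1 1) + f x $ 2 $ 2 *\<^sub>R axis 2 (axis 2 1))"
    by (auto simp: fun_eq_iff vec_eq_iff forall_2 axis_def)
  have m: "(\<lambda>x. f x $ i $ j) \<in> borel_measurable (lebesgue_on \<Omega>)" for i j
    using assms by (auto simp: square_integrable_def)
  have "(\<lambda>x. f x $ 1 $ 1 *\<^sub>R axis 1 (axis 1 1) + f x $ 1 $ 2 *\<^sub>R axis 1 (axis 2 1)
     + f x $ 2 $ 1 *\<^sub>R axis 2 (axis 1 1) + f x $ 2 $ 2 *\<^sub>R axis 2 (axis 2 1) :: real^2^2) \<in> borel_measurable (lebesgue_on \<Omega>)"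
    by (intro borel_measurable_add borel_measurable_scaleR m borel_measurable_const)
  then show ?thesis using assms eq by (simp add: L2_def norm_vec_sq square_integrable_def)
qed

section \<open>Weak gradients on a bounded open set\<close>

locale bounded_open_domain =
  fixes \<Omega> :: "(real^2) set"
  assumes op: "open \<Omega>" and bd: "bounded \<Omega>"
begin

lemma lmeas: "\<Omega> \<in> lmeasurable"
  using op bd by (simp add: bounded_set_imp_lmeasurable)

sublocale fin: finite_measure "lebesgue_on \<Omega>"
  by (rule finite_measure_lebesgue_on[OF lmeas])

lemma measurable_lebesgue_on: "f \<in> borel_measurable borel \<Longrightarrow> f \<in> borel_measurable (lebesgue_on \<Omega>)"
  by (intro measurable_restrict_space1 measurable_completion) simp

lemma AE_lebesgue_onI: "AE x in lborel. P x \<Longrightarrow> AE x in lebesgue_on \<Omega>. P x"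
  using AE_restrict_space_iff[of \<Omega> lebesgue P] op by (auto intro: AE_completion elim: eventually_mono)

lemma continuous_bounded_support_square_integrable:
  assumes "continuous_on UNIV f" and "\<And>x. x \<notin> cball 0 R \<Longrightarrow> f x = 0"
  shows "square_integrable (lebesgue_on \<Omega>) f"
proof -
  have "bounded (f ` cball 0 R)"
    using continuous_on_subset[OF assms(1)]
    by (intro compact_imp_bounded compact_continuous_image compact_cball) blast
  then obtain B where "B > 0" "\<forall>y\<in>f ` cball 0 R. norm y \<le> B" unfolding bounded_pos by blast
  then have "\<bar>f x\<bar> \<le> B" for x using assms(2)[of x] by (cases "x \<in> cball 0 R") auto
  then show ?thesis
    by (intro fin.square_integrable_bounded[where B = B] measurable_lebesgue_on borel_measurable_continuous_onI assms AE_I2)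
qed

lemma test_function_square_integrable:
  assumes "test_function \<Omega> \<phi>"
  shows "square_integrable (lebesgue_on \<Omega>) \<phi>" "square_integrable (lebesgue_on \<Omega>) (partial_deriv j \<phi>)"
proof -
  obtain R where R: "\<forall>x. x \<notin> cball 0 R \<longrightarrow> \<phi> x = 0 \<and> (\<forall>j. partial_deriv j \<phi> x = 0)"
    using test_function_bounded_support[OF assms] by blast
  show "square_integrable (lebesgue_on \<Omega>) \<phi>"
    using R by (intro continuous_bounded_support_square_integrable[OF continuous_on_test_function[OF assms], of R]) blast
  show "square_integrable (lebesgue_on \<Omega>) (partial_deriv j \<phi>)"
    using R by (intro continuous_bounded_support_square_integrable[OF continuous_on_partial_deriv[OF assms], of R]) blast
qed

text \<open>The test function provides the compact support in \<Omega>; \<open>\<psi>\<close> may be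
  nonzero anywhere. It is applied to other test functions, to the product of a test function with a
  coordinate and, in the limit, to the cutoffs.\<close>

lemma integration_by_parts_test_function:
  assumes \<phi>: "test_function \<Omega> \<phi>" and \<psi>: "K-lipschitz_on UNIV \<psi>"
    and \<psi>': "AE x in lborel. ((\<lambda>h. \<psi> (x + h *\<^sub>R axis j 1)) has_real_derivative \<psi>' x) (at 0)"
    and [measurable]: "\<psi>' \<in> borel_measurable borel"
  shows "(\<integral>x. partial_deriv j \<phi> x * \<psi> x \<partial>lebesgue_on \<Omega>) = - (\<integral>x. \<phi> x * \<psi>' x \<partial>lebesgue_on \<Omega>)"
proof -
  obtain R where R: "\<forall>x. x \<notin> cball 0 R \<longrightarrow> \<phi> x = 0 \<and> (\<forall>j. partial_deriv j \<phi> x = 0)"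
    using test_function_bounded_support[OF \<phi>] by blast
  obtain L where L: "L-lipschitz_on UNIV \<phi>" using test_function_lipschitz[OF \<phi>] by blast
  have [measurable]: "partial_deriv j \<phi> \<in> borel_measurable borel" "\<phi> \<in> borel_measurable borel" "\<psi> \<in> borel_measurable borel"
    using continuous_on_partial_deriv[OF \<phi>] continuous_on_test_function[OF \<phi>] lipschitz_on_continuous_on[OF \<psi>]
    by (auto intro: borel_measurable_continuous_onI)
  have "(\<integral>x. partial_deriv j \<phi> x * \<psi> x \<partial>lborel) = - (\<integral>x. \<phi> x * \<psi>' x \<partial>lborel)"
    by (rule integration_by_parts_lipschitz[OF L \<psi>, where R = R])
      (use R test_function_directional_derivative[OF \<phi>] \<psi>' in auto)
  moreover have "(\<integral>x. partial_deriv j \<phi> x * \<psi> x \<partial>lebesgue_on \<Omega>) = (\<integral>x. partial_deriv j \<phi> x * \<psi> x \<partial>lborel)"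
    using op by (intro integral_lebesgue_on_eq_lborel) (auto simp: test_function_partial_deriv_zero[OF \<phi>])
  moreover have "(\<integral>x. \<phi> x * \<psi>' x \<partial>lebesgue_on \<Omega>) = (\<integral>x. \<phi> x * \<psi>' x \<partial>lborel)"
    using op by (intro integral_lebesgue_on_eq_lborel) (auto simp: test_function_zero[OF \<phi>])
  ultimately show ?thesis by simp
qed

text \<open>\<open>weak_grad\<close> is an arbitrary choice, so the classical gradient is first
  exhibited as one admissible candidate; \<open>is_weak_grad_unique\<close> then identifies
  candidates up to null sets.\<close>

lemma is_weak_grad_test_function:
  assumes "\<And>i. test_function \<Omega> (\<lambda>x. \<Phi> x $ i)"
  shows "is_weak_grad \<Omega> \<Phi> (\<lambda>x. \<chi> i j. partial_deriv j (\<lambda>x. \<Phi> x $ i) x)"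
  unfolding is_weak_grad_def
proof (intro conjI allI impI)
  show "(\<lambda>x. \<chi> i j. partial_deriv j (\<lambda>x. \<Phi> x $ i) x) \<in> L2 \<Omega>"
    by (rule L2_matI) (simp add: test_function_square_integrable[OF assms])
  fix \<phi> i j assume \<phi>: "test_function \<Omega> \<phi>"
  obtain L where L: "L-lipschitz_on UNIV \<phi>" using test_function_lipschitz[OF \<phi>] by blast
  have "(\<integral>x. partial_deriv j (\<lambda>x. \<Phi> x $ i) x * \<phi> x \<partial>lebesgue_on \<Omega>) = - (\<integral>x. \<Phi> x $ i * partial_deriv j \<phi> x \<partial>lebesgue_on \<Omega>)"
    by (rule integration_by_parts_test_function[OF assms L])
      (use test_function_directional_derivative[OF \<phi>] continuous_on_partial_deriv[OF \<phi>] in \<open>auto intro: borel_measurable_continuous_onI\<close>)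
  then show "(LINT x|lebesgue_on \<Omega>. \<Phi> x $ i * partial_deriv j \<phi> x)
          = - (LINT x|lebesgue_on \<Omega>. (\<chi> i j. partial_deriv j (\<lambda>x. \<Phi> x $ i) x) $ i $ j * \<phi> x)"
    by simp
qed

lemma is_weak_grad_diff:
  assumes u: "u \<in> L2 \<Omega>" "is_weak_grad \<Omega> u G" and v: "v \<in> L2 \<Omega>" "is_weak_grad \<Omega> v H"
  shows "is_weak_grad \<Omega> (\<lambda>x. u x - v x) (\<lambda>x. G x - H x)"
  unfolding is_weak_grad_def
proof (intro conjI allI impI)
  have GH: "G \<in> L2 \<Omega>" "H \<in> L2 \<Omega>" using u v by (auto simp: is_weak_grad_def)
  show "(\<lambda>x. G x - H x) \<in> L2 \<Omega>"
    by (rule L2_matI) (simp add: square_integrable_diff L2_component2 GH)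
  fix \<phi> i j assume \<phi>: "test_function \<Omega> \<phi>"
  note int1 = square_integrable_mult[OF L2_component[OF u(1)] test_function_square_integrable(2)[OF \<phi>], of i j]
    square_integrable_mult[OF L2_component[OF v(1)] test_function_square_integrable(2)[OF \<phi>], of i j]
  note int2 = square_integrable_mult[OF L2_component2[OF GH(1)] test_function_square_integrable(1)[OF \<phi>], of i j]
    square_integrable_mult[OF L2_component2[OF GH(2)] test_function_square_integrable(1)[OF \<phi>], of i j]
  have "(LINT x|lebesgue_on \<Omega>. u x $ i * partial_deriv j \<phi> x) = - (LINT x|lebesgue_on \<Omega>. G x $ i $ j * \<phi> x)"
    "(LINT x|lebesgue_on \<Omega>. v x $ i * partial_deriv j \<phi> x) = - (LINT x|lebesgue_on \<Omega>. H x $ i $ j * \<phi> x)"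
    using u v \<phi> by (auto simp: is_weak_grad_def)
  then show "(LINT x|lebesgue_on \<Omega>. (u x - v x) $ i * partial_deriv j \<phi> x)
          = - (LINT x|lebesgue_on \<Omega>. (G x - H x) $ i $ j * \<phi> x)"
    using int1 int2 by (simp add: left_diff_distrib)
qed

text \<open>Entry by entry, the difference of two candidates is orthogonal to all test
  functions.\<close>

lemma is_weak_grad_unique:
  assumes "is_weak_grad \<Omega> u G" "is_weak_grad \<Omega> u H"
  shows "AE x in lebesgue_on \<Omega>. G x = H x"
proof -
  have GH: "G \<in> L2 \<Omega>" "H \<in> L2 \<Omega>" using assms by (auto simp: is_weak_grad_def)
  have "AE x in lebesgue_on \<Omega>. G x $ i $ j - H x $ i $ j = 0" for i j
  proof (rule AE_zero_if_orthogonal_to_test_functions[OF op])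
    show "integrable (lebesgue_on \<Omega>) (\<lambda>x. G x $ i $ j - H x $ i $ j)"
      by (intro fin.square_integrable_imp_integrable square_integrable_diff L2_component2 GH)
    fix \<phi> assume \<phi>: "test_function \<Omega> \<phi>"
    have "(LINT x|lebesgue_on \<Omega>. G x $ i $ j * \<phi> x) = (LINT x|lebesgue_on \<Omega>. H x $ i $ j * \<phi> x)"
    proof -
      have "(LINT x|lebesgue_on \<Omega>. u x $ i * partial_deriv j \<phi> x) = - (LINT x|lebesgue_on \<Omega>. G x $ i $ j * \<phi> x)"
        "(LINT x|lebesgue_on \<Omega>. u x $ i * partial_deriv j \<phi> x) = - (LINT x|lebesgue_on \<Omega>. H x $ i $ j * \<phi> x)"
        using assms \<phi> by (simp_all add: is_weak_grad_def)
      then show ?thesis by linarith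
    qed
    then show "(LINT x|lebesgue_on \<Omega>. (G x $ i $ j - H x $ i $ j) * \<phi> x) = 0"
      using square_integrable_mult[OF L2_component2[OF GH(1)] test_function_square_integrable(1)[OF \<phi>], of i j]
        square_integrable_mult[OF L2_component2[OF GH(2)] test_function_square_integrable(1)[OF \<phi>], of i j]
      by (simp add: left_diff_distrib)
  qed
  then have "AE x in lebesgue_on \<Omega>. \<forall>i j. G x $ i $ j - H x $ i $ j = 0"
    by (simp add: forall_2)
  then show ?thesis by eventually_elim (simp add: vec_eq_iff)
qed

lemma weak_grad_zero: "AE x in lebesgue_on \<Omega>. weak_grad \<Omega> (\<lambda>x. 0) x = 0"
proof -
  have 0: "is_weak_grad \<Omega> (\<lambda>x. 0) (\<lambda>x. 0)" by (simp add: is_weak_grad_def L2_def)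
  then have "is_weak_grad \<Omega> (\<lambda>x. 0) (weak_grad \<Omega> (\<lambda>x. 0))"
    unfolding weak_grad_def by (rule someI[of "is_weak_grad \<Omega> (\<lambda>x. 0)"])
  then show ?thesis using is_weak_grad_unique[OF _ 0] by blast
qed

lemma H10_D:
  assumes "u \<in> H10 \<Omega>"
  shows "u \<in> L2 \<Omega>" "is_weak_grad \<Omega> u (weak_grad \<Omega> u)" "weak_grad \<Omega> u \<in> L2 \<Omega>"
proof -
  show "u \<in> L2 \<Omega>" using assms by (simp add: H10_def H1_def)
  show "is_weak_grad \<Omega> u (weak_grad \<Omega> u)"
    using assms someI_ex[of "is_weak_grad \<Omega> u"] unfolding weak_grad_def by (auto simp: H10_def H1_def)
  then show "weak_grad \<Omega> u \<in> L2 \<Omega>" by (simp add: is_weak_grad_def)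
qed

text \<open>Unpacks the \<open>H1_norm\<close> in the definition of \<open>H10\<close>, which
  involves a chosen weak gradient of the difference, into limits for the explicit partial
  derivatives of the approximants.\<close>

lemma H10_approximation:
  assumes u: "u \<in> H10 \<Omega>"
  shows "\<exists>\<Phi>. (\<forall>n i. test_function \<Omega> (\<lambda>x. \<Phi> n x $ i)) \<and>
    (\<forall>i. (\<lambda>n. \<integral>x. (\<Phi> n x $ i - u x $ i)\<^sup>2 \<partial>lebesgue_on \<Omega>) \<longlonglongrightarrow> 0) \<and>
    (\<forall>i j. (\<lambda>n. \<integral>x. (partial_deriv j (\<lambda>x. \<Phi> n x $ i) x - weak_grad \<Omega> u x $ i $ j)\<^sup>2 \<partial>lebesgue_on \<Omega>) \<longlonglongrightarrow> 0)"
proof -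
  obtain \<Phi> where \<Phi>: "\<And>n i. test_function \<Omega> (\<lambda>x. \<Phi> n x $ i)"
    and lim: "(\<lambda>n. H1_norm \<Omega> (\<lambda>x. \<Phi> n x - u x)) \<longlonglongrightarrow> 0"
    using u by (auto simp: H10_def)
  define D where "D n x = (\<chi> i j. partial_deriv j (\<lambda>x. \<Phi> n x $ i) x)" for n x
  define G where "G = weak_grad \<Omega> u"
  define w where "w n = (\<lambda>x. \<Phi> n x - u x)" for n
  have \<Phi>2: "\<Phi> n \<in> L2 \<Omega>" for n by (rule L2_vecI) (rule test_function_square_integrable[OF \<Phi>])
  have wg: "is_weak_grad \<Omega> (w n) (\<lambda>x. D n x - G x)" for n
    unfolding w_def D_def G_def
    by (rule is_weak_grad_diff[OF \<Phi>2 is_weak_grad_test_function[OF \<Phi>] H10_D(1,2)[OF u]])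
  then have "is_weak_grad \<Omega> (w n) (weak_grad \<Omega> (w n))" for n
    unfolding weak_grad_def by (rule someI[of "is_weak_grad \<Omega> (w n)"])
  then have ae: "AE x in lebesgue_on \<Omega>. weak_grad \<Omega> (w n) x = D n x - G x" for n
    by (rule is_weak_grad_unique[OF _ wg])
  have wL: "w n \<in> L2 \<Omega>" for n
    using \<Phi>2 H10_D(1)[OF u] by (intro L2_vecI) (auto simp: w_def intro!: square_integrable_diff L2_component)
  have dL: "(\<lambda>x. D n x - G x) \<in> L2 \<Omega>" for n using wg by (simp add: is_weak_grad_def)
  define A where "A n = (\<integral>x. (norm (w n x))\<^sup>2 \<partial>lebesgue_on \<Omega>)" for n
  define B where "B n = (\<integral>x. (norm (D n x - G x))\<^sup>2 \<partial>lebesgue_on \<Omega>)" for n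
  have AB: "A n \<ge> 0" "B n \<ge> 0" for n unfolding A_def B_def by simp_all
  have "H1_norm \<Omega> (w n) = sqrt (A n + B n)" for n
  proof -
    have "L2_inner \<Omega> (weak_grad \<Omega> (w n)) (weak_grad \<Omega> (w n)) = (\<integral>x. (norm (weak_grad \<Omega> (w n) x))\<^sup>2 \<partial>lebesgue_on \<Omega>)"
      by (simp add: L2_inner_def power2_norm_eq_inner)
    also have "\<dots> = B n" unfolding B_def
    proof (rule integral_cong_AE)
      show "(\<lambda>x. (norm (weak_grad \<Omega> (w n) x))\<^sup>2) \<in> borel_measurable (lebesgue_on \<Omega>)"
        using \<open>is_weak_grad \<Omega> (w n) (weak_grad \<Omega> (w n))\<close> by (auto simp: is_weak_grad_def L2_def)
      show "(\<lambda>x. (norm (D n x - G x))\<^sup>2) \<in> borel_measurable (lebesgue_on \<Omega>)"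
        using dL[of n] by (auto simp: L2_def)
    qed (use ae[of n] in \<open>auto elim: eventually_mono\<close>)
    finally show ?thesis unfolding H1_norm_def A_def by (simp add: L2_inner_def power2_norm_eq_inner)
  qed
  then have "(\<lambda>n. sqrt (A n + B n)) \<longlonglongrightarrow> 0" using lim by (simp add: w_def)
  then have "(\<lambda>n. (sqrt (A n + B n))\<^sup>2) \<longlonglongrightarrow> 0\<^sup>2" by (rule tendsto_power)
  then have S: "(\<lambda>n. A n + B n) \<longlonglongrightarrow> 0" using AB by simp
  have c1: "(\<integral>x. (\<Phi> n x $ i - u x $ i)\<^sup>2 \<partial>lebesgue_on \<Omega>) \<le> A n + B n" for n i
  proof -
    have "(\<integral>x. (\<Phi> n x $ i - u x $ i)\<^sup>2 \<partial>lebesgue_on \<Omega>) \<le> A n" unfolding A_def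
    proof (rule integral_mono)
      show "integrable (lebesgue_on \<Omega>) (\<lambda>x. (\<Phi> n x $ i - u x $ i)\<^sup>2)"
        using L2_component[OF wL] by (simp add: square_integrable_def w_def)
      show "integrable (lebesgue_on \<Omega>) (\<lambda>x. (norm (w n x))\<^sup>2)" using wL by (simp add: L2_def)
      show "(\<Phi> n x $ i - u x $ i)\<^sup>2 \<le> (norm (w n x))\<^sup>2" for x
        using component_le_norm_cart[of "w n x" i] by (simp add: w_def abs_le_square_iff[symmetric])
    qed
    then show ?thesis using AB(2)[of n] by linarith
  qed
  have c2: "(\<integral>x. (D n x $ i $ j - G x $ i $ j)\<^sup>2 \<partial>lebesgue_on \<Omega>) \<le> A n + B n" for n i j
  proof -
    have "(\<integral>x. (D n x $ i $ j - G x $ i $ j)\<^sup>2 \<partial>lebesgue_on \<Omega>) \<le> B n" unfolding B_def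
    proof (rule integral_mono)
      show "integrable (lebesgue_on \<Omega>) (\<lambda>x. (D n x $ i $ j - G x $ i $ j)\<^sup>2)"
        using L2_component2[OF dL] by (simp add: square_integrable_def)
      show "integrable (lebesgue_on \<Omega>) (\<lambda>x. (norm (D n x - G x))\<^sup>2)" using dL by (simp add: L2_def)
      show "(D n x $ i $ j - G x $ i $ j)\<^sup>2 \<le> (norm (D n x - G x))\<^sup>2" for x
        using component_le_norm_cart[of "(D n x - G x) $ i" j] Finite_Cartesian_Product.norm_nth_le[of "D n x - G x" i]
        by (simp add: abs_le_square_iff[symmetric])
    qed
    then show ?thesis using AB(1)[of n] by linarith
  qed
  show ?thesis
  proof (intro exI[of _ \<Phi>] conjI allI)
    show "(\<lambda>n. \<integral>x. (\<Phi> n x $ i - u x $ i)\<^sup>2 \<partial>lebesgue_on \<Omega>) \<longlonglongrightarrow> 0" for i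
      by (rule tendsto_sandwich[OF _ _ tendsto_const S]) (use c1 in \<open>auto intro: always_eventually\<close>)
    show "(\<lambda>n. \<integral>x. (partial_deriv j (\<lambda>x. \<Phi> n x $ i) x - weak_grad \<Omega> u x $ i $ j)\<^sup>2 \<partial>lebesgue_on \<Omega>) \<longlonglongrightarrow> 0" for i j
      by (rule tendsto_sandwich[OF _ _ tendsto_const S]) (use c2[of _ i j] in \<open>auto intro: always_eventually simp: D_def G_def\<close>)
  qed (rule \<Phi>)
qed

end

section \<open>Integration by parts and zero boundary values\<close>

context bounded_open_domain begin

text \<open>No boundary term arises although \<open>\<psi>\<close> need not vanish at the boundary,
  because the approximating test functions do. The limit requires \<open>\<psi>\<close> and
  \<open>\<psi>'\<close> to be bounded on \<Omega>: the former is so because \<Omega> is bounded,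
  the latter by the Lipschitz constant.\<close>

lemma H10_integration_by_parts:
  assumes u: "u \<in> H10 \<Omega>" and \<psi>: "K-lipschitz_on UNIV \<psi>"
    and \<psi>': "AE x in lborel. ((\<lambda>h. \<psi> (x + h *\<^sub>R axis j 1)) has_real_derivative \<psi>' x) (at 0)"
    and [measurable]: "\<psi>' \<in> borel_measurable borel"
  shows "(\<integral>x. weak_grad \<Omega> u x $ i $ j * \<psi> x \<partial>lebesgue_on \<Omega>) = - (\<integral>x. u x $ i * \<psi>' x \<partial>lebesgue_on \<Omega>)"
proof -
  obtain \<Phi> where \<Phi>: "test_function \<Omega> (\<lambda>x. \<Phi> n x $ i)"
    and lim: "(\<lambda>n. \<integral>x. (\<Phi> n x $ i - u x $ i)\<^sup>2 \<partial>lebesgue_on \<Omega>) \<longlonglongrightarrow> 0"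
    "(\<lambda>n. \<integral>x. (partial_deriv j (\<lambda>x. \<Phi> n x $ i) x - weak_grad \<Omega> u x $ i $ j)\<^sup>2 \<partial>lebesgue_on \<Omega>) \<longlonglongrightarrow> 0" for n i j
    using H10_approximation[OF u] by blast
  obtain R where R: "\<And>x. x \<in> \<Omega> \<Longrightarrow> norm x \<le> R" using bd unfolding bounded_iff by blast
  obtain B where B: "\<forall>x\<in>cball 0 R. \<bar>\<psi> x\<bar> \<le> B"
    using bounded_support_lipschitz_bounded[OF \<psi>] by blast
  have \<psi>m: "\<psi> \<in> borel_measurable (lebesgue_on \<Omega>)"
    by (intro measurable_lebesgue_on borel_measurable_continuous_onI lipschitz_on_continuous_on[OF \<psi>])
  have \<psi>b: "AE x in lebesgue_on \<Omega>. \<bar>\<psi> x\<bar> \<le> B"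
    using B R by (intro AE_I2) (simp add: space_restrict_space)
  have \<psi>'b: "AE x in lebesgue_on \<Omega>. \<bar>\<psi>' x\<bar> \<le> K * norm (axis j 1 :: real^2)"
    by (rule AE_lebesgue_onI, rule eventually_mono[OF \<psi>'], rule lipschitz_directional_derivative_bound[OF \<psi>])
  have A: "(\<lambda>n. \<integral>x. partial_deriv j (\<lambda>x. \<Phi> n x $ i) x * \<psi> x \<partial>lebesgue_on \<Omega>) \<longlonglongrightarrow> (\<integral>x. weak_grad \<Omega> u x $ i $ j * \<psi> x \<partial>lebesgue_on \<Omega>)"
    by (rule fin.L2_limit_integral[OF test_function_square_integrable(2)[OF \<Phi>] L2_component2[OF H10_D(3)[OF u]] lim(2) \<psi>m \<psi>b])
  have B: "(\<lambda>n. - (\<integral>x. \<Phi> n x $ i * \<psi>' x \<partial>lebesgue_on \<Omega>)) \<longlonglongrightarrow> - (\<integral>x. u x $ i * \<psi>' x \<partial>lebesgue_on \<Omega>)"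
    by (rule tendsto_minus, rule fin.L2_limit_integral[OF test_function_square_integrable(1)[OF \<Phi>] L2_component[OF H10_D(1)[OF u]] lim(1) _ \<psi>'b])
      (rule measurable_lebesgue_on, measurable)
  have "(\<integral>x. partial_deriv j (\<lambda>x. \<Phi> n x $ i) x * \<psi> x \<partial>lebesgue_on \<Omega>) = - (\<integral>x. \<Phi> n x $ i * \<psi>' x \<partial>lebesgue_on \<Omega>)" for n
    by (rule integration_by_parts_test_function[OF \<Phi> \<psi> \<psi>']) measurable
  then show ?thesis using A B LIMSEQ_unique by simp
qed

lemma integral_weak_grad_zero:
  assumes u: "u \<in> H10 \<Omega>"
  shows "(\<integral>x. weak_grad \<Omega> u x $ i $ j \<partial>lebesgue_on \<Omega>) = 0"
  using H10_integration_by_parts[OF u, of 0 "\<lambda>x. 1" j "\<lambda>x. 0" i] by (simp add: lipschitz_on_def)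

text \<open>The key identity is \<open>\<integral> \<phi>\<^sup>2 = - 2 \<integral> x\<^sub>k \<phi> \<partial>\<^sub>k\<phi>\<close> for test functions.\<close>

lemma H10_zero_if_diagonal_derivative_zero:
  assumes u: "u \<in> H10 \<Omega>" and 0: "AE x in lebesgue_on \<Omega>. weak_grad \<Omega> u x $ k $ k = 0"
  shows "AE x in lebesgue_on \<Omega>. u x $ k = 0"
proof -
  let ?M = "lebesgue_on \<Omega>"
  obtain \<Phi> where \<Phi>: "test_function \<Omega> (\<lambda>x. \<Phi> n x $ i)"
    and lim: "(\<lambda>n. \<integral>x. (\<Phi> n x $ i - u x $ i)\<^sup>2 \<partial>?M) \<longlonglongrightarrow> 0"
    "(\<lambda>n. \<integral>x. (partial_deriv j (\<lambda>x. \<Phi> n x $ i) x - weak_grad \<Omega> u x $ i $ j)\<^sup>2 \<partial>?M) \<longlonglongrightarrow> 0" for n i j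
    using H10_approximation[OF u] by blast
  obtain R where R: "\<And>x. x \<in> \<Omega> \<Longrightarrow> norm x \<le> R" using bd unfolding bounded_iff by blast
  define \<phi> where "\<phi> n = (\<lambda>x. \<Phi> n x $ k)" for n
  have \<phi>: "test_function \<Omega> (\<phi> n)" for n using \<Phi> by (simp add: \<phi>_def)
  have lip1: "1-lipschitz_on UNIV (\<lambda>x :: real^2. x $ k)"
    by (rule lipschitz_onI) (auto simp: dist_norm simp flip: vector_minus_component intro: component_le_norm_cart)
  have der1: "((\<lambda>h. (x + h *\<^sub>R axis k 1) $ k) has_real_derivative 1) (at 0)" for x :: "real^2"
    by (auto intro!: derivative_eq_intros)
  have sq\<phi>: "square_integrable ?M (\<phi> n)" "square_integrable ?M (partial_deriv k (\<phi> n))" for n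
    using test_function_square_integrable[OF \<phi>] by blast+
  have bound: "(\<integral>x. (\<phi> n x)\<^sup>2 \<partial>?M) \<le> 4 * R\<^sup>2 * (\<integral>x. (partial_deriv k (\<phi> n) x)\<^sup>2 \<partial>?M)" for n
  proof -
    obtain S where S: "\<forall>x. x \<notin> cball 0 S \<longrightarrow> \<phi> n x = 0 \<and> (\<forall>j. partial_deriv j (\<phi> n) x = 0)"
      using test_function_bounded_support[OF \<phi>] by blast
    obtain L where L: "L-lipschitz_on UNIV (\<phi> n)" using test_function_lipschitz[OF \<phi>] by blast
    obtain L' where L': "L'-lipschitz_on UNIV (\<lambda>x. \<phi> n x * x $ k)"
      using lipschitz_on_mult_bounded_support[OF L lip1, of S] S by blast
    have der: "((\<lambda>h. \<phi> n (x + h *\<^sub>R axis k 1) * (x + h *\<^sub>R axis k 1) $ k) has_real_derivative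
        partial_deriv k (\<phi> n) x * x $ k + \<phi> n x) (at 0)" for x
      using DERIV_mult[OF test_function_directional_derivative[OF \<phi>, of n x k] der1[of x]] by (simp add: add.commute)
    have m: "(\<lambda>x. partial_deriv k (\<phi> n) x * x $ k + \<phi> n x) \<in> borel_measurable borel"
      by (intro borel_measurable_continuous_onI continuous_intros continuous_on_partial_deriv[OF \<phi>] continuous_on_test_function[OF \<phi>])
    have ibp: "(\<integral>x. partial_deriv k (\<phi> n) x * (\<phi> n x * x $ k) \<partial>?M) = - (\<integral>x. \<phi> n x * (partial_deriv k (\<phi> n) x * x $ k + \<phi> n x) \<partial>?M)"
      by (rule integration_by_parts_test_function[OF \<phi> L' _ m]) (rule AE_I2, rule der)
    define P where "P x = \<phi> n x * (partial_deriv k (\<phi> n) x * x $ k)" for x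
    have xk: "square_integrable ?M (\<lambda>x. partial_deriv k (\<phi> n) x * x $ k)"
    proof (rule continuous_bounded_support_square_integrable)
      show "continuous_on UNIV (\<lambda>x. partial_deriv k (\<phi> n) x * x $ k)"
        by (intro continuous_intros continuous_on_partial_deriv[OF \<phi>])
      show "x \<notin> cball 0 S \<Longrightarrow> partial_deriv k (\<phi> n) x * x $ k = 0" for x using S by simp
    qed
    have Pint: "integrable ?M P" unfolding P_def by (rule square_integrable_mult[OF sq\<phi>(1) xk])
    have sq: "integrable ?M (\<lambda>x. (\<phi> n x)\<^sup>2)" "integrable ?M (\<lambda>x. (partial_deriv k (\<phi> n) x)\<^sup>2)"
      using sq\<phi>[of n] by (simp_all add: square_integrable_def)
    have "(\<lambda>x. partial_deriv k (\<phi> n) x * (\<phi> n x * x $ k)) = P"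
      "(\<lambda>x. \<phi> n x * (partial_deriv k (\<phi> n) x * x $ k + \<phi> n x)) = (\<lambda>x. P x + (\<phi> n x)\<^sup>2)"
      by (simp_all add: fun_eq_iff P_def distrib_left power2_eq_square mult_ac)
    then have "(\<integral>x. P x \<partial>?M) = - ((\<integral>x. P x \<partial>?M) + (\<integral>x. (\<phi> n x)\<^sup>2 \<partial>?M))"
      using ibp Bochner_Integration.integral_add[OF Pint sq(1)] by simp
    then have "(\<integral>x. (\<phi> n x)\<^sup>2 \<partial>?M) = (\<integral>x. - 2 * P x \<partial>?M)" by simp
    \<comment> \<open>Young's inequality, weighted so that half of the left-hand integral can be
      absorbed; this leaves the constant 4 R^2 of \<open>bound\<close>.\<close>
    also have "\<dots> \<le> (\<integral>x. (\<phi> n x)\<^sup>2 / 2 + 2 * R\<^sup>2 * (partial_deriv k (\<phi> n) x)\<^sup>2 \<partial>?M)"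
    proof (rule integral_mono)
      fix x assume "x \<in> space ?M"
      then have "norm x \<le> R" using R by (simp add: space_restrict_space)
      then have xR: "(x $ k)\<^sup>2 \<le> R\<^sup>2"
        using component_le_norm_cart[of x k] by (simp add: abs_le_square_iff[symmetric])
      have "- 2 * P x \<le> (\<phi> n x)\<^sup>2 / 2 + 2 * ((x $ k)\<^sup>2 * (partial_deriv k (\<phi> n) x)\<^sup>2)"
        using zero_le_power2[of "\<phi> n x + 2 * (partial_deriv k (\<phi> n) x * x $ k)"]
        by (simp add: P_def power2_eq_square algebra_simps)
      moreover have "(x $ k)\<^sup>2 * (partial_deriv k (\<phi> n) x)\<^sup>2 \<le> R\<^sup>2 * (partial_deriv k (\<phi> n) x)\<^sup>2"
        by (intro mult_right_mono xR) simp
      ultimately show "- 2 * P x \<le> (\<phi> n x)\<^sup>2 / 2 + 2 * R\<^sup>2 * (partial_deriv k (\<phi> n) x)\<^sup>2" by linarith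
    qed (use sq Pint in auto)
    also have "\<dots> = (\<integral>x. (\<phi> n x)\<^sup>2 \<partial>?M) / 2 + 2 * R\<^sup>2 * (\<integral>x. (partial_deriv k (\<phi> n) x)\<^sup>2 \<partial>?M)"
      using sq by simp
    finally show ?thesis by simp
  qed
  have gradlim: "(\<lambda>n. \<integral>x. (partial_deriv k (\<phi> n) x)\<^sup>2 \<partial>?M) \<longlonglongrightarrow> 0"
  proof -
    have "(\<integral>x. (partial_deriv k (\<phi> n) x)\<^sup>2 \<partial>?M) = (\<integral>x. (partial_deriv k (\<phi> n) x - weak_grad \<Omega> u x $ k $ k)\<^sup>2 \<partial>?M)" for n
    proof (rule integral_cong_AE)
      show "(\<lambda>x. (partial_deriv k (\<phi> n) x)\<^sup>2) \<in> borel_measurable ?M"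
        using sq\<phi>[of n] by (auto simp: square_integrable_def)
      show "(\<lambda>x. (partial_deriv k (\<phi> n) x - weak_grad \<Omega> u x $ k $ k)\<^sup>2) \<in> borel_measurable ?M"
        using square_integrable_diff[OF sq\<phi>(2)[of n] L2_component2[OF H10_D(3)[OF u]]] by (auto simp: square_integrable_def)
    qed (use 0 in \<open>auto elim: eventually_mono\<close>)
    then show ?thesis using lim(2)[of k k] by (simp add: \<phi>_def)
  qed
  have "(\<lambda>n. 2 * (4 * R\<^sup>2 * (\<integral>x. (partial_deriv k (\<phi> n) x)\<^sup>2 \<partial>?M)) + 2 * (\<integral>x. (\<phi> n x - u x $ k)\<^sup>2 \<partial>?M)) \<longlonglongrightarrow> 2 * (4 * R\<^sup>2 * 0) + 2 * 0"
    unfolding \<phi>_def by (intro tendsto_intros lim gradlim[unfolded \<phi>_def])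
  \<comment> \<open>The limit \<open>u\<close> is compared with its approximants by u^2 \<le> 2
    \<phi>^2 + 2 (\<phi> - u)^2, and \<open>bound\<close> controls the first term by the vanishing
    derivatives.\<close>
  moreover have "(\<integral>x. (u x $ k)\<^sup>2 \<partial>?M) \<le> 2 * (4 * R\<^sup>2 * (\<integral>x. (partial_deriv k (\<phi> n) x)\<^sup>2 \<partial>?M)) + 2 * (\<integral>x. (\<phi> n x - u x $ k)\<^sup>2 \<partial>?M)" for n
  proof -
    have ints: "integrable ?M (\<lambda>x. (\<phi> n x)\<^sup>2)" "integrable ?M (\<lambda>x. (u x $ k)\<^sup>2)" "integrable ?M (\<lambda>x. (\<phi> n x - u x $ k)\<^sup>2)"
      using sq\<phi>(1)[of n] L2_component[OF H10_D(1)[OF u], of k] square_integrable_diff[OF sq\<phi>(1)[of n] L2_component[OF H10_D(1)[OF u]], of k]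
      by (simp_all add: square_integrable_def)
    have "(\<integral>x. (u x $ k)\<^sup>2 \<partial>?M) \<le> (\<integral>x. 2 * (\<phi> n x)\<^sup>2 + 2 * (\<phi> n x - u x $ k)\<^sup>2 \<partial>?M)"
    proof (rule integral_mono)
      show "(u x $ k)\<^sup>2 \<le> 2 * (\<phi> n x)\<^sup>2 + 2 * (\<phi> n x - u x $ k)\<^sup>2" for x
        using zero_le_power2[of "2 * \<phi> n x - u x $ k"] by (simp add: power2_eq_square algebra_simps)
    qed (use ints in auto)
    also have "\<dots> = 2 * (\<integral>x. (\<phi> n x)\<^sup>2 \<partial>?M) + 2 * (\<integral>x. (\<phi> n x - u x $ k)\<^sup>2 \<partial>?M)" using ints by simp
    finally show ?thesis using bound[of n] by linarith
  qed
  ultimately have "(\<integral>x. (u x $ k)\<^sup>2 \<partial>?M) \<le> 0"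
    by (intro LIMSEQ_le_const[of _ 0]) auto
  then have "(\<integral>x. (u x $ k)\<^sup>2 \<partial>?M) = 0" by (intro antisym Bochner_Integration.integral_nonneg) auto
  then have "AE x in ?M. (u x $ k)\<^sup>2 = 0"
    using L2_component[OF H10_D(1)[OF u], of k]
    by (subst integral_nonneg_eq_0_iff_AE[symmetric]) (auto simp: square_integrable_def)
  then show ?thesis by simp
qed

text \<open>The part of \<Omega> where \<open>u\<close> is nonzero is open and null, hence empty;
  continuity then reaches the closure.\<close>

lemma continuous_AE_zero_imp_zero_on_closure:
  assumes "continuous_on (closure \<Omega>) u" and ae: "AE x in lebesgue_on \<Omega>. u x = (0 :: real^2)"
  shows "\<forall>x\<in>closure \<Omega>. u x = 0"
proof -
  define Z where "Z = \<Omega> \<inter> {x. u x \<noteq> 0}"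
  have "continuous_on \<Omega> u" using assms(1) closure_subset continuous_on_subset by blast
  then have "open (\<Omega> \<inter> u -` (- {0}))" by (intro continuous_open_preimage op) auto
  then have Zo: "open Z" by (simp add: Z_def vimage_def)
  have "AE x in lebesgue. x \<in> \<Omega> \<longrightarrow> u x = 0"
    using ae AE_restrict_space_iff[of \<Omega> lebesgue "\<lambda>x. u x = 0"] op by simp
  then have "AE x in lebesgue. x \<notin> Z" by eventually_elim (simp add: Z_def)
  then have "Z \<in> null_sets lebesgue"
    using Zo by (subst (asm) AE_iff_null_sets[symmetric]) auto
  then have "negligible Z" by (simp add: negligible_iff_null_sets)
  then have "Z = {}" using Zo open_not_negligible by blast
  then have "\<Omega> \<subseteq> {x. u x = 0}" by (auto simp: Z_def)
  then show ?thesis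
    using continuous_constant_on_closure[OF assms(1), of 0] by blast
qed

text \<open>Testing with the cone \<open>max 0 (\<rho> - dist x x0)\<close>: if \<open>u x0 \<noteq> 0\<close>, the term with \<open>u\<close> is at least of
  order \<open>\<rho>\<^sup>2\<close>, while the term with the square integrable gradient is \<open>o(\<rho>\<^sup>2)\<close>.\<close>

lemma H10_zero_at_one_sided_boundary_point:
  assumes u: "u \<in> H10 \<Omega>" and cont: "continuous_on (closure \<Omega>) u"
    and x0: "x0 \<in> closure \<Omega>" and \<epsilon>: "\<epsilon> > 0" and n: "norm n = 1"
    and inside: "\<And>z. z \<in> ball x0 \<epsilon> \<Longrightarrow> (z - x0) \<bullet> n > 0 \<Longrightarrow> z \<in> \<Omega>"
    and outside: "\<And>z. z \<in> ball x0 \<epsilon> \<Longrightarrow> (z - x0) \<bullet> n < 0 \<Longrightarrow> z \<notin> \<Omega>"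
  shows "u x0 = 0"
proof -
  let ?M = "lebesgue_on \<Omega>"
  define \<kappa> where "\<kappa> = unit_ball_vol 2"
  have \<kappa>: "\<kappa> > 0" by (simp add: \<kappa>_def)
  have ball_measure: "measure lebesgue (ball c r) = \<kappa> * r\<^sup>2" if "r \<ge> 0" for c :: "real^2" and r
    using content_ball[OF that, of c] by (simp add: \<kappa>_def)
  have "u x0 $ i = 0" for i
  proof (rule ccontr)
    define v where "v = u x0 $ i"
    assume "u x0 $ i \<noteq> 0"
    then have v: "v \<noteq> 0" by (simp add: v_def)
    \<comment> \<open>The sign makes this component positive near \<open>x0\<close>, where its value
      is |v|.\<close>
    define w where "w x = sgn v * u x $ i" for x
    have wc: "continuous_on (closure \<Omega>) w" unfolding w_def by (intro continuous_intros cont)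
    have "w x0 = \<bar>v\<bar>" by (simp add: w_def v_def abs_sgn mult.commute)
    obtain \<delta> where \<delta>: "\<delta> > 0" "\<And>x. x \<in> closure \<Omega> \<Longrightarrow> dist x x0 < \<delta> \<Longrightarrow> dist (w x) (w x0) < \<bar>v\<bar> / 2"
      using wc[unfolded continuous_on_iff, rule_format, OF x0, of "\<bar>v\<bar> / 2"] v by auto
    have wpos: "w x \<ge> \<bar>v\<bar> / 2" if "x \<in> \<Omega>" "dist x x0 < \<delta>" for x
    proof -
      have "\<bar>w x - w x0\<bar> < \<bar>v\<bar> / 2" using \<delta>(2)[of x] that closure_subset by (auto simp: dist_real_def)
      then show ?thesis using \<open>w x0 = \<bar>v\<bar>\<close> by linarith
    qed
    define g where "g x = \<bar>weak_grad \<Omega> u x $ i $ 1\<bar> + \<bar>weak_grad \<Omega> u x $ i $ 2\<bar>" for x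
    have gsq: "square_integrable ?M g"
    proof -
      have "square_integrable ?M (\<lambda>x. \<bar>weak_grad \<Omega> u x $ i $ j\<bar>)" for j
        using L2_component2[OF H10_D(3)[OF u], of i j] by (auto simp: square_integrable_def)
      then show ?thesis unfolding g_def by (intro square_integrable_add)
    qed
    \<comment> \<open>|v|/6 bounds the integrand from below on a ball of radius \<rho>/4, whose area
      is \<kappa> \<rho>^2 / 16; the product of the two is c \<rho>^2.\<close>
    define c where "c = \<kappa> * \<bar>v\<bar> / 96"
    have c: "c > 0" using \<kappa> v by (simp add: c_def)
    \<comment> \<open>With this weight the remainder \<kappa> / (4 M) of Young's inequality in
      \<open>upper\<close> equals c/2, half of what \<open>lower\<close> provides.\<close>
    define M where "M = \<kappa> / (2 * c)"
    have M: "M > 0" using \<kappa> c by (simp add: M_def)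
    have main: "c / 2 \<le> M * (\<integral>x. indicator (ball x0 \<rho>) x * (g x)\<^sup>2 \<partial>?M)"
      if \<rho>: "\<rho> > 0" "\<rho> < \<delta>" "\<rho> < \<epsilon>" for \<rho>
    proof -
      define \<psi> where "\<psi> x = max 0 (\<rho> - dist x x0)" for x
      define \<psi>' where "\<psi>' j x = (if dist x x0 < \<rho> then - (x - x0) $ j / dist x x0 else 0)" for j x
      have lip: "1-lipschitz_on UNIV \<psi>"
      proof (rule lipschitz_onI)
        show "dist (\<psi> x) (\<psi> y) \<le> 1 * dist x y" for x y
          using dist_triangle[of x x0 y] dist_triangle[of y x0 x] by (auto simp: \<psi>_def dist_real_def dist_commute)
      qed simp
      \<comment> \<open>The cone fails to be differentiable only at its apex and on its rim, both
        null sets.\<close>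
      have der: "AE x in lborel. ((\<lambda>h. \<psi> (x + h *\<^sub>R axis j 1)) has_real_derivative \<psi>' j x) (at 0)" for j
      proof -
        have "AE x in lborel. x \<notin> sphere x0 \<rho>"
          by (rule AE_not_in) (use negligible_sphere in \<open>simp add: negligible_iff_null_sets null_sets_completion_iff\<close>)
        moreover have "AE x in lborel. x \<noteq> x0"
          by (rule AE_lborel_singleton)
        ultimately show ?thesis
        proof eventually_elim
          case (elim x)
          have tl: "((\<lambda>h. norm (x + h *\<^sub>R axis j 1 - x0)) \<longlongrightarrow> norm (x + 0 *\<^sub>R axis j 1 - x0)) (nhds (0::real))"
            by (intro tendsto_intros filterlim_ident)
          consider "dist x x0 < \<rho>" | "dist x x0 > \<rho>" using elim by (fastforce simp: dist_commute)
          then show ?case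
          proof cases
            case 1
            have "((\<lambda>h. \<rho> - norm (x + h *\<^sub>R axis j 1 - x0)) has_derivative
                (\<lambda>h. - (h *\<^sub>R axis j 1 \<bullet> sgn (x - x0)))) (at 0)"
            proof (rule has_derivative_diff[OF has_derivative_const, THEN has_derivative_eq_rhs])
              have a: "((\<lambda>h. x + h *\<^sub>R axis j 1 - x0) has_derivative (\<lambda>h. h *\<^sub>R axis j 1)) (at (0::real))"
                by (auto intro!: derivative_eq_intros)
              have N: "(norm has_derivative (\<lambda>h. h \<bullet> sgn (x - x0))) (at (x + 0 *\<^sub>R axis j 1 - x0))"
                using has_derivative_norm[of "x - x0"] elim(2) by simp
              show "((\<lambda>h. norm (x + h *\<^sub>R axis j 1 - x0)) has_derivative (\<lambda>h. h *\<^sub>R axis j 1 \<bullet> sgn (x - x0))) (at 0)"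
                by (rule has_derivative_compose[OF a N])
            qed simp
            then have "((\<lambda>h. \<rho> - norm (x + h *\<^sub>R axis j 1 - x0)) has_real_derivative - ((x - x0) $ j / dist x x0)) (at 0)"
              unfolding has_field_derivative_def
              by (rule has_derivative_eq_rhs)
                (auto simp: fun_eq_iff sgn_div_norm inner_axis' dist_norm divide_inverse)
            moreover have "\<forall>\<^sub>F h in nhds 0. \<rho> - norm (x + h *\<^sub>R axis j 1 - x0) = \<psi> (x + h *\<^sub>R axis j 1)"
            proof -
              have "\<forall>\<^sub>F h in nhds 0. norm (x + h *\<^sub>R axis j 1 - x0) < \<rho>"
                by (rule order_tendstoD(2)[OF tl]) (use 1 in \<open>simp add: dist_norm\<close>)
              then show ?thesis by eventually_elim (simp add: \<psi>_def dist_norm)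
            qed
            ultimately show ?thesis
              using 1 DERIV_cong_ev[OF refl, of "\<lambda>h. \<rho> - norm (x + h *\<^sub>R axis j 1 - x0)" "\<lambda>h. \<psi> (x + h *\<^sub>R axis j 1)" 0]
              by (simp add: \<psi>'_def minus_divide_left)
          next
            case 2
            have "\<forall>\<^sub>F h in nhds 0. 0 = \<psi> (x + h *\<^sub>R axis j 1)"
            proof -
              have "\<forall>\<^sub>F h in nhds 0. norm (x + h *\<^sub>R axis j 1 - x0) > \<rho>"
                by (rule order_tendstoD(1)[OF tl]) (use 2 in \<open>simp add: dist_norm\<close>)
              then show ?thesis by eventually_elim (simp add: \<psi>_def dist_norm)
            qed
            then show ?thesis
              using 2 DERIV_cong_ev[OF refl, of "\<lambda>h. 0" "\<lambda>h. \<psi> (x + h *\<^sub>R axis j 1)" 0 0 0]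
              by (simp add: \<psi>'_def)
          qed
        qed
      qed
      have \<psi>'m[measurable]: "\<psi>' j \<in> borel_measurable borel" for j
      proof -
        have [measurable]: "(\<lambda>x. (x - x0) $ j) \<in> borel_measurable borel" "(\<lambda>x. dist x x0) \<in> borel_measurable borel"
          by (intro borel_measurable_continuous_onI continuous_intros)+
        show ?thesis unfolding \<psi>'_def by measurable
      qed
      have \<psi>'b: "\<bar>\<psi>' j x\<bar> \<le> 1" for j x
        using component_le_norm_cart[of "x - x0" j] by (auto simp: \<psi>'_def dist_norm divide_le_eq_1)
      have \<psi>m: "\<psi> \<in> borel_measurable borel"
        by (intro borel_measurable_continuous_onI lipschitz_on_continuous_on[OF lip])
      have \<psi>sq: "square_integrable ?M \<psi>" "square_integrable ?M (\<psi>' j)" for j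
        by (intro fin.square_integrable_bounded[where B = \<rho>] measurable_lebesgue_on \<psi>m AE_I2)
          (use \<rho> in \<open>simp add: \<psi>_def\<close>, intro fin.square_integrable_bounded[where B = 1] measurable_lebesgue_on \<psi>'m AE_I2 \<psi>'b)
      define F where "F x = sgn v * (n $ 1 * weak_grad \<Omega> u x $ i $ 1 + n $ 2 * weak_grad \<Omega> u x $ i $ 2)" for x
      have "(\<integral>x. weak_grad \<Omega> u x $ i $ j * \<psi> x \<partial>?M) = - (\<integral>x. u x $ i * \<psi>' j x \<partial>?M)" for j
        by (rule H10_integration_by_parts[OF u lip der \<psi>'m])
      note ibp = this
      note i1 = square_integrable_mult[OF L2_component2[OF H10_D(3)[OF u]] \<psi>sq(1)]
      note i2 = square_integrable_mult[OF L2_component[OF H10_D(1)[OF u]] \<psi>sq(2)]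
      have "(\<integral>x. F x * \<psi> x \<partial>?M) = sgn v * (n $ 1 * (\<integral>x. weak_grad \<Omega> u x $ i $ 1 * \<psi> x \<partial>?M) + n $ 2 * (\<integral>x. weak_grad \<Omega> u x $ i $ 2 * \<psi> x \<partial>?M))"
        using i1[of i 1] i1[of i 2] by (simp add: F_def distrib_right mult.assoc)
      also have "\<dots> = (\<integral>x. w x * - (n $ 1 * \<psi>' 1 x + n $ 2 * \<psi>' 2 x) \<partial>?M)"
      proof -
        have "(\<lambda>x. w x * - (n $ 1 * \<psi>' 1 x + n $ 2 * \<psi>' 2 x))
            = (\<lambda>x. (- (sgn v * n $ 1)) * (u x $ i * \<psi>' 1 x) + (- (sgn v * n $ 2)) * (u x $ i * \<psi>' 2 x))"
          by (simp add: w_def fun_eq_iff algebra_simps)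
        then have "(\<integral>x. w x * - (n $ 1 * \<psi>' 1 x + n $ 2 * \<psi>' 2 x) \<partial>?M)
            = (- (sgn v * n $ 1)) * (\<integral>x. u x $ i * \<psi>' 1 x \<partial>?M) + (- (sgn v * n $ 2)) * (\<integral>x. u x $ i * \<psi>' 2 x \<partial>?M)"
          by (simp only: Bochner_Integration.integral_add[OF integrable_mult_right[OF i2[of i 1]] integrable_mult_right[OF i2[of i 2]]]
            integral_mult_right_zero)
        then show ?thesis unfolding ibp by (simp add: algebra_simps)
      qed
      finally have eq: "(\<integral>x. F x * \<psi> x \<partial>?M) = (\<integral>x. w x * - (n $ 1 * \<psi>' 1 x + n $ 2 * \<psi>' 2 x) \<partial>?M)" .
      have lower: "c * \<rho>\<^sup>2 \<le> (\<integral>x. w x * - (n $ 1 * \<psi>' 1 x + n $ 2 * \<psi>' 2 x) \<partial>?M)"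
      proof -
        \<comment> \<open>On the ball of radius \<rho>/4 about \<open>y\<close> the height above the
          line is at least \<rho>/4 and the distance to \<open>x0\<close> at most 3 \<rho>/4, so
          their quotient is at least 1/3. Together with w \<ge> |v|/2 this gives |v|/6.\<close>
        define y where "y = x0 + (\<rho> / 2) *\<^sub>R n"
        define b where "b = ball y (\<rho> / 4)"
        have b: "(x - x0) \<bullet> n \<ge> \<rho> / 4" "dist x x0 \<le> 3 * \<rho> / 4" "x \<in> \<Omega>" if "x \<in> b" for x
        proof -
          have nxy: "norm (x - y) < \<rho> / 4" using that by (simp add: b_def dist_norm norm_minus_commute)
          have "\<bar>(x - y) \<bullet> n\<bar> \<le> norm (x - y)" using Cauchy_Schwarz_ineq2[of "x - y" n] n by simp
          moreover have nn: "n \<bullet> n = 1" using n by (simp add: norm_eq_1)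
          moreover have "(x - x0) \<bullet> n = (x - y) \<bullet> n + \<rho> / 2" by (simp add: y_def algebra_simps nn)
          ultimately show 1: "(x - x0) \<bullet> n \<ge> \<rho> / 4" using nxy by linarith
          have "norm (x - x0) \<le> norm (x - y) + norm ((\<rho> / 2) *\<^sub>R n)"
            using norm_triangle_ineq[of "x - y" "(\<rho> / 2) *\<^sub>R n"] by (simp add: y_def)
          then show 2: "dist x x0 \<le> 3 * \<rho> / 4" using nxy n \<rho> by (simp add: dist_norm)
          show "x \<in> \<Omega>" using inside[of x] 1 2 \<rho> by (simp add: dist_commute)
        qed
        have bm: "b \<in> sets lebesgue" "b \<subseteq> \<Omega>" using b by (auto simp: b_def)
        have "(\<integral>x. (\<bar>v\<bar> / 6) * indicator b x \<partial>?M) = (\<bar>v\<bar> / 6) * measure ?M b"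
          using bm op by (simp add: Int_absorb2 sets_restrict_space_iff space_restrict_space)
        also have "measure ?M b = measure lebesgue b"
          using bm op by (simp add: measure_restrict_space)
        also have "\<dots> = \<kappa> * (\<rho> / 4)\<^sup>2" unfolding b_def using \<rho> by (intro ball_measure) simp
        also have "(\<bar>v\<bar> / 6) * (\<kappa> * (\<rho> / 4)\<^sup>2) = c * \<rho>\<^sup>2" by (simp add: c_def power2_eq_square)
        finally have "c * \<rho>\<^sup>2 = (\<integral>x. (\<bar>v\<bar> / 6) * indicator b x \<partial>?M)" by simp
        also have "\<dots> \<le> (\<integral>x. w x * - (n $ 1 * \<psi>' 1 x + n $ 2 * \<psi>' 2 x) \<partial>?M)"
        proof (rule integral_mono)
          show "integrable ?M (\<lambda>x. (\<bar>v\<bar> / 6) * indicator b x)"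
            using bm op by (intro integrable_mult_right fin.integrable_const_bound[where B = 1])
              (auto simp: sets_restrict_space_iff intro!: borel_measurable_indicator)
          show "integrable ?M (\<lambda>x. w x * - (n $ 1 * \<psi>' 1 x + n $ 2 * \<psi>' 2 x))"
            unfolding w_def
            by (intro square_integrable_mult square_integrable_cmult L2_component[OF H10_D(1)[OF u]])
              (use square_integrable_add[OF square_integrable_cmult[OF \<psi>sq(2)[of 1], of "- n $ 1"] square_integrable_cmult[OF \<psi>sq(2)[of 2], of "- n $ 2"]] in \<open>simp add: algebra_simps\<close>)
          fix x assume "x \<in> space ?M"
          then have x: "x \<in> \<Omega>" by (simp add: space_restrict_space)
          show "(\<bar>v\<bar> / 6) * indicator b x \<le> w x * - (n $ 1 * \<psi>' 1 x + n $ 2 * \<psi>' 2 x)"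
          proof (cases "dist x x0 < \<rho>")
            case True
            have e: "- (n $ 1 * \<psi>' 1 x + n $ 2 * \<psi>' 2 x) = ((x - x0) \<bullet> n) / dist x x0"
              using True by (simp add: \<psi>'_def inner_vec_def sum_2 add_divide_distrib diff_divide_distrib algebra_simps)
            have wx: "w x \<ge> \<bar>v\<bar> / 2" using wpos x True \<rho> by simp
            \<comment> \<open>\<Omega> avoids the other half disc, so the integrand is nonnegative
              under the whole cone.\<close>
            have ge0: "(x - x0) \<bullet> n \<ge> 0" using outside[of x] x True \<rho> by (force simp: dist_commute)
            show ?thesis
            proof (cases "x \<in> b")
              case xb: True
              have "dist x x0 > 0" using b(1)[OF xb] \<rho> by auto
              then have "1 / 3 \<le> ((x - x0) \<bullet> n) / dist x x0" using b(1,2)[OF xb] by (simp add: field_simps)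
              then have "(\<bar>v\<bar> / 2) * (1 / 3) \<le> w x * (((x - x0) \<bullet> n) / dist x x0)"
                using wx by (intro mult_mono) auto
              then show ?thesis unfolding e using xb by simp
            next
              case False
              have "0 \<le> w x * (((x - x0) \<bullet> n) / dist x x0)"
                using wx ge0 by (intro mult_nonneg_nonneg divide_nonneg_nonneg) auto
              then show ?thesis unfolding e using False by simp
            qed
          next
            case False
            then have "x \<notin> b" using b(2)[of x] \<rho> by auto
            then show ?thesis using False by (simp add: \<psi>'_def)
          qed
        qed
        finally show ?thesis .
      qed
      have upper: "(\<integral>x. F x * \<psi> x \<partial>?M) \<le> M * \<rho>\<^sup>2 * (\<integral>x. indicator (ball x0 \<rho>) x * (g x)\<^sup>2 \<partial>?M) + (c / 2) * \<rho>\<^sup>2"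
      proof -
        have im: "(indicator (ball x0 \<rho>) :: _ \<Rightarrow> real) \<in> borel_measurable ?M"
          by (intro measurable_lebesgue_on borel_measurable_indicator) auto
        have ind: "integrable ?M (indicator (ball x0 \<rho>) :: _ \<Rightarrow> real)"
          by (rule fin.integrable_const_bound[where B = 1]) (auto simp: im)
        have ig: "integrable ?M (\<lambda>x. indicator (ball x0 \<rho>) x * (g x)\<^sup>2)"
        proof (rule Bochner_Integration.integrable_bound[of _ "\<lambda>x. (g x)\<^sup>2"])
          show "(\<lambda>x. indicator (ball x0 \<rho>) x * (g x)\<^sup>2) \<in> borel_measurable ?M"
            using gsq by (intro borel_measurable_times borel_measurable_power im) (simp add: square_integrable_def)
        qed (use gsq in \<open>auto simp: square_integrable_def indicator_def\<close>)
        have "(\<integral>x. F x * \<psi> x \<partial>?M) \<le> (\<integral>x. M * \<rho>\<^sup>2 * (indicator (ball x0 \<rho>) x * (g x)\<^sup>2) + (1 / (4 * M)) * indicator (ball x0 \<rho>) x \<partial>?M)"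
        proof (rule integral_mono)
          show "integrable ?M (\<lambda>x. F x * \<psi> x)"
            unfolding F_def by (intro square_integrable_mult square_integrable_cmult square_integrable_add L2_component2[OF H10_D(3)[OF u]] \<psi>sq)
          show "integrable ?M (\<lambda>x. M * \<rho>\<^sup>2 * (indicator (ball x0 \<rho>) x * (g x)\<^sup>2) + (1 / (4 * M)) * indicator (ball x0 \<rho>) x)"
            using ig ind by simp
          fix x assume "x \<in> space ?M"
          show "F x * \<psi> x \<le> M * \<rho>\<^sup>2 * (indicator (ball x0 \<rho>) x * (g x)\<^sup>2) + (1 / (4 * M)) * indicator (ball x0 \<rho>) x"
          proof (cases "x \<in> ball x0 \<rho>")
            case True
            have \<psi>r: "0 \<le> \<psi> x" "\<psi> x \<le> \<rho>" using \<rho> by (auto simp: \<psi>_def)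
            have n1: "\<bar>n $ j\<bar> \<le> 1" for j using component_le_norm_cart[of n j] n by simp
            have "\<bar>n $ j * weak_grad \<Omega> u x $ i $ j\<bar> \<le> \<bar>weak_grad \<Omega> u x $ i $ j\<bar>" for j
              using mult_left_le_one_le[OF _ _ n1[of j], of "\<bar>weak_grad \<Omega> u x $ i $ j\<bar>"] by (simp add: abs_mult)
            from this[of 1] this[of 2] have "\<bar>n $ 1 * weak_grad \<Omega> u x $ i $ 1 + n $ 2 * weak_grad \<Omega> u x $ i $ 2\<bar> \<le> g x"
              unfolding g_def by linarith
            moreover have "\<bar>F x\<bar> \<le> \<bar>n $ 1 * weak_grad \<Omega> u x $ i $ 1 + n $ 2 * weak_grad \<Omega> u x $ i $ 2\<bar>"
              unfolding F_def abs_mult by (simp add: abs_sgn_eq)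
            ultimately have "\<bar>F x\<bar> \<le> g x" by linarith
            then have "\<bar>F x\<bar> * \<psi> x \<le> g x * \<rho>" using \<psi>r by (intro mult_mono) auto
            moreover have "F x * \<psi> x \<le> \<bar>F x\<bar> * \<psi> x" using \<psi>r by (intro mult_right_mono) auto
            moreover have "g x * \<rho> \<le> M * \<rho>\<^sup>2 * (g x)\<^sup>2 + 1 / (4 * M)"
            proof -
              have "0 \<le> (2 * M * \<rho> * g x - 1)\<^sup>2 / (4 * M)" using M by simp
              also have "\<dots> = M * \<rho>\<^sup>2 * (g x)\<^sup>2 + 1 / (4 * M) - g x * \<rho>"
                using M by (simp add: power2_eq_square field_simps)
              finally show ?thesis by simp
            qed
            ultimately show ?thesis using True by simp
          qed (auto simp: \<psi>_def dist_commute)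
        qed
        also have "\<dots> = M * \<rho>\<^sup>2 * (\<integral>x. indicator (ball x0 \<rho>) x * (g x)\<^sup>2 \<partial>?M) + (1 / (4 * M)) * (\<integral>x. indicator (ball x0 \<rho>) x \<partial>?M)"
          using ig ind by simp
        also have "(\<integral>x. indicator (ball x0 \<rho>) x \<partial>?M) \<le> \<kappa> * \<rho>\<^sup>2"
        proof -
          have "(\<integral>x. indicat_real (ball x0 \<rho>) x \<partial>?M) = (\<integral>x. indicat_real (\<Omega> \<inter> ball x0 \<rho>) x \<partial>lebesgue)"
          proof -
            have "(\<lambda>x. indicat_real \<Omega> x *\<^sub>R indicat_real (ball x0 \<rho>) x) = indicat_real (\<Omega> \<inter> ball x0 \<rho>)"
              by (simp add: fun_eq_iff indicator_inter_arith)
            then show ?thesis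
              using integral_restrict_space[of \<Omega> lebesgue "indicat_real (ball x0 \<rho>)"] op by simp
          qed
          also have "\<dots> = measure lebesgue (\<Omega> \<inter> ball x0 \<rho>)" by simp
          also have "\<dots> \<le> measure lebesgue (ball x0 \<rho>)"
            using op by (intro measure_mono_fmeasurable) (auto simp: lmeasurable_ball)
          finally show ?thesis using ball_measure[of \<rho> x0] \<rho> by simp
        qed
        then have "M * \<rho>\<^sup>2 * (\<integral>x. indicator (ball x0 \<rho>) x * (g x)\<^sup>2 \<partial>?M) + (1 / (4 * M)) * (\<integral>x. indicator (ball x0 \<rho>) x \<partial>?M)
            \<le> M * \<rho>\<^sup>2 * (\<integral>x. indicator (ball x0 \<rho>) x * (g x)\<^sup>2 \<partial>?M) + (1 / (4 * M)) * (\<kappa> * \<rho>\<^sup>2)"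
          using M by (intro add_left_mono mult_left_mono) auto
        also have "(1 / (4 * M)) * (\<kappa> * \<rho>\<^sup>2) = (c / 2) * \<rho>\<^sup>2" using \<kappa> c by (simp add: M_def field_simps)
        finally show ?thesis .
      qed
      have "c * \<rho>\<^sup>2 \<le> M * \<rho>\<^sup>2 * (\<integral>x. indicator (ball x0 \<rho>) x * (g x)\<^sup>2 \<partial>?M) + (c / 2) * \<rho>\<^sup>2"
        using lower upper eq by linarith
      then have "(c / 2) * \<rho>\<^sup>2 \<le> (M * (\<integral>x. indicator (ball x0 \<rho>) x * (g x)\<^sup>2 \<partial>?M)) * \<rho>\<^sup>2"
        by (simp add: algebra_simps)
      then show ?thesis using \<rho> by (simp add: mult_le_cancel_right)
    qed
    \<comment> \<open>Dividing by n + 2 keeps every radius, the first one included, strictly below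
      \<open>\<delta>\<close> and \<open>\<epsilon>\<close>.\<close>
    define r where "r n = min \<delta> \<epsilon> / real (Suc (Suc n))" for n
    have r: "r n > 0" "r n < \<delta>" "r n < \<epsilon>" for n
      using \<delta>(1) \<epsilon> by (auto simp: r_def divide_less_eq min_def algebra_simps add_pos_nonneg intro: add_strict_increasing2)
    have "(\<lambda>n. \<integral>x. indicator (ball x0 (r n)) x * (g x)\<^sup>2 \<partial>?M) \<longlonglongrightarrow> (\<integral>x. 0 \<partial>?M)"
    proof (rule integral_dominated_convergence[where w = "\<lambda>x. (g x)\<^sup>2"])
      show "AE x in ?M. (\<lambda>n. indicator (ball x0 (r n)) x * (g x)\<^sup>2) \<longlonglongrightarrow> 0"
      proof -
        have "AE x in ?M. x \<noteq> x0" by (rule AE_lebesgue_onI, rule AE_lborel_singleton)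
        then show ?thesis
        proof eventually_elim
          case (elim x)
          have "(\<lambda>n. min \<delta> \<epsilon> / real (Suc n)) \<longlonglongrightarrow> 0" by (rule LIMSEQ_Suc[OF lim_const_over_n])
          then have "r \<longlonglongrightarrow> 0" unfolding r_def by (rule LIMSEQ_Suc)
          then have "\<forall>\<^sub>F n in sequentially. r n < dist x0 x"
            by (rule order_tendstoD) (use elim in simp)
          then have "\<forall>\<^sub>F n in sequentially. indicator (ball x0 (r n)) x * (g x)\<^sup>2 = 0"
            by eventually_elim (simp add: indicator_def)
          then show ?case by (rule tendsto_eventually)
        qed
      qed
      show "(\<lambda>x. indicator (ball x0 (r n)) x * (g x)\<^sup>2) \<in> borel_measurable ?M" for n
        using gsq
        by (intro borel_measurable_times[OF measurable_lebesgue_on[OF borel_measurable_indicator] borel_measurable_power])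
          (auto simp: square_integrable_def)
    qed (use gsq in \<open>auto simp: square_integrable_def indicator_def\<close>)
    then have "(\<lambda>n. M * (\<integral>x. indicator (ball x0 (r n)) x * (g x)\<^sup>2 \<partial>?M)) \<longlonglongrightarrow> M * 0"
      by (intro tendsto_intros) simp
    then have "c / 2 \<le> M * 0" by (rule LIMSEQ_le_const) (use main r in blast)
    then show False using c by simp
  qed
  then show ?thesis by (simp add: vec_eq_iff)
qed

end

section \<open>Geometry of the regular polygon\<close>

lemma vector_2_eqI: "x $ 1 = y $ 1 \<Longrightarrow> x $ 2 = y $ 2 \<Longrightarrow> x = (y :: 'a^2)"
  by (simp add: vec_eq_iff forall_2)

lemma inner_2: "x \<bullet> y = x $ 1 * y $ 1 + x $ 2 * (y $ 2)" for x y :: "real^2"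
  by (simp add: inner_vec_def sum_2)

text \<open>Evenness and the reflection of d to 2N - d bring the angle into [0, pi], where the
  cosine decreases. Odd \<open>d\<close> are the angles, in units of pi / N, between vertex
  directions and edge normals; |d| = 1 and |d| = 2N - 1 belong to the end points of the
  edge.\<close>

lemma cos_le_cos_pi_div:
  fixes d :: int
  assumes "N \<ge> 1" "1 \<le> \<bar>d\<bar>" "\<bar>d\<bar> \<le> 2 * int N - 1"
  shows "cos (pi * d / real N) \<le> cos (pi / real N)"
    "1 < \<bar>d\<bar> \<Longrightarrow> \<bar>d\<bar> < 2 * int N - 1 \<Longrightarrow> cos (pi * d / real N) < cos (pi / real N)"
proof -
  have N: "real N > 0" using assms by simp
  define e where "e = (if \<bar>d\<bar> \<le> int N then \<bar>d\<bar> else 2 * int N - \<bar>d\<bar>)"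
  have e: "1 \<le> e" "e \<le> int N" using assms by (auto simp: e_def)
  have "cos (pi * d / real N) = cos (pi * \<bar>d\<bar> / real N)"
  proof (cases "d \<ge> 0")
    case False
    then have "cos (pi * \<bar>d\<bar> / real N) = cos (- (pi * d / real N))" by simp
    then show ?thesis by (simp only: cos_minus)
  qed simp
  also have "\<dots> = cos (pi * e / real N)"
  proof (cases "\<bar>d\<bar> \<le> int N")
    case False
    then have "pi * e / real N = 2 * pi - pi * \<bar>d\<bar> / real N"
      using N by (simp add: e_def field_simps)
    then show ?thesis by (simp add: cos_diff)
  qed (simp add: e_def)
  finally have ce: "cos (pi * d / real N) = cos (pi * e / real N)" .
  have e1: "pi / real N \<le> pi * e / real N" "pi * e / real N \<le> pi" "0 \<le> pi / real N"
    using e N by (simp_all add: field_simps)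
  show "cos (pi * d / real N) \<le> cos (pi / real N)"
    unfolding ce using e1 by (intro cos_monotone_0_pi_le) auto
  assume "1 < \<bar>d\<bar>" "\<bar>d\<bar> < 2 * int N - 1"
  then have "1 < e" by (auto simp: e_def)
  then have "pi / real N < pi * e / real N" using N by (simp add: field_simps)
  then show "cos (pi * d / real N) < cos (pi / real N)"
    unfolding ce using e1 by (intro cos_monotone_0_pi) auto
qed

text \<open>The discrete spaces prescribe affinity on open edges only; continuity carries it to the
  end points.\<close>

lemma continuous_affine_on_unit_interval:
  fixes f :: "real \<Rightarrow> 'a::real_normed_vector"
  assumes cont: "continuous_on {0..1} f" and aff: "\<And>t. 0 < t \<Longrightarrow> t < 1 \<Longrightarrow> f t = a + t *\<^sub>R b" and t: "t \<in> {0..1}"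
  shows "f t = (1 - t) *\<^sub>R f 0 + t *\<^sub>R f 1"
proof -
  have cl: "closure {0<..<1::real} = {0..1}" by simp
  have eq: "f t - (a + t *\<^sub>R b) = 0" if "t \<in> {0..1}" for t
    by (rule continuous_constant_on_closure[of "{0<..<1}" "\<lambda>t. f t - (a + t *\<^sub>R b)"])
      (use that aff in \<open>auto simp: cl intro!: continuous_intros cont\<close>)
  from eq[OF t] eq[of 0] eq[of 1] show ?thesis by (simp add: algebra_simps)
qed

locale regular_ngon =
  fixes N :: nat and q :: "nat \<Rightarrow> real^2" and c :: "real^2" and r \<theta> :: real
  assumes N3: "3 \<le> N" and r: "0 < r"
    and q: "j < N \<Longrightarrow> q j = c + r *\<^sub>R vector [cos (\<theta> + 2 * pi * real j / real N), sin (\<theta> + 2 * pi * real j / real N)]"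
begin

text \<open>The index is real: integers stand for vertices, half-integers for midpoints of edges,
  whose directions from the centre are the normals.\<close>

definition phase :: "real \<Rightarrow> real" where
  "phase s = \<theta> + 2 * pi * s / real N"

definition dir :: "real \<Rightarrow> real^2" where
  "dir s = vector [cos (phase s), sin (phase s)]"

definition perp :: "real \<Rightarrow> real^2" where
  "perp s = vector [- sin (phase s), cos (phase s)]"

text \<open>\<open>q\<close> is prescribed below \<open>N\<close> only. This formula continues it
  periodically, so that the successor of an index needs no modulus.\<close>

definition vertex :: "nat \<Rightarrow> real^2" where "vertex j = c + r *\<^sub>R dir (real j)"

definition nrm :: "nat \<Rightarrow> real^2" where "nrm j = dir (real j + 1 / 2)"

definition tangent :: "nat \<Rightarrow> real^2" where "tangent j = perp (real j + 1 / 2)"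

definition apothem :: real where "apothem = r * cos (pi / real N)"

definition side :: real where "side = 2 * r * sin (pi / real N)"

lemma N_pos: "real N > 0" using N3 by simp

lemma angle: "0 < pi / real N" "pi / real N < pi / 2"
  using N3 divide_strict_left_mono[of 2 "real N" pi] by simp_all

lemma sin_pos: "sin (pi / real N) > 0"
  by (intro sin_gt_zero) (use angle pi_gt_zero in linarith)+

lemma cos_pos: "cos (pi / real N) > 0"
  using angle by (intro cos_gt_zero) auto

lemma apothem_pos: "apothem > 0" and side_pos: "side > 0"
  using r sin_pos cos_pos by (simp_all add: apothem_def side_def)

lemma phase_diff: "phase s - phase t = 2 * pi * (s - t) / real N"
  by (simp add: phase_def algebra_simps diff_divide_distrib)

lemma phase_add: "phase (s + u) = phase s + 2 * pi * u / real N"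
  and phase_minus: "phase (s - u) = phase s - 2 * pi * u / real N"
  using phase_diff[of "s + u" s] phase_diff[of s "s - u"] by simp_all

lemma dir_inner: "dir s \<bullet> dir t = cos (2 * pi * (s - t) / real N)"
  by (simp add: dir_def inner_2 cos_diff flip: phase_diff)

lemma dir_perp_inner: "dir s \<bullet> perp t = sin (2 * pi * (s - t) / real N)"
  by (simp add: dir_def perp_def inner_2 sin_diff flip: phase_diff)

lemma perp_inner: "perp s \<bullet> perp s = 1"
  by (simp add: perp_def inner_2 flip: power2_eq_square)

lemma norm_dir: "norm (dir s) = 1"
  using dir_inner[of s s] by (simp add: norm_eq_1)

lemma norm_perp: "norm (perp s) = 1"
  by (simp add: norm_eq_1 perp_inner)

lemma orthonormal_expansion: "v = (v \<bullet> dir s) *\<^sub>R dir s + (v \<bullet> perp s) *\<^sub>R perp s"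
proof -
  define C S where "C = cos (phase s)" "S = sin (phase s)"
  have "C * C + S * S = 1" by (simp add: C_S_def flip: power2_eq_square)
  then have "v $ 1 = (v $ 1 * C + v $ 2 * S) * C + (v $ 2 * C - v $ 1 * S) * - S"
    "v $ 2 = (v $ 1 * C + v $ 2 * S) * S + (v $ 2 * C - v $ 1 * S) * C" by algebra+
  then show ?thesis
    by (intro vector_2_eqI) (simp_all add: dir_def perp_def inner_2 C_S_def)
qed

text \<open>This and the next two are sum-to-product formulas for u = 1/2: around a midpoint index
  they combine the two vertices of an edge, around a vertex index the normals or tangents of its two
  edges.\<close>

lemma dir_add: "dir (s + u) + dir (s - u) = (2 * cos (2 * pi * u / real N)) *\<^sub>R dir s"
  by (intro vector_2_eqI) (simp_all add: dir_def phase_add phase_minus cos_add sin_add cos_diff sin_diff)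

lemma dir_diff: "dir (s + u) - dir (s - u) = (2 * sin (2 * pi * u / real N)) *\<^sub>R perp s"
  by (intro vector_2_eqI) (simp_all add: dir_def perp_def phase_add phase_minus cos_add sin_add cos_diff sin_diff)

lemma perp_diff: "perp (s - u) - perp (s + u) = (2 * sin (2 * pi * u / real N)) *\<^sub>R dir s"
  by (intro vector_2_eqI) (simp_all add: dir_def perp_def phase_add phase_minus cos_add sin_add cos_diff sin_diff)

lemma dir_period: "dir (s + real N) = dir s" and perp_period: "perp (s + real N) = perp s"
  using N_pos by (simp_all add: dir_def perp_def phase_add)

lemma vertex_period: "vertex N = vertex 0"
  using dir_period[of 0] by (simp add: vertex_def)

lemma q_vertex: "j < N \<Longrightarrow> q j = vertex j"
  by (simp add: q vertex_def dir_def phase_def)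

lemma vnext_vertex:
  assumes "j < N" shows "vnext N q j = vertex (Suc j)"
proof (cases "Suc j = N")
  case True
  then show ?thesis using assms q_vertex[of 0] vertex_period by (simp add: vnext_def)
next
  case False
  then show ?thesis using assms q_vertex[of "Suc j"] by (simp add: vnext_def)
qed

lemma vertex_diff: "vertex (Suc j) - vertex j = side *\<^sub>R tangent j"
proof -
  have "dir (real (Suc j)) - dir (real j) = (2 * sin (2 * pi * (1 / 2) / real N)) *\<^sub>R perp (real j + 1 / 2)"
    using dir_diff[of "real j + 1 / 2" "1 / 2"] by (simp add: add.commute)
  then show ?thesis by (simp add: vertex_def tangent_def side_def flip: scaleR_diff_right)
qed

lemma vertex_add: "vertex (Suc j) + vertex j = 2 *\<^sub>R c + (2 * apothem) *\<^sub>R nrm j"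
proof -
  have "dir (real (Suc j)) + dir (real j) = (2 * cos (2 * pi * (1 / 2) / real N)) *\<^sub>R dir (real j + 1 / 2)"
    using dir_add[of "real j + 1 / 2" "1 / 2"] by (simp add: add.commute)
  then have "r *\<^sub>R (dir (real (Suc j)) + dir (real j)) = (2 * apothem) *\<^sub>R nrm j"
    by (simp add: apothem_def nrm_def)
  then show ?thesis by (simp add: vertex_def scaleR_add_right scaleR_2)
qed

lemma nrm_tangent: "nrm j \<bullet> tangent j = 0" "norm (nrm j) = 1" "norm (tangent j) = 1"
  "nrm j \<bullet> nrm j = 1" "tangent j \<bullet> tangent j = 1"
  using dir_perp_inner[of "real j + 1 / 2" "real j + 1 / 2"] norm_dir norm_perp
  by (auto simp: nrm_def tangent_def norm_eq_1)

lemma edge_length_eq: "j < N \<Longrightarrow> edge_length N q j = side"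
  using vertex_diff[of j] side_pos nrm_tangent(3)[of j] norm_minus_commute[of "vertex j" "vertex (Suc j)"]
  by (simp add: edge_length_def q_vertex vnext_vertex dist_norm)

lemma edge_tangent_eq: "j < N \<Longrightarrow> edge_tangent N q j = tangent j"
  using vertex_diff[of j] side_pos by (simp add: edge_tangent_def edge_length_eq q_vertex vnext_vertex)

text \<open>Parametrises the whole line through an edge, the edge being the range from 0 to 1.
  Parameters beyond it arise when the strips along the edges are rescaled.\<close>

definition edge_point :: "nat \<Rightarrow> real \<Rightarrow> real^2" where
  "edge_point j t = vertex j + (t * side) *\<^sub>R tangent j"

lemma edge_point_convex: "edge_point j t = (1 - t) *\<^sub>R vertex j + t *\<^sub>R vertex (Suc j)"
proof -
  have "vertex (Suc j) = vertex j + side *\<^sub>R tangent j" using vertex_diff[of j] by (simp add: algebra_simps)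
  then show ?thesis by (simp add: edge_point_def algebra_simps)
qed

lemma edge_point_0_1: "edge_point j 0 = vertex j" "edge_point j 1 = vertex (Suc j)"
  by (simp_all add: edge_point_convex)

lemma edge_point_q: "j < N \<Longrightarrow> q j + t *\<^sub>R (vnext N q j - q j) = edge_point j t"
  using vertex_diff[of j] by (simp add: edge_point_def q_vertex vnext_vertex)

lemma vertex_neq: "vertex j \<noteq> vertex (Suc j)"
  using vertex_diff[of j] side_pos nrm_tangent(3)[of j] by auto

lemma edge_point_fun: "edge_point j = (\<lambda>t. (1 - t) *\<^sub>R vertex j + t *\<^sub>R vertex (Suc j))"
  by (simp add: fun_eq_iff edge_point_convex)

lemma edge_eq: "j < N \<Longrightarrow> edge N q j = edge_point j ` {0<..<1}"
  using vertex_neq[of j]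
  by (simp add: edge_def q_vertex vnext_vertex open_segment_image_interval edge_point_fun)

lemma closure_edge_eq: "j < N \<Longrightarrow> closure (edge N q j) = edge_point j ` {0..1}"
  using vertex_neq[of j]
  by (simp add: edge_def q_vertex vnext_vertex closed_segment_image_interval edge_point_fun)

lemma polygon_eq: "polygon N q = (\<Union>j<N. edge_point j ` {0..1})"
  by (simp add: polygon_def closure_edge_eq)

lemma edge_point_in_polygon: "j < N \<Longrightarrow> t \<in> {0..1} \<Longrightarrow> edge_point j t \<in> polygon N q"
  unfolding polygon_eq by blast

lemma vertex_in_polygon: "j < N \<Longrightarrow> vertex j \<in> polygon N q" "j < N \<Longrightarrow> vertex (Suc j) \<in> polygon N q"
  using edge_point_in_polygon[of j 0] edge_point_in_polygon[of j 1] by (simp_all add: edge_point_0_1)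

text \<open>The angle between the vertex direction and the normal is an odd multiple
  \<open>d\<close> of pi / N, and |d| is 1 or 2N - 1 exactly at the two end points of the
  edge.\<close>

lemma vertex_nrm_le: "k < N \<Longrightarrow> j < N \<Longrightarrow> (vertex k - c) \<bullet> nrm j \<le> apothem"
  and vertex_nrm_less: "k < N \<Longrightarrow> j < N \<Longrightarrow> k \<noteq> j \<Longrightarrow> k \<noteq> Suc j mod N \<Longrightarrow> (vertex k - c) \<bullet> nrm j < apothem"
proof -
  assume kj: "k < N" "j < N"
  define d where "d = 2 * int k - 2 * int j - 1"
  have "2 * pi * (real k - (real j + 1 / 2)) = pi * d"
    by (simp add: d_def algebra_simps)
  then have "2 * pi * (real k - (real j + 1 / 2)) / real N = pi * d / real N" by simp
  moreover have "(vertex k - c) \<bullet> nrm j = r * (dir (real k) \<bullet> dir (real j + 1 / 2))"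
    by (simp add: vertex_def nrm_def)
  ultimately have eq: "(vertex k - c) \<bullet> nrm j = r * cos (pi * d / real N)"
    by (simp only: dir_inner)
  have d: "1 \<le> \<bar>d\<bar>" "\<bar>d\<bar> \<le> 2 * int N - 1" using kj unfolding d_def by presburger+
  show "(vertex k - c) \<bullet> nrm j \<le> apothem"
    unfolding eq apothem_def using r N3 cos_le_cos_pi_div(1)[OF _ d] by simp
  assume ne: "k \<noteq> j" "k \<noteq> Suc j mod N"
  have "Suc j mod N = (if Suc j = N then 0 else Suc j)" using kj by auto
  then have "1 < \<bar>d\<bar>" "\<bar>d\<bar> < 2 * int N - 1" using kj ne by (auto simp: d_def split: if_splits)
  then show "(vertex k - c) \<bullet> nrm j < apothem"
    unfolding eq apothem_def using r N3 cos_le_cos_pi_div(2)[OF _ d] by simp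
qed

lemma vertex_nrm_eq: "(vertex j - c) \<bullet> nrm j = apothem" "(vertex (Suc j) - c) \<bullet> nrm j = apothem"
proof -
  have h: "vertex (Suc j) - c = (vertex j - c) + side *\<^sub>R tangent j"
    using vertex_diff[of j] by (simp add: algebra_simps)
  then have e: "(vertex (Suc j) - c) \<bullet> nrm j = (vertex j - c) \<bullet> nrm j"
    unfolding h inner_add_left using nrm_tangent(1)[of j] by (simp add: inner_commute[of "tangent j"])
  have "(vertex (Suc j) - c) + (vertex j - c) = (2 * apothem) *\<^sub>R nrm j"
    using vertex_add[of j] by (simp add: algebra_simps scaleR_2)
  then have "((vertex (Suc j) - c) + (vertex j - c)) \<bullet> nrm j = 2 * apothem"
    using nrm_tangent(4)[of j] by simp
  then show "(vertex j - c) \<bullet> nrm j = apothem" "(vertex (Suc j) - c) \<bullet> nrm j = apothem"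
    using e by (simp_all only: inner_add_left)
qed

lemma vertex_Suc_mod: "j < N \<Longrightarrow> vertex (Suc j) = vertex (Suc j mod N)"
  using vertex_period by (cases "Suc j = N") auto

lemma vertex_Suc_nrm_le: "k < N \<Longrightarrow> j < N \<Longrightarrow> (vertex (Suc k) - c) \<bullet> nrm j \<le> apothem"
  using vertex_nrm_le[of "Suc k mod N" j] N3 by (simp add: vertex_Suc_mod)

section \<open>The filled polygon as an intersection of half-planes\<close>

definition region :: "(real^2) set" where
  "region = {x. \<forall>j<N. (x - c) \<bullet> nrm j \<le> apothem}"

lemma edge_point_nrm: "(edge_point j t - c) \<bullet> nrm k =
    (1 - t) * ((vertex j - c) \<bullet> nrm k) + t * ((vertex (Suc j) - c) \<bullet> nrm k)"
proof -
  have "edge_point j t - c = (1 - t) *\<^sub>R (vertex j - c) + t *\<^sub>R (vertex (Suc j) - c)"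
    by (simp add: edge_point_convex algebra_simps)
  then show ?thesis by (simp add: inner_add_left)
qed

lemma edge_point_nrm_self: "(edge_point j t - c) \<bullet> nrm j = apothem"
  unfolding edge_point_nrm vertex_nrm_eq by (simp add: algebra_simps)

lemma edge_point_nrm_le:
  "j < N \<Longrightarrow> k < N \<Longrightarrow> t \<in> {0..1} \<Longrightarrow> (edge_point j t - c) \<bullet> nrm k \<le> apothem"
  unfolding edge_point_nrm using vertex_nrm_le[of j k] vertex_Suc_nrm_le[of j k]
  by (intro convex_bound_le) auto

text \<open>Distinct edges share at most one vertex, so at least one end point of edge
  \<open>j\<close> lies strictly inside the half-plane of edge \<open>k\<close>.\<close>

lemma edge_point_nrm_less:
  assumes "j < N" "k < N" "k \<noteq> j" "0 < t" "t < 1"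
  shows "(edge_point j t - c) \<bullet> nrm k < apothem"
proof -
  have le: "(vertex j - c) \<bullet> nrm k \<le> apothem" "(vertex (Suc j) - c) \<bullet> nrm k \<le> apothem"
    using vertex_nrm_le[of j k] vertex_Suc_nrm_le[of j k] assms by auto
  have "(vertex j - c) \<bullet> nrm k < apothem \<or> (vertex (Suc j) - c) \<bullet> nrm k < apothem"
  proof (cases "j = Suc k mod N")
    case False
    then show ?thesis using vertex_nrm_less[of j k] assms by auto
  next
    case True
    \<comment> \<open>Edge \<open>j\<close> starts where edge \<open>k\<close> ends; with at least
      three vertices its other end is not a vertex of edge \<open>k\<close>.\<close>
    have "Suc j mod N \<noteq> k" "Suc j mod N \<noteq> Suc k mod N"
      using assms True N3 by (auto simp: mod_Suc split: if_splits)
    then show ?thesis using vertex_nrm_less[of "Suc j mod N" k] assms N3 vertex_Suc_mod[of j] by auto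
  qed
  then have "(1 - t) * ((vertex j - c) \<bullet> nrm k) + t * ((vertex (Suc j) - c) \<bullet> nrm k) < (1 - t) * apothem + t * apothem"
    using le assms by (auto intro: add_less_le_mono add_le_less_mono mult_left_mono mult_strict_left_mono)
  also have "\<dots> = apothem" by (simp add: algebra_simps)
  finally show ?thesis unfolding edge_point_nrm .
qed

text \<open>Allowing every integer index spares the wrap-around for the neighbours of an edge and
  for the normal nearest to a given direction.\<close>

lemma region_all_normals:
  assumes "x \<in> region"
  shows "(x - c) \<bullet> dir (of_int i + 1 / 2) \<le> apothem"
proof -
  define k where "k = nat (i mod int N)"
  have k: "k < N" "int k = i mod int N" using N3 by (auto simp: k_def nat_less_iff)
  have "dir (s + of_int m * real N) = dir s" for s m
  proof -
    have "2 * pi * (of_int m * real N) / real N = 2 * pi * of_int m" using N_pos by simp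
    then show ?thesis unfolding dir_def phase_add
      using sin_int_2pin[of m] cos_int_2pin[of m] by (simp add: cos_add sin_add mult_ac)
  qed
  from this[of "real k + 1 / 2" "i div int N"]
  have "dir (real k + 1 / 2 + of_int (i div int N) * real N) = nrm k" by (simp add: nrm_def)
  moreover have "of_int i = real k + of_int (i div int N) * real N"
    using k(2) by (metis (no_types) div_mult_mod_eq of_int_add of_int_mult of_int_of_nat_eq add.commute)
  ultimately have "dir (of_int i + 1 / 2) = nrm k" by (simp add: add_ac)
  then show ?thesis using assms k by (simp add: region_def)
qed

text \<open>Every direction makes an angle of at most pi / N with some edge normal, so the distance
  to the centre times cos (pi / N) is at most \<open>apothem\<close>.\<close>

lemma region_bounded: "region \<subseteq> cball c r"
proof
  fix x assume x: "x \<in> region"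
  show "x \<in> cball c r"
  proof (cases "x = c")
    case False
    define v where "v = (1 / norm (x - c)) *\<^sub>R (x - c)"
    have nv: "norm v = 1" using False by (simp add: v_def)
    then have "(v $ 1)\<^sup>2 + (v $ 2)\<^sup>2 = 1" by (simp add: norm_eq_1 inner_2 power2_eq_square)
    then obtain t where t: "v $ 1 = cos t" "v $ 2 = sin t" using sincos_total_2pi by metis
    define s where "s = (t - \<theta>) * real N / (2 * pi)"
    have "\<theta> + 2 * pi * s / real N = t" using N_pos by (simp add: s_def)
    then have v: "v = dir s" by (intro vector_2_eqI) (simp_all add: dir_def phase_def t)
    define u where "u = s - (of_int \<lfloor>s\<rfloor> + 1 / 2)"
    have u: "\<bar>u\<bar> \<le> 1 / 2" unfolding u_def by linarith
    have "cos (2 * pi * u / real N) = cos \<bar>2 * pi * u / real N\<bar>" by (simp only: cos_abs_real)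
    also have "\<dots> \<ge> cos (pi / real N)"
    proof (rule cos_monotone_0_pi_le)
      show "\<bar>2 * pi * u / real N\<bar> \<le> pi / real N"
        using u N_pos by (simp add: abs_mult field_simps)
      show "pi / real N \<le> pi" using N3 by (simp add: field_simps)
    qed simp
    finally have "norm (x - c) * cos (pi / real N) \<le> norm (x - c) * (dir s \<bullet> dir (of_int \<lfloor>s\<rfloor> + 1 / 2))"
      by (intro mult_left_mono) (simp_all add: dir_inner u_def)
    also have "\<dots> = (x - c) \<bullet> dir (of_int \<lfloor>s\<rfloor> + 1 / 2)"
      using False by (simp add: v[symmetric] v_def)
    also have "\<dots> \<le> r * cos (pi / real N)" using region_all_normals[OF x] by (simp add: apothem_def)
    finally show ?thesis using cos_pos by (simp add: dist_norm norm_minus_commute)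
  qed (use r in simp)
qed

lemma region_eq: "region = (\<Inter>j<N. {x. nrm j \<bullet> x \<le> apothem + c \<bullet> nrm j})"
  by (auto simp: region_def inner_diff_left inner_commute algebra_simps)

lemma region_convex: "convex region" and region_closed: "closed region" and region_bounded': "bounded region"
  unfolding region_eq using region_bounded[unfolded region_eq]
  by (auto intro!: convex_INT convex_halfspace_le closed_INT closed_halfspace_le intro: bounded_subset[OF bounded_cball])

lemma nrm_nonzero: "nrm j \<noteq> 0" using nrm_tangent(2)[of j] by auto

lemma interior_region: "interior region = {x. \<forall>j<N. (x - c) \<bullet> nrm j < apothem}"
proof -
  have "interior region = (\<Inter>j<N. {x. nrm j \<bullet> x < apothem + c \<bullet> nrm j})"
  proof
    have "interior region \<subseteq> {x. nrm j \<bullet> x < apothem + c \<bullet> nrm j}" if "j < N" for j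
    proof -
      have "interior region \<subseteq> interior {x. nrm j \<bullet> x \<le> apothem + c \<bullet> nrm j}"
        using that by (intro interior_mono) (auto simp: region_eq)
      then show ?thesis by (simp add: interior_halfspace_le nrm_nonzero)
    qed
    then show "interior region \<subseteq> (\<Inter>j<N. {x. nrm j \<bullet> x < apothem + c \<bullet> nrm j})" by blast
    show "(\<Inter>j<N. {x. nrm j \<bullet> x < apothem + c \<bullet> nrm j}) \<subseteq> interior region"
      by (rule interior_maximal) (auto simp: region_eq less_imp_le intro!: open_INT open_halfspace_lt)
  qed
  then show ?thesis by (auto simp: inner_diff_left inner_commute algebra_simps)
qed

text \<open>On the line of edge \<open>j\<close> the half-planes of the two neighbouring edges bound
  the parameter from either side: each of their normals takes the value \<open>apothem\<close> at
  one end point and the smaller value r cos (3 pi / N) at the other.\<close>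

lemma region_face:
  assumes x: "x \<in> region" and j: "j < N" and eq: "(x - c) \<bullet> nrm j = apothem"
  shows "\<exists>t\<in>{0..1}. x = edge_point j t"
proof -
  define t where "t = ((x - vertex j) \<bullet> tangent j) / side"
  have "(x - vertex j) \<bullet> nrm j = 0" using eq vertex_nrm_eq(1)[of j] by (simp add: inner_diff_left)
  then have "x - vertex j = (t * side) *\<^sub>R tangent j"
    using orthonormal_expansion[of "x - vertex j" "real j + 1 / 2"] side_pos
    by (simp add: nrm_def tangent_def t_def)
  then have xt: "x = edge_point j t" by (simp add: edge_point_def algebra_simps)
  have n1: "dir (of_int (int j + 1) + 1 / 2) = dir (real j + 3 / 2)" "dir (of_int (int j - 1) + 1 / 2) = dir (real j - 1 / 2)"
    by (simp_all add: algebra_simps)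
  have C: "r * cos (3 * pi / real N) < apothem"
  proof -
    have "cos (pi * of_int 3 / real N) < cos (pi / real N)"
      by (rule cos_le_cos_pi_div(2)) (use N3 in auto)
    then show ?thesis using r by (simp add: apothem_def mult.commute)
  qed
  have vv: "(vertex j - c) \<bullet> dir (real j + 3 / 2) = r * cos (3 * pi / real N)"
    "(vertex (Suc j) - c) \<bullet> dir (real j + 3 / 2) = apothem"
    "(vertex j - c) \<bullet> dir (real j - 1 / 2) = apothem"
    "(vertex (Suc j) - c) \<bullet> dir (real j - 1 / 2) = r * cos (3 * pi / real N)"
    by (simp_all add: vertex_def dir_inner apothem_def)
  have ep: "(x - c) \<bullet> w = (1 - t) * ((vertex j - c) \<bullet> w) + t * ((vertex (Suc j) - c) \<bullet> w)" for w
  proof -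
    have "edge_point j t - c = (1 - t) *\<^sub>R (vertex j - c) + t *\<^sub>R (vertex (Suc j) - c)"
      by (simp add: edge_point_convex algebra_simps)
    then show ?thesis by (simp add: xt inner_add_left)
  qed
  define C3 where "C3 = r * cos (3 * pi / real N)"
  have "(1 - t) * C3 + t * apothem \<le> apothem"
    using region_all_normals[OF x, of "int j + 1"] unfolding n1 ep vv by (simp add: C3_def)
  then have "(1 - t) * (apothem - C3) \<ge> 0" by (simp add: algebra_simps)
  then have "t \<le> 1" using C by (simp add: C3_def zero_le_mult_iff)
  have "(1 - t) * apothem + t * C3 \<le> apothem"
    using region_all_normals[OF x, of "int j - 1"] unfolding n1 ep vv by (simp add: C3_def)
  then have "t * (apothem - C3) \<ge> 0" by (simp add: algebra_simps)
  then have "t \<ge> 0" using C by (simp add: C3_def zero_le_mult_iff)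
  then show ?thesis using \<open>t \<le> 1\<close> xt by (intro bexI[of _ t]) auto
qed

text \<open>Reduces the inside and the outside of the curve to the interior and the complement of a
  bounded closed convex set.\<close>

lemma polygon_eq_frontier: "polygon N q = frontier region"
proof -
  have "frontier region = {x\<in>region. \<exists>j<N. (x - c) \<bullet> nrm j = apothem}"
    unfolding frontier_def interior_region using region_closed
    by (auto simp: region_def not_less) (metis order_antisym)
  also have "\<dots> = polygon N q"
  proof (intro set_eqI iffI)
    fix x assume "x \<in> {x\<in>region. \<exists>j<N. (x - c) \<bullet> nrm j = apothem}"
    then show "x \<in> polygon N q" using region_face by (force simp: polygon_eq)
  next
    fix x assume "x \<in> polygon N q"
    then obtain j t where "j < N" "t \<in> {0..1}" "x = edge_point j t" by (auto simp: polygon_eq)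
    then show "x \<in> {x\<in>region. \<exists>j<N. (x - c) \<bullet> nrm j = apothem}"
      using edge_point_nrm_le edge_point_nrm_self by (auto simp: region_def)
  qed
  finally show ?thesis by simp
qed

lemma inside_polygon: "inside (polygon N q) = interior region"
  unfolding polygon_eq_frontier by (rule inside_frontier_eq_interior[OF region_bounded' region_convex])

lemma outside_polygon: "outside (polygon N q) = - region"
  unfolding polygon_eq_frontier
  using outside_frontier_eq_complement_closure[OF region_bounded' region_convex] region_closed by simp

text \<open>Length and orthogonality leave only the sign open, and a short step along the inward
  normal stays in \<open>region\<close>.\<close>

lemma outer_unit_normal_eq:
  assumes \<nu>: "is_outer_unit_normal N q \<nu>" and j: "j < N" and x: "x \<in> edge N q j"
  shows "\<nu> x = nrm j"
proof -
  obtain t where t: "0 < t" "t < 1" "x = edge_point j t" using x edge_eq[OF j] by auto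
  have "\<nu> x \<bullet> (vertex (Suc j) - vertex j) = 0"
    using \<nu> j x unfolding is_outer_unit_normal_def by (simp add: q_vertex vnext_vertex)
  then have perp: "\<nu> x \<bullet> tangent j = 0" using vertex_diff[of j] side_pos by simp
  have n1: "norm (\<nu> x) = 1"
    and out: "\<forall>\<^sub>F \<epsilon> in at_right 0. x + \<epsilon> *\<^sub>R \<nu> x \<in> - region"
    using \<nu> j x unfolding is_outer_unit_normal_def outside_polygon by auto
  define s where "s = \<nu> x \<bullet> nrm j"
  have "\<nu> x = s *\<^sub>R nrm j"
    using orthonormal_expansion[of "\<nu> x" "real j + 1 / 2"] perp side_pos by (simp add: nrm_def tangent_def s_def)
  moreover from this n1 have "\<bar>s\<bar> = 1" using nrm_tangent(2)[of j] by simp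
  moreover have "s \<noteq> -1"
  proof
    assume "s = -1"
    then have nu: "\<nu> x = - nrm j" using \<open>\<nu> x = s *\<^sub>R nrm j\<close> by simp
    \<comment> \<open>The vectors from the centre to the two vertices add up to 2 apothem nrm j. A
      step of length \<epsilon> against the normal therefore lowers both convex weights of
      \<open>x\<close> by \<epsilon> / (2 apothem), and below this bound they remain
      positive.\<close>
    define \<delta> where "\<delta> = 2 * apothem * min t (1 - t)"
    have \<delta>: "\<delta> > 0" using t apothem_pos by (simp add: \<delta>_def)
    have reg: "x + \<epsilon> *\<^sub>R \<nu> x \<in> region" if "0 < \<epsilon>" "\<epsilon> < \<delta>" for \<epsilon>
    proof -
      define \<beta> where "\<beta> = \<epsilon> / (2 * apothem)"
      have \<beta>: "\<beta> > 0" "\<beta> < t" "\<beta> < 1 - t"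
      proof -
        have "\<delta> \<le> 2 * apothem * t" "\<delta> \<le> 2 * apothem * (1 - t)"
          using apothem_pos by (simp_all add: \<delta>_def)
        then have "\<epsilon> < 2 * apothem * t" "\<epsilon> < 2 * apothem * (1 - t)" using that by linarith+
        then show "\<beta> > 0" "\<beta> < t" "\<beta> < 1 - t"
          using that apothem_pos by (simp_all add: \<beta>_def divide_less_eq mult_ac)
      qed
      have "(2 * apothem) *\<^sub>R nrm j = (vertex (Suc j) - c) + (vertex j - c)"
        using vertex_add[of j] by (simp add: algebra_simps scaleR_2)
      then have "\<beta> *\<^sub>R ((2 * apothem) *\<^sub>R nrm j) = \<beta> *\<^sub>R ((vertex (Suc j) - c) + (vertex j - c))" by simp
      then have en: "\<epsilon> *\<^sub>R nrm j = \<beta> *\<^sub>R (vertex (Suc j) - c) + \<beta> *\<^sub>R (vertex j - c)"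
        using apothem_pos unfolding scaleR_add_right by (simp add: \<beta>_def)
      have "x - c = (1 - t) *\<^sub>R (vertex j - c) + t *\<^sub>R (vertex (Suc j) - c)"
        by (simp add: t edge_point_convex algebra_simps)
      then have decomp: "x + \<epsilon> *\<^sub>R \<nu> x - c = (1 - t - \<beta>) *\<^sub>R (vertex j - c) + (t - \<beta>) *\<^sub>R (vertex (Suc j) - c)"
      proof -
        have "x + \<epsilon> *\<^sub>R \<nu> x - c = (x - c) - \<epsilon> *\<^sub>R nrm j" by (simp add: nu)
        also have "\<dots> = (1 - t - \<beta>) *\<^sub>R (vertex j - c) + (t - \<beta>) *\<^sub>R (vertex (Suc j) - c)"
          unfolding en \<open>x - c = _\<close> by (simp add: scaleR_diff_left)
        finally show ?thesis .
      qed
      show ?thesis unfolding region_def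
      proof (clarify)
        fix k assume k: "k < N"
        have "(x + \<epsilon> *\<^sub>R \<nu> x - c) \<bullet> nrm k \<le> (1 - t - \<beta>) * apothem + (t - \<beta>) * apothem"
          unfolding decomp inner_add_left inner_scaleR_left
          using \<beta> vertex_nrm_le[OF j k] vertex_Suc_nrm_le[OF j k] by (intro add_mono mult_left_mono) auto
        also have "\<dots> \<le> apothem" using \<beta> apothem_pos by (simp add: algebra_simps)
        finally show "(x + \<epsilon> *\<^sub>R \<nu> x - c) \<bullet> nrm k \<le> apothem" .
      qed
    qed
    have "\<forall>\<^sub>F \<epsilon> in at_right 0. 0 < \<epsilon> \<and> \<epsilon> < \<delta>"
      using \<delta> eventually_at_right[OF \<delta>] by auto
    with out have "\<forall>\<^sub>F \<epsilon> in at_right (0::real). False"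
      by eventually_elim (use reg in auto)
    then show False by simp
  qed
  ultimately show ?thesis by (auto simp: abs_if split: if_splits)
qed

end

section \<open>Finite elements on the polygon\<close>

lemma has_integral_affine_unit_interval:
  "((\<lambda>t. (1 - t) * a + t * b) has_integral (a + b) / 2) {0..1::real}"
proof -
  have "((\<lambda>t. (1 - t) * a + t * b) has_integral
      ((\<lambda>t. t * a + t\<^sup>2 / 2 * (b - a)) 1 - (\<lambda>t. t * a + t\<^sup>2 / 2 * (b - a)) 0)) {0..1::real}"
    by (rule fundamental_theorem_of_calculus)
      (auto intro!: derivative_eq_intros simp: has_real_derivative_iff_has_vector_derivative[symmetric] field_simps)
  then show ?thesis by (simp add: field_simps)
qed

lemma sum_cyclic_shift:
  fixes h :: "nat \<Rightarrow> 'a::ab_group_add"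
  assumes "h N = h 0"
  shows "(\<Sum>j<N. h (Suc j)) = (\<Sum>j<N. h j)"
  using sum.lessThan_Suc_shift[of h N] sum.lessThan_Suc[of h N] assms by (simp add: add.commute)

context regular_ngon begin

text \<open>The common value behind the products on the curve. For a velocity \<open>h\<close> of
  the vertices it is, up to constant factors, the first variation of the length of the polygon and
  also that of its area.\<close>

definition vertex_sum :: "(real^2 \<Rightarrow> real^2) \<Rightarrow> real" where
  "vertex_sum h = (\<Sum>j<N. h (vertex j) \<bullet> dir (real j))"

text \<open>The sum over edges is regrouped by vertices: each vertex meets the normals of its two
  edges, at index distance 1/2, and they add up to a multiple of the radial direction.\<close>

lemma sum_nrm:
  "(\<Sum>j<N. (h (vertex j) + h (vertex (Suc j))) \<bullet> nrm j) = 2 * cos (pi / real N) * vertex_sum h"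
proof -
  define k where "k j = h (vertex j) \<bullet> dir (real j - 1 / 2)" for j
  have "k N = k 0" using dir_period[of "- 1 / 2"] by (simp add: k_def vertex_period)
  then have "(\<Sum>j<N. k (Suc j)) = (\<Sum>j<N. k j)" by (rule sum_cyclic_shift)
  moreover have "k (Suc j) = h (vertex (Suc j)) \<bullet> nrm j" for j
    by (simp add: k_def nrm_def add.commute)
  moreover have "h (vertex j) \<bullet> nrm j + k j = 2 * cos (pi / real N) * (h (vertex j) \<bullet> dir (real j))" for j
    using dir_add[of "real j" "1 / 2"] by (simp add: k_def nrm_def flip: inner_add_right)
  then have "(\<Sum>j<N. h (vertex j) \<bullet> nrm j) + (\<Sum>j<N. k j) = 2 * cos (pi / real N) * vertex_sum h"
    by (simp add: vertex_sum_def sum_distrib_left flip: sum.distrib)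
  ultimately show ?thesis by (simp add: inner_add_left sum.distrib)
qed

text \<open>The same regrouping; here it is the difference of the two adjacent tangents that is
  radial.\<close>

lemma sum_tangent:
  "(\<Sum>j<N. (h (vertex (Suc j)) - h (vertex j)) \<bullet> tangent j) = 2 * sin (pi / real N) * vertex_sum h"
proof -
  define k where "k j = h (vertex j) \<bullet> perp (real j - 1 / 2)" for j
  have "k N = k 0" using perp_period[of "- 1 / 2"] by (simp add: k_def vertex_period)
  then have "(\<Sum>j<N. k (Suc j)) = (\<Sum>j<N. k j)" by (rule sum_cyclic_shift)
  moreover have "k (Suc j) = h (vertex (Suc j)) \<bullet> tangent j" for j
    by (simp add: k_def tangent_def add.commute)
  moreover have "k j - h (vertex j) \<bullet> tangent j = 2 * sin (pi / real N) * (h (vertex j) \<bullet> dir (real j))" for j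
    using perp_diff[of "real j" "1 / 2"] by (simp add: k_def tangent_def flip: inner_diff_right)
  then have "(\<Sum>j<N. k j) - (\<Sum>j<N. h (vertex j) \<bullet> tangent j) = 2 * sin (pi / real N) * vertex_sum h"
    by (simp add: vertex_sum_def sum_distrib_left flip: sum_subtractf)
  ultimately show ?thesis by (simp add: inner_diff_left sum_subtractf)
qed

text \<open>Only interior points of the edge are compared, because \<open>\<nu>\<close> is arbitrary
  at the vertices.\<close>

lemma edge_integral_cong:
  assumes "j < N" and "\<And>t. 0 < t \<Longrightarrow> t < 1 \<Longrightarrow> g (edge_point j t) = f t"
  shows "edge_integral N q j g = side * integral {0..1} f"
proof -
  have "integral {0..1} (\<lambda>t. g (edge_point j t)) = integral {0..1} f"
    by (rule integral_spike[of "{0, 1}"]) (use assms(2) in auto)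
  then show ?thesis using assms(1) by (simp add: edge_integral_def edge_length_eq edge_point_q)
qed

lemma continuous_on_edge_point: "continuous_on S (edge_point j)"
  unfolding edge_point_fun by (intro continuous_intros)

lemma W_space_edge_point:
  assumes \<zeta>: "\<zeta> \<in> W_space N q" and j: "j < N" and t: "t \<in> {0..1}"
  shows "\<zeta> (edge_point j t) = (1 - t) * \<zeta> (vertex j) + t * \<zeta> (vertex (Suc j))"
proof -
  obtain l d where l: "linear l" "\<And>x. x \<in> edge N q j \<Longrightarrow> \<zeta> x = l x + d"
    using \<zeta> j unfolding W_space_def by blast
  have "continuous_on (polygon N q) \<zeta>" using \<zeta> by (simp add: W_space_def)
  then have "continuous_on {0..1} (\<lambda>t. \<zeta> (edge_point j t))"
    by (rule continuous_on_compose2[OF _ continuous_on_edge_point]) (use edge_point_in_polygon[OF j] in blast)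
  moreover have "\<zeta> (edge_point j t) = (l (vertex j) + d) + t *\<^sub>R (l (side *\<^sub>R tangent j))" if "0 < t" "t < 1" for t
  proof -
    have "edge_point j t \<in> edge N q j" using that edge_eq[OF j] by simp
    then show ?thesis using l by (simp add: edge_point_def linear_add linear_scale)
  qed
  ultimately have "\<zeta> (edge_point j t) = (1 - t) *\<^sub>R \<zeta> (edge_point j 0) + t *\<^sub>R \<zeta> (edge_point j 1)"
    using continuous_affine_on_unit_interval[of "\<lambda>t. \<zeta> (edge_point j t)", OF _ _ t] by blast
  then show ?thesis by (simp add: edge_point_0_1)
qed

lemma V_space_edge_point:
  assumes "\<eta> \<in> V_space N q" "j < N" "t \<in> {0..1}"
  shows "\<eta> (edge_point j t) = (1 - t) *\<^sub>R \<eta> (vertex j) + t *\<^sub>R \<eta> (vertex (Suc j))"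
  using assms W_space_edge_point[of "\<lambda>x. \<eta> x $ i" j t for i]
  by (simp add: V_space_def vec_eq_iff)

lemma continuous_on_V_space: "\<eta> \<in> V_space N q \<Longrightarrow> continuous_on (polygon N q) \<eta>"
  unfolding V_space_def W_space_def by (subst continuous_on_componentwise) (auto simp: Basis_vec_def inner_axis)

lemma affine_in_W_space:
  assumes "linear l" shows "(\<lambda>x. l x + d) \<in> W_space N q"
  unfolding W_space_def using assms linear_continuous_on[of l]
  by (auto intro!: continuous_intros simp: linear_conv_bounded_linear)

lemma id_in_V_space: "(\<lambda>x. x) \<in> V_space N q"
  unfolding V_space_def
proof (clarify)
  fix i :: 2
  have "linear (\<lambda>x :: real^2. x $ i)" by (intro bounded_linear.linear bounded_linear_vec_nth)
  from affine_in_W_space[OF this, of 0] show "(\<lambda>x. x $ i) \<in> W_space N q" by simp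
qed

lemma const_in_W_space: "(\<lambda>x. d) \<in> W_space N q"
  using affine_in_W_space[OF linear_zero, of d] by simp

lemma W_space_diff:
  assumes "f \<in> W_space N q" "g \<in> W_space N q" shows "(\<lambda>x. f x - g x) \<in> W_space N q"
  unfolding W_space_def
proof (intro CollectI conjI allI impI)
  show "continuous_on (polygon N q) (\<lambda>x. f x - g x)"
    using assms by (intro continuous_intros) (auto simp: W_space_def)
  fix j assume "j < N"
  then obtain l d l' d' where "linear l" "\<forall>x\<in>edge N q j. f x = l x + d" "linear l'" "\<forall>x\<in>edge N q j. g x = l' x + d'"
    using assms unfolding W_space_def by blast
  then show "\<exists>l c. linear l \<and> (\<forall>x\<in>edge N q j. f x - g x = l x + c)"
    by (intro exI[of _ "\<lambda>x. l x - l' x"] exI[of _ "d - d'"]) (auto intro: linear_compose_sub)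
qed

lemma W_space_scale:
  assumes "f \<in> W_space N q" shows "(\<lambda>x. f x * a) \<in> W_space N q"
  unfolding W_space_def
proof (intro CollectI conjI allI impI)
  show "continuous_on (polygon N q) (\<lambda>x. f x * a)"
    using assms by (intro continuous_intros) (auto simp: W_space_def)
  fix j assume "j < N"
  then obtain l d where "linear l" "\<forall>x\<in>edge N q j. f x = l x + d"
    using assms unfolding W_space_def by blast
  then have "linear (\<lambda>x. a *\<^sub>R l x)" "\<forall>x\<in>edge N q j. f x * a = a *\<^sub>R l x + d * a"
    by (auto intro: linear_compose_scale_right simp: algebra_simps simp del: real_scaleR_def) (simp_all add: algebra_simps)
  then show "\<exists>l c. linear l \<and> (\<forall>x\<in>edge N q j. f x * a = l x + c)" by blast
qed

lemma V_space_diff: "f \<in> V_space N q \<Longrightarrow> g \<in> V_space N q \<Longrightarrow> (\<lambda>x. f x - g x) \<in> V_space N q"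
  by (simp add: V_space_def W_space_diff)

lemma V_space_scaleR: "f \<in> W_space N q \<Longrightarrow> (\<lambda>x. f x *\<^sub>R v) \<in> V_space N q"
  by (simp add: V_space_def W_space_scale)

text \<open>The nodal function of vertex \<open>k\<close>, written as the positive part of one
  affine function of the plane: that function is 1 at the vertex, 0 at its two neighbours, whose
  radial component is r cos (2 pi / N), and at most 0 at all other vertices.\<close>

definition hat :: "nat \<Rightarrow> real^2 \<Rightarrow> real" where
  "hat k x = max 0 ((dir (real k) \<bullet> (x - c) - r * cos (2 * pi / real N)) / (r * (1 - cos (2 * pi / real N))))"

lemma hat_vertex: assumes "j < N" "k < N" shows "hat k (vertex j) = (if j = k then 1 else 0)"
  and hat_affine_vertex: "j \<noteq> k \<Longrightarrow> (dir (real k) \<bullet> (vertex j - c) - r * cos (2 * pi / real N)) / (r * (1 - cos (2 * pi / real N))) \<le> 0"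
proof -
  have "cos (2 * pi / real N) < cos 0"
    using N3 by (intro cos_monotone_0_pi) (auto simp: field_simps)
  then have D: "r * (1 - cos (2 * pi / real N)) > 0" using r by simp
  have e: "dir (real k) \<bullet> (vertex j - c) = r * cos (2 * pi * (real k - real j) / real N)"
    by (simp add: vertex_def dir_inner)
  have *: "(dir (real k) \<bullet> (vertex j - c) - r * cos (2 * pi / real N)) / (r * (1 - cos (2 * pi / real N))) \<le> 0" if "j \<noteq> k"
  proof -
    define d where "d = (if k > j then int k - int j else int j - int k)"
    have d: "1 \<le> d" "d \<le> int N - 1" using assms that by (auto simp: d_def)
    \<comment> \<open>Index distances d and N - d have the same cosine; the smaller one puts the
      angle into [0, pi], where the cosine decreases.\<close>
    define e' where "e' = min d (int N - d)"
    have "cos (2 * pi * (real k - real j) / real N) = cos (2 * pi * d / real N)"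
    proof (cases "k > j")
      case False
      then have "2 * pi * (real k - real j) = - (2 * pi * d)" by (simp add: d_def algebra_simps)
      then have "2 * pi * (real k - real j) / real N = - (2 * pi * d / real N)"
        by (simp only: minus_divide_left)
      then show ?thesis by (simp only: cos_minus)
    qed (simp add: d_def)
    also have "\<dots> = cos (2 * pi * e' / real N)"
    proof (cases "d \<le> int N - d")
      case False
      then have "2 * pi * e' / real N = 2 * pi - 2 * pi * d / real N"
        using N_pos by (simp add: e'_def field_simps min_def)
      then show ?thesis by (simp add: cos_diff)
    qed (simp add: e'_def min_def)
    also have "\<dots> \<le> cos (2 * pi / real N)"
    proof (rule cos_monotone_0_pi_le)
      have "real_of_int (2 * e') \<le> real_of_int (int N)" "1 \<le> e'"
        using d by (auto simp: e'_def min_def)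
      then show "2 * pi * e' / real N \<le> pi" "2 * pi / real N \<le> 2 * pi * e' / real N"
        using N_pos by (simp_all add: field_simps)
    qed simp
    finally show ?thesis using r D by (simp add: e divide_le_0_iff)
  qed
  show "j \<noteq> k \<Longrightarrow> (dir (real k) \<bullet> (vertex j - c) - r * cos (2 * pi / real N)) / (r * (1 - cos (2 * pi / real N))) \<le> 0"
    using * .
  show "hat k (vertex j) = (if j = k then 1 else 0)"
  proof (cases "j = k")
    case True
    then have "dir (real k) \<bullet> (vertex j - c) - r * cos (2 * pi / real N) = r * (1 - cos (2 * pi / real N))"
      by (simp add: vertex_def dir_inner right_diff_distrib)
    then show ?thesis using D True by (auto simp: hat_def)
  next
    case False
    then show ?thesis using * by (simp add: hat_def)
  qed
qed

text \<open>Taking the positive part keeps the function affine on each edge because the affine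
  function does not change sign there: it is nonnegative at both ends of the two edges at vertex
  \<open>k\<close> and nonpositive at both ends of every other edge.\<close>

lemma hat_in_W_space: assumes k: "k < N" shows "hat k \<in> W_space N q"
  unfolding W_space_def
proof (intro CollectI conjI allI impI)
  show "continuous_on (polygon N q) (hat k)" unfolding hat_def divide_inverse by (intro continuous_intros)
  define D where "D = r * (1 - cos (2 * pi / real N))"
  define A where "A x = (dir (real k) \<bullet> (x - c) - r * cos (2 * pi / real N)) / D" for x
  have hA: "hat k x = max 0 (A x)" for x by (simp add: hat_def A_def D_def)
  fix j assume j: "j < N"
  define j' where "j' = Suc j mod N"
  have j': "j' < N" "vertex (Suc j) = vertex j'" using N3 vertex_Suc_mod[OF j] by (auto simp: j'_def)
  have Ae: "A (edge_point j t) = (1 - t) * A (vertex j) + t * A (vertex j')" for t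
  proof -
    have "edge_point j t - c = (1 - t) *\<^sub>R (vertex j - c) + t *\<^sub>R (vertex j' - c)"
      by (simp add: edge_point_convex j' algebra_simps)
    then have "dir (real k) \<bullet> (edge_point j t - c) = (1 - t) * (dir (real k) \<bullet> (vertex j - c)) + t * (dir (real k) \<bullet> (vertex j' - c))"
      by (simp only: inner_add_right inner_scaleR_right)
    then have "dir (real k) \<bullet> (edge_point j t - c) - r * cos (2 * pi / real N)
       = (1 - t) * (dir (real k) \<bullet> (vertex j - c) - r * cos (2 * pi / real N)) + t * (dir (real k) \<bullet> (vertex j' - c) - r * cos (2 * pi / real N))"
      by algebra
    then show ?thesis by (simp add: A_def add_divide_distrib)
  qed
  show "\<exists>l d. linear l \<and> (\<forall>x\<in>edge N q j. hat k x = l x + d)"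
  proof (cases "k = j \<or> k = j'")
    case True
    have nn: "0 \<le> A (vertex j)" "0 \<le> A (vertex j')"
    proof -
      have "cos (2 * pi / real N) < cos 0"
        using N3 by (intro cos_monotone_0_pi) (auto simp: field_simps)
      then have D: "D > 0" using r by (simp add: D_def)
      have Av: "A (vertex i) = r * (dir (real k) \<bullet> dir (real i) - cos (2 * pi / real N)) / D" for i
        by (simp add: A_def vertex_def algebra_simps)
      have Ak: "0 \<le> A (vertex k)" using D r \<open>cos (2 * pi / real N) < cos 0\<close> by (simp add: Av dir_inner)
      have nb: "dir (real j) \<bullet> dir (real (Suc j)) = cos (2 * pi / real N)"
        "dir (real (Suc j)) \<bullet> dir (real j) = cos (2 * pi / real N)"
        by (simp_all add: dir_inner)
      have d': "dir (real (Suc j)) = dir (real j')" using j'(2) r by (simp add: vertex_def del: of_nat_Suc)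
      have "A (vertex j') = 0" if "k = j" using nb(1) unfolding d' by (simp add: Av that)
      moreover have "A (vertex j) = 0" if "k = j'" using nb(2) unfolding d' by (simp add: Av that)
      ultimately show "0 \<le> A (vertex j)" "0 \<le> A (vertex j')" using Ak True by auto
    qed
    have "hat k x = A x" if "x \<in> edge N q j" for x
      using that nn by (auto simp: edge_eq[OF j] hA Ae)
    moreover have "A x = (dir (real k) \<bullet> x) / D + (- (dir (real k) \<bullet> c) - r * cos (2 * pi / real N)) / D" for x
      by (simp add: A_def inner_diff_right add_divide_distrib diff_divide_distrib)
    moreover have "linear (\<lambda>x. (dir (real k) \<bullet> x) / D)"
      by (auto intro!: linearI simp: inner_add_right add_divide_distrib)
    ultimately show ?thesis
      by (intro exI[of _ "\<lambda>x. (dir (real k) \<bullet> x) / D"] exI[of _ "(- (dir (real k) \<bullet> c) - r * cos (2 * pi / real N)) / D"])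
        auto
  next
    case False
    then have "A (vertex j) \<le> 0" "A (vertex j') \<le> 0"
      using hat_affine_vertex[OF j k] hat_affine_vertex[OF j'(1) k] by (auto simp: A_def D_def)
    then have "hat k x = 0" if "x \<in> edge N q j" for x
      using that Ae by (auto simp: edge_eq[OF j] hA max_def mult_nonneg_nonpos intro!: antisym add_nonpos_nonpos)
    then show ?thesis by (intro exI[of _ "\<lambda>x. 0"] exI[of _ 0]) (simp add: linear_zero)
  qed
qed

section \<open>Closed forms of the products on the curve\<close>

lemma vertex_islimpt_edge:
  assumes "j < N" shows "vertex j islimpt edge N q j" "vertex (Suc j) islimpt edge N q j"
proof -
  have "p islimpt edge N q j" if "p = vertex j \<or> p = vertex (Suc j)" for p
  proof -
    have "p \<in> closure (edge N q j)"
      using that assms vertex_neq[of j] by (auto simp: edge_def q_vertex vnext_vertex)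
    moreover have "p \<notin> edge N q j"
      using that assms by (auto simp: edge_def q_vertex vnext_vertex open_segment_def)
    ultimately show ?thesis by (simp add: closure_def)
  qed
  then show "vertex j islimpt edge N q j" "vertex (Suc j) islimpt edge N q j" by blast+
qed

text \<open>Only the normal jumps at a vertex: \<open>h\<close> is continuous along the whole curve,
  so the limits from both edges involve the same value of \<open>h\<close>. Both lumped products of
  the system have this form.\<close>

lemma lumped_inner_eq:
  assumes cont: "continuous_on (polygon N q) h"
    and vw: "\<And>j x. j < N \<Longrightarrow> x \<in> edge N q j \<Longrightarrow> v x \<bullet> w x = h x \<bullet> nrm j"
  shows "lumped_inner N q v w = side * cos (pi / real N) * vertex_sum h"
proof -
  have lim: "Lim (at p within edge N q j) (\<lambda>x. v x \<bullet> w x) = h p \<bullet> nrm j"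
    if j: "j < N" and p: "p = vertex j \<or> p = vertex (Suc j)" for j p
  proof (rule tendsto_Lim)
    show "at p within edge N q j \<noteq> bot"
      using vertex_islimpt_edge[OF j] p by (auto simp: trivial_limit_within)
    have pp: "p \<in> polygon N q" using p vertex_in_polygon[OF j] by auto
    have sub: "edge N q j \<subseteq> polygon N q" using j closure_subset by (auto simp: polygon_def)
    have "((\<lambda>x. h x \<bullet> nrm j) \<longlongrightarrow> h p \<bullet> nrm j) (at p within edge N q j)"
      using cont pp by (intro tendsto_intros tendsto_within_subset[OF _ sub]) (simp add: continuous_on_def)
    moreover have "\<forall>\<^sub>F x in at p within edge N q j. h x \<bullet> nrm j = v x \<bullet> w x"
      using vw[OF j] by (simp add: eventually_at_filter)
    ultimately show "((\<lambda>x. v x \<bullet> w x) \<longlongrightarrow> h p \<bullet> nrm j) (at p within edge N q j)"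
      by (rule Lim_transform_eventually)
  qed
  have "lumped_inner N q v w = (1 / 2) * (\<Sum>j<N. side * ((h (vertex j) + h (vertex (Suc j))) \<bullet> nrm j))"
    unfolding lumped_inner_def
    by (intro arg_cong[where f = "(*) (1 / 2)"] sum.cong refl)
      (simp add: edge_length_eq q_vertex vnext_vertex lim inner_add_left)
  also have "\<dots> = side * cos (pi / real N) * vertex_sum h"
    by (simp add: sum_nrm flip: sum_distrib_left)
  finally show ?thesis .
qed

text \<open>The integrand is affine on each edge, where the trapezoidal rule is exact; hence the
  same closed form as for the lumped product.\<close>

lemma curve_inner_normal_eq:
  assumes \<nu>: "is_outer_unit_normal N q \<nu>" and \<eta>: "\<eta> \<in> V_space N q"
  shows "curve_inner N q \<nu> \<eta> = side * cos (pi / real N) * vertex_sum \<eta>"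
proof -
  have "edge_integral N q j (\<lambda>x. \<nu> x \<bullet> \<eta> x) = side * (((\<eta> (vertex j) + \<eta> (vertex (Suc j))) \<bullet> nrm j) / 2)" if j: "j < N" for j
  proof -
    have "edge_integral N q j (\<lambda>x. \<nu> x \<bullet> \<eta> x) = side * integral {0..1} (\<lambda>t. (1 - t) * (\<eta> (vertex j) \<bullet> nrm j) + t * (\<eta> (vertex (Suc j)) \<bullet> nrm j))"
    proof (rule edge_integral_cong[OF j])
      fix t :: real assume t: "0 < t" "t < 1"
      then have "edge_point j t \<in> edge N q j" using edge_eq[OF j] by simp
      then show "\<nu> (edge_point j t) \<bullet> \<eta> (edge_point j t) = (1 - t) * (\<eta> (vertex j) \<bullet> nrm j) + t * (\<eta> (vertex (Suc j)) \<bullet> nrm j)"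
        using t by (simp add: outer_unit_normal_eq[OF \<nu> j] V_space_edge_point[OF \<eta> j] inner_add_right inner_commute)
    qed
    then show ?thesis
      using integral_unique[OF has_integral_affine_unit_interval] by (simp add: inner_add_left)
  qed
  then have "curve_inner N q \<nu> \<eta> = (\<Sum>j<N. (side / 2) * ((\<eta> (vertex j) + \<eta> (vertex (Suc j))) \<bullet> nrm j))"
    unfolding curve_inner_def by (intro sum.cong) (simp_all add: field_simps)
  also have "\<dots> = side * cos (pi / real N) * vertex_sum \<eta>"
    unfolding sum_distrib_left[symmetric] sum_nrm by simp
  finally show ?thesis .
qed

lemma surface_grad_edge_point:
  assumes X: "X \<in> V_space N q" and j: "j < N" and t: "0 < t" "t < 1"
  shows "surface_grad N q j X (edge_point j t) = (\<chi> i k. ((X (vertex (Suc j)) - X (vertex j)) $ i / side) * tangent j $ k)"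
proof -
  have "((\<lambda>s. X (edge_point j t + s *\<^sub>R tangent j)) has_vector_derivative (1 / side) *\<^sub>R (X (vertex (Suc j)) - X (vertex j))) (at 0)"
  proof -
    have d1: "((\<lambda>s. (1 - (t + s / side)) *\<^sub>R X (vertex j) + (t + s / side) *\<^sub>R X (vertex (Suc j))) has_vector_derivative
        (1 / side) *\<^sub>R (X (vertex (Suc j)) - X (vertex j))) (at 0)"
      using side_pos by (auto intro!: derivative_eq_intros simp: algebra_simps)
    have "X (edge_point j t + s *\<^sub>R tangent j) = (1 - (t + s / side)) *\<^sub>R X (vertex j) + (t + s / side) *\<^sub>R X (vertex (Suc j))"
      if "\<bar>s\<bar> < side * min t (1 - t)" for s
    proof -
      have e: "edge_point j t + s *\<^sub>R tangent j = edge_point j (t + s / side)"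
        using side_pos by (simp add: edge_point_def algebra_simps)
      have "side * min t (1 - t) \<le> side * t" "side * min t (1 - t) \<le> side * (1 - t)" using side_pos by simp_all
      then have "\<bar>s\<bar> < side * t" "\<bar>s\<bar> < side * (1 - t)" using that by linarith+
      then have "\<bar>s / side\<bar> < t" "\<bar>s / side\<bar> < 1 - t" using side_pos by (simp_all add: abs_divide divide_less_eq mult.commute)
      then have "t + s / side \<ge> 0" "t + s / side \<le> 1" by linarith+
      then have "t + s / side \<in> {0..1}" by simp
      then show ?thesis unfolding e by (rule V_space_edge_point[OF X j])
    qed
    then have eq: "(1 - (t + s / side)) *\<^sub>R X (vertex j) + (t + s / side) *\<^sub>R X (vertex (Suc j)) = X (edge_point j t + s *\<^sub>R tangent j)"
      if "s \<in> ball 0 (side * min t (1 - t))" for s using that by (simp add: dist_real_def)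
    show ?thesis
      by (rule has_vector_derivative_transform_within_open[OF d1, of "ball 0 (side * min t (1 - t))"])
        (use side_pos t eq in auto)
  qed
  from vector_derivative_at[OF this] show ?thesis
    by (simp add: surface_grad_def edge_tangent_eq[OF j])
qed

text \<open>On an edge the surface gradient is the constant rank one matrix formed from the
  difference quotient and the tangent. Of the two factors 1 / \<open>side\<close> the edge length
  cancels one.\<close>

lemma surface_grad_inner_eq:
  assumes X: "X \<in> V_space N q" and \<eta>: "\<eta> \<in> V_space N q"
  shows "surface_grad_inner N q X \<eta> =
    (\<Sum>j<N. ((X (vertex (Suc j)) - X (vertex j)) \<bullet> (\<eta> (vertex (Suc j)) - \<eta> (vertex j))) / side)"
  unfolding surface_grad_inner_def
proof (rule sum.cong)
  fix j assume "j \<in> {..<N}"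
  then have j: "j < N" by simp
  define K where "K = ((X (vertex (Suc j)) - X (vertex j)) \<bullet> (\<eta> (vertex (Suc j)) - \<eta> (vertex j))) / side\<^sup>2"
  have tt: "tangent j $ 1 * tangent j $ 1 + tangent j $ 2 * tangent j $ 2 = 1"
    using nrm_tangent(5)[of j] by (simp add: inner_2)
  have "edge_integral N q j (\<lambda>x. surface_grad N q j X x \<bullet> surface_grad N q j \<eta> x) = side * integral {0..1::real} (\<lambda>t. K)"
  proof (rule edge_integral_cong[OF j, where f = "\<lambda>t. K"])
    fix t :: real assume t: "0 < t" "t < 1"
    define a b where "a = (X (vertex (Suc j)) - X (vertex j))" "b = (\<eta> (vertex (Suc j)) - \<eta> (vertex j))"
    have "surface_grad N q j X (edge_point j t) \<bullet> surface_grad N q j \<eta> (edge_point j t)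
       = (a $ 1 * b $ 1 + a $ 2 * b $ 2) / side\<^sup>2 * (tangent j $ 1 * tangent j $ 1 + tangent j $ 2 * tangent j $ 2)"
      unfolding surface_grad_edge_point[OF X j t] surface_grad_edge_point[OF \<eta> j t] a_b_def[symmetric]
      using side_pos by (simp add: inner_vec_def sum_2 power2_eq_square field_simps)
    then show "surface_grad N q j X (edge_point j t) \<bullet> surface_grad N q j \<eta> (edge_point j t) = K"
      unfolding tt by (simp add: K_def a_b_def inner_2)
  qed
  then show "edge_integral N q j (\<lambda>x. surface_grad N q j X x \<bullet> surface_grad N q j \<eta> x) =
     ((X (vertex (Suc j)) - X (vertex j)) \<bullet> (\<eta> (vertex (Suc j)) - \<eta> (vertex j))) / side"
    using side_pos by (simp add: K_def power2_eq_square)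
qed simp

lemma surface_grad_inner_id:
  assumes \<eta>: "\<eta> \<in> V_space N q"
  shows "surface_grad_inner N q (\<lambda>x. x) \<eta> = 2 * sin (pi / real N) * vertex_sum \<eta>"
  unfolding surface_grad_inner_eq[OF id_in_V_space \<eta>] sum_tangent[symmetric] vertex_diff
  using side_pos by (simp add: inner_commute)

text \<open>The value is the negative quotient of the factors 2 sin (pi / N) and side cos (pi / N)
  in the two closed forms.\<close>

lemma constant_discrete_curvature:
  assumes "is_outer_unit_normal N q \<nu>" "\<eta> \<in> V_space N q"
  shows "- (1 / apothem) * curve_inner N q \<nu> \<eta> + surface_grad_inner N q (\<lambda>x. x) \<eta> = 0"
  using r cos_pos unfolding curve_inner_normal_eq[OF assms] surface_grad_inner_id[OF assms(2)]
  by (simp add: apothem_def side_def)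

end

section \<open>Affine changes of variables in the plane\<close>

lemma Basis_real_2: "(Basis :: (real^2) set) = {axis 1 1, axis 2 1}"
  by (auto simp: Basis_vec_def UNIV_2)

lemma nn_integral_product_2:
  fixes g h :: "real \<Rightarrow> ennreal"
  assumes "g \<in> borel_measurable borel" "h \<in> borel_measurable borel"
  shows "(\<integral>\<^sup>+w. g (w $ 1) * h (w $ 2) \<partial>(lborel :: (real^2) measure)) = (\<integral>\<^sup>+x. g x \<partial>lborel) * (\<integral>\<^sup>+x. h x \<partial>lborel)"
proof -
  have ne: "axis 1 1 \<noteq> (axis 2 1 :: real^2)" by (simp add: axis_eq_axis)
  define f where "f b = (if b = (axis 1 1 :: real^2) then g else h)" for b
  have "f b \<in> borel_measurable borel" for b using assms by (simp add: f_def)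
  then have "(\<integral>\<^sup>+w. (\<Prod>b\<in>Basis. f b (w \<bullet> b)) \<partial>lborel) = (\<Prod>b\<in>Basis. (\<integral>\<^sup>+x. f b x \<partial>lborel))"
    by (intro nn_integral_lborel_prod) auto
  then show ?thesis using ne by (simp add: Basis_real_2 f_def inner_axis)
qed

lemma integral_product_2:
  fixes g h :: "real \<Rightarrow> real"
  assumes [measurable]: "g \<in> borel_measurable borel" "h \<in> borel_measurable borel"
    and nn: "\<And>x. 0 \<le> g x" "\<And>x. 0 \<le> h x"
  shows "(\<integral>w. g (w $ 1) * h (w $ 2) \<partial>(lborel :: (real^2) measure)) = (\<integral>x. g x \<partial>lborel) * (\<integral>x. h x \<partial>lborel)"
proof -
  have [measurable]: "(\<lambda>w :: real^2. w $ i) \<in> borel_measurable borel" for i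
    by (intro borel_measurable_continuous_onI continuous_intros)
  have "(\<integral>w. g (w $ 1) * h (w $ 2) \<partial>(lborel :: (real^2) measure)) = enn2real (\<integral>\<^sup>+w. ennreal (g (w $ 1)) * ennreal (h (w $ 2)) \<partial>(lborel :: (real^2) measure))"
    by (subst integral_eq_nn_integral) (auto simp: nn ennreal_mult)
  also have "\<dots> = enn2real (\<integral>\<^sup>+x. ennreal (g x) \<partial>lborel) * enn2real (\<integral>\<^sup>+x. ennreal (h x) \<partial>lborel)"
    using nn_integral_product_2[of "\<lambda>x. ennreal (g x)" "\<lambda>x. ennreal (h x)"] by (simp add: enn2real_mult)
  also have "\<dots> = (\<integral>x. g x \<partial>lborel) * (\<integral>x. h x \<partial>lborel)"
    by (simp add: integral_eq_nn_integral nn)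
  finally show ?thesis .
qed

text \<open>Rewrites an integral along an edge as one over the unit square, the form in which the
  limit of the rescaled strips appears.\<close>

lemma integral_unit_square:
  fixes f :: "real \<Rightarrow> real"
  assumes f: "continuous_on {0..1} f"
  shows "(\<integral>w. (indicator {0..1} (w $ 1) * f (w $ 1)) * indicator {0<..<1} (w $ 2) \<partial>(lborel :: (real^2) measure)) = integral {0..1} f"
proof -
  define h :: "real \<Rightarrow> real" where "h = indicator {0<..<1}"
  have h[measurable]: "h \<in> borel_measurable borel" "\<And>x. 0 \<le> h x" by (auto simp: h_def)
  have hI: "(\<integral>x. h x \<partial>lborel) = 1" by (simp add: h_def)
  have proj[measurable]: "(\<lambda>w :: real^2. w $ i) \<in> borel_measurable borel" for i
    by (intro borel_measurable_continuous_onI continuous_intros)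
  have "bounded (f ` {0..1})" by (intro compact_imp_bounded compact_continuous_image f) simp
  then obtain B where B: "B > 0" "\<forall>y\<in>f ` {0..1}. norm y \<le> B" unfolding bounded_pos by blast
  define F where "F x = indicator {0..1} x * f x" for x
  have F[measurable]: "F \<in> borel_measurable borel"
    using borel_measurable_continuous_on_indicator[OF _ f] unfolding F_def by (simp add: scaleR_conv_of_real)
  \<comment> \<open>The product formula is for nonnegative factors. It applies to
    \<open>F + C\<close> and to \<open>C\<close>, and subtraction gives it for
    \<open>F\<close>.\<close>
  define C where "C x = B * indicator {0..1} x" for x :: real
  have C[measurable]: "C \<in> borel_measurable borel" by (simp add: C_def[abs_def])
  have FC: "\<bar>F x\<bar> \<le> C x" for x using B(2) by (auto simp: F_def C_def indicator_def)
  have Cint: "integrable lborel C" unfolding C_def[abs_def] by (intro integrable_mult_right integrable_real_indicator) auto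
  have Fint: "integrable lborel F"
    by (rule Bochner_Integration.integrable_bound[OF Cint]) (use FC in \<open>auto intro: order_trans[OF _ abs_ge_self]\<close>)
  have b2: "integrable lborel (\<lambda>w :: real^2. C (w $ 1) * h (w $ 2))"
  proof (rule Bochner_Integration.integrable_bound)
    show "integrable lborel (\<lambda>w :: real^2. B * indicator (cbox 0 (vector [1, 1])) w)"
      by (intro integrable_mult_right integrable_real_indicator) (auto simp: emeasure_lborel_cbox_eq)
    show "AE w in (lborel :: (real^2) measure). norm (C (w $ 1) * h (w $ 2)) \<le> norm (B * indicator (cbox 0 (vector [1, 1])) w)"
      using B(1) by (intro AE_I2) (auto simp: C_def h_def indicator_def mem_box_cart forall_2 abs_mult)
  qed measurable
  have i2: "integrable lborel (\<lambda>w :: real^2. F (w $ 1) * h (w $ 2))"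
    by (rule Bochner_Integration.integrable_bound[OF b2])
      (use FC h(2) in \<open>auto simp: abs_mult intro!: mult_right_mono order_trans[OF _ abs_ge_self]\<close>)
  have "(\<integral>w. (F (w $ 1) + C (w $ 1)) * h (w $ 2) \<partial>(lborel :: (real^2) measure)) = (\<integral>x. F x + C x \<partial>lborel)"
    by (subst integral_product_2[of "\<lambda>x. F x + C x" h]) (use FC h in \<open>auto simp: hI abs_le_iff intro: order_trans\<close>, smt (verit) FC)
  moreover have "(\<integral>w. C (w $ 1) * h (w $ 2) \<partial>(lborel :: (real^2) measure)) = (\<integral>x. C x \<partial>lborel)"
    by (subst integral_product_2[of C h]) (use B h in \<open>auto simp: hI C_def\<close>)
  ultimately have "(\<integral>w. F (w $ 1) * h (w $ 2) \<partial>(lborel :: (real^2) measure)) = (\<integral>x. F x \<partial>lborel)"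
    using i2 b2 Fint Cint by (simp add: distrib_right)
  moreover have "(\<integral>x. F x \<partial>lborel) = integral {0..1} f"
  proof -
    have "set_integrable lborel {0..1} f" using Fint by (simp add: set_integrable_def F_def[abs_def])
    from set_borel_integral_eq_integral(2)[OF this] show ?thesis
      by (simp add: set_lebesgue_integral_def F_def)
  qed
  ultimately show ?thesis by (simp add: F_def h_def)
qed

lemma integral_translate:
  fixes f :: "'a::euclidean_space \<Rightarrow> real"
  assumes [measurable]: "f \<in> borel_measurable borel"
  shows "integrable lborel (\<lambda>x. f (v + x)) \<longleftrightarrow> integrable lborel f"
    "(\<integral>x. f (v + x) \<partial>lborel) = (\<integral>x. f x \<partial>lborel)"
proof -
  have "integrable (distr lborel borel ((+) v)) f \<longleftrightarrow> integrable lborel (\<lambda>x. f (v + x))"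
    by (subst integrable_distr_eq) auto
  then show "integrable lborel (\<lambda>x. f (v + x)) \<longleftrightarrow> integrable lborel f" by (simp add: lborel_distr_plus)
  have "integral\<^sup>L (distr lborel borel ((+) v)) f = (\<integral>x. f (v + x) \<partial>lborel)"
    by (subst integral_distr) auto
  then show "(\<integral>x. f (v + x) \<partial>lborel) = (\<integral>x. f x \<partial>lborel)" by (simp add: lborel_distr_plus)
qed

lemma integral_affine_change_of_variables:
  fixes g :: "real^2 \<Rightarrow> real" and L :: "real^2 \<Rightarrow> real^2"
  assumes gm: "g \<in> borel_measurable borel" and g: "integrable lborel g" and L: "linear L" and det: "det (matrix L) \<noteq> 0"
  shows "(\<integral>x. g x \<partial>lborel) = \<bar>det (matrix L)\<bar> * (\<integral>w. g (v + L w) \<partial>lborel)"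
proof -
  define G where "G x = g (v + x)" for x
  have Gm: "G \<in> borel_measurable borel" unfolding G_def using gm by measurable
  have Gi: "integrable lborel G" using integral_translate(1)[OF gm] g by (simp add: G_def[abs_def])
  \<comment> \<open>The linear change of variables is applied to a vector-valued function, so the
    scalar is carried in \<open>real^1\<close>.\<close>
  define G1 :: "real^2 \<Rightarrow> real^1" where "G1 x = vec (G x)" for x
  have surj: "range L = UNIV"
    using det L by (simp add: det_nz_iff_inj linear_injective_imp_surjective)
  have "G absolutely_integrable_on UNIV"
    using Gi Gm by (simp add: set_integrable_def integrable_completion)
  then have "G1 absolutely_integrable_on UNIV" by (simp add: absolutely_integrable_on_1_iff G1_def)
  then have a: "G1 absolutely_integrable_on (L ` UNIV)" by (simp add: surj)
  then have cv: "integral (L ` UNIV) G1 = \<bar>det (matrix L)\<bar> *\<^sub>R integral UNIV (G1 \<circ> L)"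
    by (intro integral_change_of_variables_linear[OF L]) simp
  have a2: "(G1 \<circ> L) absolutely_integrable_on UNIV"
    using a absolutely_integrable_on_linear_image[OF L, where f = G1 and S = UNIV] det by simp
  then have GL: "(G \<circ> L) absolutely_integrable_on UNIV"
    by (simp add: absolutely_integrable_on_1_iff G1_def o_def)
  have "integral UNIV G = \<bar>det (matrix L)\<bar> * integral UNIV (G \<circ> L)"
    using cv by (simp add: surj integral_on_1_eq G1_def o_def vec_eq_iff)
  moreover have "integral UNIV G = (\<integral>x. G x \<partial>lborel)"
    using set_lebesgue_integral_eq_integral(2)[OF \<open>G absolutely_integrable_on UNIV\<close>] Gm
    by (simp add: set_lebesgue_integral_def integral_completion)
  moreover have "integral UNIV (G \<circ> L) = (\<integral>x. G (L x) \<partial>lborel)"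
  proof -
    have "L \<in> borel_measurable borel"
      using L linear_continuous_on[of L] by (intro borel_measurable_continuous_onI) (simp add: linear_conv_bounded_linear)
    then have "(\<lambda>x. G (L x)) \<in> borel_measurable borel" using Gm by measurable
    then show ?thesis using set_lebesgue_integral_eq_integral(2)[OF GL]
      by (simp add: set_lebesgue_integral_def integral_completion o_def)
  qed
  ultimately show ?thesis using integral_translate(2)[OF gm, of v] by (simp add: G_def)
qed

section \<open>The divergence theorem on the polygon\<close>

definition clip :: "real \<Rightarrow> real" where "clip u = max 0 (min 1 u)"

lemma clip_bounds: "0 \<le> clip u" "clip u \<le> 1" by (auto simp: clip_def)

lemma clip_lipschitz: "\<bar>clip u - clip v\<bar> \<le> \<bar>u - v\<bar>" by (auto simp: clip_def)

lemma lipschitz_on_prod_unit_interval: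
  fixes f :: "'i \<Rightarrow> 'a::metric_space \<Rightarrow> real"
  assumes "finite I" "\<And>i. i \<in> I \<Longrightarrow> K-lipschitz_on UNIV (f i)" "\<And>i x. 0 \<le> f i x" "\<And>i x. f i x \<le> 1"
  shows "\<exists>L. L-lipschitz_on UNIV (\<lambda>x. \<Prod>i\<in>I. f i x)"
  using assms(1,2)
proof (induction I rule: finite_induct)
  case empty
  then show ?case by (intro exI[of _ 0]) (simp add: lipschitz_on_def)
next
  case (insert i I)
  then obtain L where L: "L-lipschitz_on UNIV (\<lambda>x. \<Prod>i\<in>I. f i x)" by auto
  have K: "K-lipschitz_on UNIV (f i)" using insert by simp
  have "(K + L)-lipschitz_on UNIV (\<lambda>x. f i x * (\<Prod>i\<in>I. f i x))"
  proof (rule lipschitz_onI)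
    fix x y
    define P where "P x = (\<Prod>i\<in>I. f i x)" for x
    have P: "0 \<le> P x" "P x \<le> 1" for x using assms(3,4) by (auto simp: P_def intro: prod_nonneg prod_le_1)
    have "f i x * P x - f i y * P y = (f i x - f i y) * P x + f i y * (P x - P y)" by algebra
    then have "\<bar>f i x * P x - f i y * P y\<bar> \<le> \<bar>f i x - f i y\<bar> * P x + f i y * \<bar>P x - P y\<bar>"
      using P[of x] assms(3)[of i y] abs_triangle_ineq[of "(f i x - f i y) * P x" "f i y * (P x - P y)"] by (simp add: abs_mult)
    also have "\<dots> \<le> (K * dist x y) * 1 + 1 * (L * dist x y)"
      using lipschitz_onD[OF K, of x y] lipschitz_onD[OF L, of x y] P assms(3,4)
      by (intro add_mono mult_mono) (auto simp: dist_real_def P_def)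
    finally show "dist (f i x * (\<Prod>i\<in>I. f i x)) (f i y * (\<Prod>i\<in>I. f i y)) \<le> (K + L) * dist x y"
      by (simp add: dist_real_def P_def algebra_simps)
  qed (use lipschitz_on_nonneg[OF K] lipschitz_on_nonneg[OF L] in simp)
  then show ?case using insert by auto
qed

lemma DERIV_prod_finite:
  fixes f :: "'i \<Rightarrow> real \<Rightarrow> real"
  assumes "finite I" "\<And>i. i \<in> I \<Longrightarrow> (f i has_real_derivative D i) (at x)"
  shows "((\<lambda>h. \<Prod>i\<in>I. f i h) has_real_derivative (\<Sum>i\<in>I. D i * (\<Prod>l\<in>I - {i}. f l x))) (at x)"
proof -
  have "((\<lambda>h. \<Prod>i\<in>I. f i h) has_derivative (\<lambda>y. \<Sum>i\<in>I. D i * y * (\<Prod>l\<in>I - {i}. f l x))) (at x)"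
    using assms by (intro has_derivative_prod) (simp add: has_field_derivative_def)
  then show ?thesis
    unfolding has_field_derivative_def
    by (rule has_derivative_eq_rhs) (auto simp: fun_eq_iff sum_distrib_right sum_distrib_left mult_ac)
qed

locale ngon_in_domain = bounded_open_domain \<Omega> + regular_ngon N q c r \<theta>
  for \<Omega> :: "(real^2) set" and N :: nat and q :: "nat \<Rightarrow> real^2" and c :: "real^2" and r \<theta> :: real +
  fixes E :: "((real^2) \<times> (real^2)) set"
  assumes polygon_subset: "polygon N q \<subseteq> closure \<Omega>"
    and finE: "finite E" and frontier_eq: "frontier \<Omega> = (\<Union>(a, b)\<in>E. closed_segment a b)"
begin

text \<open>A boundary segment of \<open>\<Omega>\<close> lies on the line through the edge or meets it in at most one point.\<close>

lemma frontier_near_edge: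
  "\<exists>bad. finite bad \<and> (\<forall>t. t \<notin> bad \<longrightarrow>
     (\<forall>\<^sub>F x in nhds (edge_point j t). x \<in> frontier \<Omega> \<longrightarrow> (x - edge_point j t) \<bullet> nrm j = 0))"
proof -
  define f where "f x = (x - c) \<bullet> nrm j - apothem" for x
  have f0: "f (edge_point j t) = 0" for t by (simp add: f_def edge_point_nrm_self)
  have fdiff: "(x - edge_point j t) \<bullet> nrm j = f x" for x t
  proof -
    have "(x - edge_point j t) \<bullet> nrm j = (x - c) \<bullet> nrm j - (edge_point j t - c) \<bullet> nrm j"
      by (simp only: inner_diff_left[symmetric]) simp
    then show ?thesis by (simp only: f_def edge_point_nrm_self)
  qed
  define S where "S p = closed_segment (fst p) (snd p)" for p :: "(real^2) \<times> (real^2)"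
  define bad where "bad = (\<Union>p\<in>{p\<in>E. \<not> (\<forall>x\<in>S p. f x = 0)}. {t. edge_point j t \<in> S p})"
  have "finite {t. edge_point j t \<in> S p}" if p: "\<not> (\<forall>x\<in>S p. f x = 0)" for p
  proof -
    obtain a b where ab: "p = (a, b)" by (cases p)
    have aff: "f ((1 - u) *\<^sub>R a + u *\<^sub>R b) = (1 - u) * f a + u * f b" for u
      by (simp add: f_def inner_diff_left inner_add_left algebra_simps)
    have "t = t'" if t: "edge_point j t \<in> S p" and t': "edge_point j t' \<in> S p" for t t'
    proof -
      obtain u u' where u: "edge_point j t = (1 - u) *\<^sub>R a + u *\<^sub>R b" "edge_point j t' = (1 - u') *\<^sub>R a + u' *\<^sub>R b"
        using t t' by (auto simp: S_def ab in_segment)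
      have z: "(1 - u) * f a + u * f b = 0" "(1 - u') * f a + u' * f b = 0"
        using f0[of t] f0[of t'] aff u by auto
      have "u = u'"
      proof (rule ccontr)
        assume "u \<noteq> u'"
        have "(u - u') * (f b - f a) = 0" using z by algebra
        then have "f b = f a" using \<open>u \<noteq> u'\<close> by simp
        moreover from this z(1) have "f a = 0" by (simp add: algebra_simps)
        ultimately have "f x = 0" if "x \<in> S p" for x using that aff by (auto simp: S_def ab in_segment)
        then show False using p by blast
      qed
      then have "edge_point j t = edge_point j t'" using u by simp
      then show "t = t'" using side_pos nrm_tangent(3)[of j] by (auto simp: edge_point_def)
    qed
    then show ?thesis by (metis (mono_tags, lifting) finite.emptyI finite_insert finite_subset mem_Collect_eq singletonI subsetI)
  qed
  then have "finite bad" using finE by (auto simp: bad_def)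
  moreover have "\<forall>\<^sub>F x in nhds (edge_point j t). x \<in> frontier \<Omega> \<longrightarrow> (x - edge_point j t) \<bullet> nrm j = 0" if t: "t \<notin> bad" for t
  proof -
    have "\<forall>\<^sub>F x in nhds (edge_point j t). x \<in> S p \<longrightarrow> f x = 0" if p: "p \<in> E" for p
    proof (cases "\<forall>x\<in>S p. f x = 0")
      case False
      then have "edge_point j t \<in> - S p" using t p unfolding bad_def by blast
      moreover have "open (- S p)" by (simp add: S_def open_Compl)
      ultimately have "\<forall>\<^sub>F x in nhds (edge_point j t). x \<in> - S p" by (intro eventually_nhds_in_open)
      then show ?thesis by eventually_elim simp
    qed simp
    then have "\<forall>\<^sub>F x in nhds (edge_point j t). \<forall>p\<in>E. x \<in> S p \<longrightarrow> f x = 0"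
      by (intro eventually_ball_finite finE) blast
    then show ?thesis
      by eventually_elim (force simp: frontier_eq fdiff S_def)
  qed
  ultimately show ?thesis by blast
qed

text \<open>Near \<open>x\<close> the frontier lies on the line orthogonal to \<open>n\<close>, so
  each open half disc is contained in \<Omega> or disjoint from it. If the half disc of the
  \<open>y m\<close> is contained in \<Omega>, continuity gives the limit. If not, \<Omega> fills
  the other half disc, the \<open>y m\<close> are eventually outside \<Omega>, and
  \<open>\<xi> x\<close> is zero as a one-sided boundary value.\<close>

lemma one_sided_limit:
  assumes \<xi>: "\<xi> \<in> H10 \<Omega>" and cont: "continuous_on (closure \<Omega>) \<xi>"
    and x: "x \<in> closure \<Omega>" and n: "norm n = 1"
    and fr: "\<forall>\<^sub>F z in nhds x. z \<in> frontier \<Omega> \<longrightarrow> (z - x) \<bullet> n = 0"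
    and y: "y \<longlonglongrightarrow> x" and neg: "\<And>m. (y m - x) \<bullet> n < 0"
  shows "(\<lambda>m. indicator \<Omega> (y m) * (\<xi> (y m) \<bullet> v)) \<longlonglongrightarrow> \<xi> x \<bullet> v"
proof -
  obtain \<epsilon> where \<epsilon>: "\<epsilon> > 0" "\<And>z. dist z x < \<epsilon> \<Longrightarrow> z \<in> frontier \<Omega> \<Longrightarrow> (z - x) \<bullet> n = 0"
    using fr unfolding eventually_nhds_metric by blast
  define Hm where "Hm = ball x \<epsilon> \<inter> {z. n \<bullet> z < n \<bullet> x}"
  define Hp where "Hp = ball x \<epsilon> \<inter> {z. n \<bullet> z > n \<bullet> x}"
  have conn: "connected Hm" "connected Hp" unfolding Hm_def Hp_def
    by (intro convex_connected convex_Int convex_ball convex_halfspace_lt convex_halfspace_gt)+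
  have mem: "z \<in> Hm \<longleftrightarrow> z \<in> ball x \<epsilon> \<and> (z - x) \<bullet> n < 0" "z \<in> Hp \<longleftrightarrow> z \<in> ball x \<epsilon> \<and> (z - x) \<bullet> n > 0" for z
    by (auto simp: Hm_def Hp_def inner_commute[of "z - x" n] inner_diff_right)
  have nofr: "Hm \<inter> frontier \<Omega> = {}" "Hp \<inter> frontier \<Omega> = {}"
    using \<epsilon>(2) by (force simp: mem dist_commute)+
  have yH: "\<forall>\<^sub>F m in sequentially. y m \<in> Hm"
    using tendstoD[OF y \<epsilon>(1)] by eventually_elim (use neg in \<open>auto simp: mem dist_commute\<close>)
  show ?thesis
  proof (cases "Hm \<inter> \<Omega> = {}")
    case False
    then have sub: "Hm \<subseteq> \<Omega>" using connected_Int_frontier[OF conn(1), of \<Omega>] nofr by blast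
    have ev: "\<forall>\<^sub>F m in sequentially. y m \<in> closure \<Omega>"
      using yH by eventually_elim (use sub closure_subset in blast)
    have "(\<lambda>m. \<xi> (y m)) \<longlonglongrightarrow> \<xi> x"
      by (rule continuous_within_tendsto_compose[OF _ ev y])
        (use cont x in \<open>simp add: continuous_on_eq_continuous_within\<close>)
    then have "(\<lambda>m. \<xi> (y m) \<bullet> v) \<longlonglongrightarrow> \<xi> x \<bullet> v" by (intro tendsto_intros)
    moreover have "\<forall>\<^sub>F m in sequentially. \<xi> (y m) \<bullet> v = indicator \<Omega> (y m) * (\<xi> (y m) \<bullet> v)"
      using yH by eventually_elim (use sub in auto)
    ultimately show ?thesis by (rule Lim_transform_eventually)
  next
    case True
    \<comment> \<open>A point of \<Omega> near \<open>x\<close> cannot lie below the line; a small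
      shift along \<open>n\<close> inside the open set also moves it off the line.\<close>
    have "Hp \<inter> \<Omega> \<noteq> {}"
    proof -
      obtain z where z: "z \<in> ball x \<epsilon>" "z \<in> \<Omega>"
        using x \<epsilon>(1) by (metis closure_approachable mem_ball dist_commute)
      have "open (ball x \<epsilon> \<inter> \<Omega>)" using op by auto
      then obtain e where e: "e > 0" "ball z e \<subseteq> ball x \<epsilon> \<inter> \<Omega>" using z open_contains_ball by (metis IntI)
      define z' where "z' = z + (e / 2) *\<^sub>R n"
      have "z' \<in> ball z e" using e n by (simp add: z'_def dist_norm)
      then have z': "z' \<in> ball x \<epsilon>" "z' \<in> \<Omega>" using e by auto
      have "(z - x) \<bullet> n \<ge> 0" using z True by (force simp: mem)
      moreover have "(z' - x) \<bullet> n = (z - x) \<bullet> n + e / 2"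
        using n by (simp add: z'_def inner_diff_left inner_add_left norm_eq_1)
      ultimately have "z' \<in> Hp" using z' e by (simp add: mem)
      then show ?thesis using z' by blast
    qed
    then have sub: "Hp \<subseteq> \<Omega>" using connected_Int_frontier[OF conn(2), of \<Omega>] nofr by blast
    have "\<xi> x = 0"
      by (rule H10_zero_at_one_sided_boundary_point[OF \<xi> cont x \<epsilon>(1) n]) (use sub True mem in blast)+
    moreover have "\<forall>\<^sub>F m in sequentially. indicator \<Omega> (y m) * (\<xi> (y m) \<bullet> v) = 0"
      using yH by eventually_elim (use True in \<open>auto simp: indicator_def disjoint_iff\<close>)
    ultimately show ?thesis by (simp add: tendsto_eventually)
  qed
qed

section \<open>Lipschitz cutoffs of the polygon\<close>

definition depth :: "nat \<Rightarrow> real^2 \<Rightarrow> real" where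
  "depth k x = apothem - (x - c) \<bullet> nrm k"

lemma continuous_on_depth: "continuous_on S (depth k)"
  unfolding depth_def by (intro continuous_intros)

lemma region_depth: "x \<in> region \<longleftrightarrow> (\<forall>k<N. 0 \<le> depth k x)"
  by (auto simp: region_def depth_def)

lemma interior_region_depth: "x \<in> interior region \<longleftrightarrow> (\<forall>k<N. 0 < depth k x)"
  by (auto simp: interior_region depth_def)

text \<open>\<open>depth\<close> is a signed distance, positive on the side of the centre. The
  product of the clipped distances therefore vanishes off the open polygon and tends to its
  indicator as \<delta> tends to 0, with derivatives that are explicit almost everywhere.\<close>

definition cutoff :: "real \<Rightarrow> real^2 \<Rightarrow> real" where
  "cutoff \<delta> x = (\<Prod>k<N. clip (depth k x / \<delta>))"

text \<open>The factor of the cutoff gradient that lives on the strip along edge \<open>k\<close>.\<close>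

definition strip :: "real \<Rightarrow> nat \<Rightarrow> real^2 \<Rightarrow> real" where
  "strip \<delta> k x = indicator {0<..<\<delta>} (depth k x) * (\<Prod>l\<in>{..<N} - {k}. clip (depth l x / \<delta>))"

lemma cutoff_lipschitz: assumes "\<delta> > 0" shows "\<exists>L. L-lipschitz_on UNIV (cutoff \<delta>)"
  unfolding cutoff_def
proof (rule lipschitz_on_prod_unit_interval[where K = "1 / \<delta>"])
  fix k
  show "(1 / \<delta>)-lipschitz_on UNIV (\<lambda>x. clip (depth k x / \<delta>))"
  proof (rule lipschitz_onI)
    fix x y :: "real^2"
    have "\<bar>clip (depth k x / \<delta>) - clip (depth k y / \<delta>)\<bar> \<le> \<bar>depth k x / \<delta> - depth k y / \<delta>\<bar>" by (rule clip_lipschitz)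
    also have "depth k x / \<delta> - depth k y / \<delta> = ((y - x) \<bullet> nrm k) / \<delta>"
      by (simp add: depth_def inner_diff_left diff_divide_distrib add_divide_distrib)
    also have "\<bar>((y - x) \<bullet> nrm k) / \<delta>\<bar> \<le> norm (y - x) / \<delta>"
      using Cauchy_Schwarz_ineq2[of "y - x" "nrm k"] assms by (simp add: nrm_tangent abs_divide divide_right_mono)
    finally show "dist (clip (depth k x / \<delta>)) (clip (depth k y / \<delta>)) \<le> 1 / \<delta> * dist x y"
      by (simp add: dist_norm norm_minus_commute)
  qed (use assms in simp)
qed (auto simp: clip_bounds)

lemma cutoff_bounds: "0 \<le> cutoff \<delta> x" "cutoff \<delta> x \<le> 1"
  by (auto simp: cutoff_def clip_bounds intro!: prod_nonneg prod_le_1)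

lemma strip_bounds: "0 \<le> strip \<delta> k x" "strip \<delta> k x \<le> 1"
proof -
  have "0 \<le> (\<Prod>l\<in>{..<N} - {k}. clip (depth l x / \<delta>))" "(\<Prod>l\<in>{..<N} - {k}. clip (depth l x / \<delta>)) \<le> 1"
    by (auto simp: clip_bounds intro!: prod_nonneg prod_le_1)
  then show "0 \<le> strip \<delta> k x" "strip \<delta> k x \<le> 1" by (auto simp: strip_def indicator_def)
qed

lemma strip_support: assumes "\<delta> > 0" "k < N" "strip \<delta> k x \<noteq> 0" shows "x \<in> region"
  unfolding region_depth
proof (intro allI impI)
  fix l assume l: "l < N"
  show "0 \<le> depth l x"
  proof (cases "l = k")
    case True
    then show ?thesis using assms by (auto simp: strip_def indicator_def split: if_splits)
  next
    case False
    then have "clip (depth l x / \<delta>) \<noteq> 0" using assms l by (auto simp: strip_def)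
    then show ?thesis using assms(1) by (auto simp: clip_def max_def min_def divide_le_0_iff zero_le_divide_iff not_le split: if_splits)
  qed
qed

lemma measurable_depth[measurable]: "depth k \<in> borel_measurable borel"
  by (intro borel_measurable_continuous_onI continuous_on_depth)

lemma measurable_clip[measurable]: "clip \<in> borel_measurable borel"
  unfolding clip_def by measurable

lemma measurable_strip[measurable]: "strip \<delta> k \<in> borel_measurable borel"
  unfolding strip_def by measurable

text \<open>The kinks lie on the finitely many lines where some \<open>depth\<close> equals 0 or
  \<delta>; elsewhere each factor is locally constant or affine, and the product rule
  applies.\<close>

lemma cutoff_derivative:
  assumes \<delta>: "\<delta> > 0"
  shows "AE x in lborel. ((\<lambda>h. cutoff \<delta> (x + h *\<^sub>R e)) has_real_derivative
     (\<Sum>k<N. - (nrm k \<bullet> e) / \<delta> * strip \<delta> k x)) (at 0)"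
proof -
  have hyp: "AE x in lborel. depth k x \<noteq> b" for k b
  proof -
    have "{x. depth k x = b} = {x. nrm k \<bullet> x = apothem - b + nrm k \<bullet> c}"
      by (auto simp: depth_def inner_diff_left inner_diff_right inner_commute)
    then have "negligible {x. depth k x = b}" using nrm_nonzero by (simp add: negligible_hyperplane)
    moreover have "{x. depth k x = b} \<in> sets lborel"
      using measurable_depth[of k] by (simp add: borel_measurable_eq)
    ultimately have "{x. depth k x = b} \<in> null_sets lborel"
      by (simp add: negligible_iff_null_sets null_sets_completion_iff)
    then show ?thesis using AE_not_in by fastforce
  qed
  have "AE x in lborel. \<forall>k\<in>{..<N}. depth k x \<noteq> 0 \<and> depth k x \<noteq> \<delta>"
    by (subst AE_ball_countable) (use hyp in auto)
  then show ?thesis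
  proof eventually_elim
    case (elim x)
    have "((\<lambda>h. clip (depth k (x + h *\<^sub>R e) / \<delta>)) has_real_derivative - (nrm k \<bullet> e) / \<delta> * indicator {0<..<\<delta>} (depth k x)) (at 0)"
      if k: "k < N" for k
    proof -
      have dk: "depth k (x + h *\<^sub>R e) = depth k x - h * (nrm k \<bullet> e)" for h
        by (simp add: depth_def inner_diff_left inner_add_left inner_commute[of e])
      have lim: "((\<lambda>h. depth k (x + h *\<^sub>R e)) \<longlongrightarrow> depth k x - 0 * (nrm k \<bullet> e)) (nhds 0)"
        unfolding dk by (intro tendsto_intros filterlim_ident)
      consider "depth k x < 0" | "0 < depth k x" "depth k x < \<delta>" | "\<delta> < depth k x" using elim k by force
      then show ?thesis
      proof cases
        case 1
        have "\<forall>\<^sub>F h in nhds 0. depth k (x + h *\<^sub>R e) < 0" using order_tendstoD(2)[OF lim] 1 by simp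
        then have "\<forall>\<^sub>F h in nhds 0. 0 = clip (depth k (x + h *\<^sub>R e) / \<delta>)"
          by eventually_elim (use \<delta> in \<open>simp add: clip_def max_def min_def zero_le_divide_iff\<close>)
        then have "((\<lambda>h. clip (depth k (x + h *\<^sub>R e) / \<delta>)) has_real_derivative 0) (at 0)"
          using DERIV_cong_ev[OF refl, of "\<lambda>h. 0" "\<lambda>h. clip (depth k (x + h *\<^sub>R e) / \<delta>)" 0 0 0] by simp
        then show ?thesis using 1 by simp
      next
        case 2
        have "\<forall>\<^sub>F h in nhds 0. depth k (x + h *\<^sub>R e) > 0" using order_tendstoD(1)[OF lim] 2 by simp
        moreover have "\<forall>\<^sub>F h in nhds 0. depth k (x + h *\<^sub>R e) < \<delta>" using order_tendstoD(2)[OF lim] 2 by simp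
        ultimately have "\<forall>\<^sub>F h in nhds 0. (depth k x - h * (nrm k \<bullet> e)) / \<delta> = clip (depth k (x + h *\<^sub>R e) / \<delta>)"
          by eventually_elim (use \<delta> in \<open>simp add: clip_def max_def min_def dk divide_less_0_iff\<close>)
        moreover have "((\<lambda>h. (depth k x - h * (nrm k \<bullet> e)) / \<delta>) has_real_derivative - (nrm k \<bullet> e) / \<delta>) (at 0)"
          using \<delta> by (auto intro!: derivative_eq_intros)
        ultimately show ?thesis
          using 2 DERIV_cong_ev[OF refl, of "\<lambda>h. (depth k x - h * (nrm k \<bullet> e)) / \<delta>" "\<lambda>h. clip (depth k (x + h *\<^sub>R e) / \<delta>)" 0] by simp
      next
        case 3
        have "\<forall>\<^sub>F h in nhds 0. depth k (x + h *\<^sub>R e) > \<delta>" using order_tendstoD(1)[OF lim] 3 by simp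
        then have "\<forall>\<^sub>F h in nhds 0. 1 = clip (depth k (x + h *\<^sub>R e) / \<delta>)"
          by eventually_elim (use \<delta> in \<open>simp add: clip_def max_def min_def\<close>)
        then have "((\<lambda>h. clip (depth k (x + h *\<^sub>R e) / \<delta>)) has_real_derivative 0) (at 0)"
          using DERIV_cong_ev[OF refl, of "\<lambda>h. 1" "\<lambda>h. clip (depth k (x + h *\<^sub>R e) / \<delta>)" 0 0 0] by simp
        then show ?thesis using 3 by simp
      qed
    qed
    from DERIV_prod_finite[of "{..<N}", OF _ this]
    have "((\<lambda>h. \<Prod>k<N. clip (depth k (x + h *\<^sub>R e) / \<delta>)) has_real_derivative
      (\<Sum>k<N. - (nrm k \<bullet> e) / \<delta> * indicator {0<..<\<delta>} (depth k x) * (\<Prod>l\<in>{..<N} - {k}. clip (depth l (x + 0 *\<^sub>R e) / \<delta>)))) (at 0)"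
      by simp
    then show ?case by (simp add: cutoff_def strip_def mult.assoc)
  qed
qed

text \<open>The normal component of \<xi>, extended by zero outside \<Omega>, weighted by the strip.
  The extension makes it a Borel function on the plane even where the strip leaves \<Omega>.\<close>

definition flux :: "(real^2 \<Rightarrow> real^2) \<Rightarrow> real \<Rightarrow> nat \<Rightarrow> real^2 \<Rightarrow> real" where
  "flux \<xi> \<delta> k x = indicator \<Omega> x * (\<xi> x \<bullet> nrm k) * strip \<delta> k x"

lemma measurable_flux:
  assumes cont: "continuous_on (closure \<Omega>) \<xi>"
  shows "flux \<xi> \<delta> k \<in> borel_measurable borel"
proof -
  have "continuous_on \<Omega> (\<lambda>x. \<xi> x \<bullet> nrm k)"
    by (intro continuous_intros continuous_on_subset[OF cont closure_subset])
  then have "(\<lambda>x. indicator \<Omega> x *\<^sub>R (\<xi> x \<bullet> nrm k)) \<in> borel_measurable borel"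
    using op by (intro borel_measurable_continuous_on_indicator) auto
  then show ?thesis unfolding flux_def[abs_def] by simp
qed

lemma flux_bound:
  assumes cont: "continuous_on (closure \<Omega>) \<xi>"
  shows "\<exists>B\<ge>0. (\<forall>x\<in>closure \<Omega>. norm (\<xi> x) \<le> B) \<and> (\<forall>\<delta> k x. \<bar>flux \<xi> \<delta> k x\<bar> \<le> B)"
proof -
  have "bounded (\<xi> ` closure \<Omega>)"
    using cont bd by (intro compact_imp_bounded compact_continuous_image) auto
  then obtain B where B: "B > 0" "\<forall>y\<in>\<xi> ` closure \<Omega>. norm y \<le> B" unfolding bounded_pos by blast
  have "\<bar>flux \<xi> \<delta> k x\<bar> \<le> B" for \<delta> k x
  proof (cases "x \<in> \<Omega>")
    case True
    then have "norm (\<xi> x) \<le> B" using B closure_subset by blast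
    moreover have "\<bar>\<xi> x \<bullet> nrm k\<bar> \<le> norm (\<xi> x)" using Cauchy_Schwarz_ineq2[of "\<xi> x" "nrm k"] by (simp add: nrm_tangent)
    ultimately have "\<bar>\<xi> x \<bullet> nrm k\<bar> * strip \<delta> k x \<le> B * 1"
      using strip_bounds[of \<delta> k x] B(1) by (intro mult_mono) auto
    then show ?thesis using True strip_bounds[of \<delta> k x] by (simp add: flux_def abs_mult)
  qed (use B in \<open>simp add: flux_def\<close>)
  then show ?thesis using B by (intro exI[of _ B]) auto
qed

lemma integrable_flux:
  assumes cont: "continuous_on (closure \<Omega>) \<xi>" and \<delta>: "\<delta> > 0" and k: "k < N"
  shows "integrable lborel (flux \<xi> \<delta> k)"
proof -
  obtain B where B: "B \<ge> 0" "\<And>x. \<bar>flux \<xi> \<delta> k x\<bar> \<le> B" using flux_bound[OF cont] by blast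
  show ?thesis
  proof (rule Bochner_Integration.integrable_bound)
    show "integrable lborel (\<lambda>x. B * indicator (cball c r) x)"
      by (intro integrable_mult_right integrable_real_indicator) (use emeasure_lborel_cball_finite in \<open>auto simp: less_top\<close>)
    show "AE x in lborel. norm (flux \<xi> \<delta> k x) \<le> norm (B * indicator (cball c r) x)"
    proof (rule AE_I2)
      fix x
      show "norm (flux \<xi> \<delta> k x) \<le> norm (B * indicator (cball c r) x)"
      proof (cases "x \<in> cball c r")
        case True
        then show ?thesis using B by simp
      next
        case False
        then have "strip \<delta> k x = 0" using strip_support[OF \<delta> k] region_bounded by blast
        then show ?thesis by (simp add: flux_def)
      qed
    qed
  qed (use measurable_flux[OF cont] in simp)
qed

text \<open>Integration by parts with the cutoff as multiplier, once per diagonal entry of the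
  gradient. Its sign cancels the one in the gradient of the cutoff, which points inward.\<close>

lemma integral_divg_cutoff:
  assumes \<xi>: "\<xi> \<in> H10 \<Omega>" and cont: "continuous_on (closure \<Omega>) \<xi>" and \<delta>: "\<delta> > 0"
  shows "(\<integral>x. divg \<Omega> \<xi> x * cutoff \<delta> x \<partial>lebesgue_on \<Omega>) = (\<Sum>k<N. (1 / \<delta>) * (\<integral>x. flux \<xi> \<delta> k x \<partial>lborel))"
proof -
  let ?M = "lebesgue_on \<Omega>"
  obtain L where L: "L-lipschitz_on UNIV (cutoff \<delta>)" using cutoff_lipschitz[OF \<delta>] by blast
  define D where "D i x = (\<Sum>k<N. - (nrm k \<bullet> axis i 1) / \<delta> * strip \<delta> k x)" for i :: 2 and x
  have Dm: "D i \<in> borel_measurable borel" for i unfolding D_def[abs_def] by measurable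
  have ibp: "(\<integral>x. weak_grad \<Omega> \<xi> x $ i $ i * cutoff \<delta> x \<partial>?M) = - (\<integral>x. \<xi> x $ i * D i x \<partial>?M)" for i
    by (rule H10_integration_by_parts[OF \<xi> L _ Dm]) (use cutoff_derivative[OF \<delta>] in \<open>simp add: D_def\<close>)
  have cm: "cutoff \<delta> \<in> borel_measurable borel"
    by (intro borel_measurable_continuous_onI lipschitz_on_continuous_on[OF L])
  have csq: "square_integrable ?M (cutoff \<delta>)"
    by (intro fin.square_integrable_bounded[where B = 1] measurable_lebesgue_on cm AE_I2) (use cutoff_bounds in auto)
  have ssq: "square_integrable ?M (strip \<delta> k)" for k
    by (intro fin.square_integrable_bounded[where B = 1] measurable_lebesgue_on measurable_strip AE_I2) (use strip_bounds in auto)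
  have Dsq: "square_integrable ?M (D i)" for i
  proof -
    have "square_integrable ?M (\<lambda>x. \<Sum>k\<in>K. - (nrm k \<bullet> axis i 1) / \<delta> * strip \<delta> k x)" if "finite K" for K
      using that
    proof (induction K rule: finite_induct)
      case empty
      then show ?case by (simp add: square_integrable_def)
    next
      case (insert k K)
      then show ?case by (simp only: sum.insert[OF insert(1,2)]) (intro square_integrable_add square_integrable_cmult ssq)
    qed
    then show ?thesis by (simp add: D_def[abs_def])
  qed
  note i1 = square_integrable_mult[OF L2_component2[OF H10_D(3)[OF \<xi>]] csq]
  note i2 = square_integrable_mult[OF L2_component[OF H10_D(1)[OF \<xi>]] Dsq]
  note i3 = square_integrable_mult[OF L2_component[OF H10_D(1)[OF \<xi>]] ssq]
  have "(\<integral>x. divg \<Omega> \<xi> x * cutoff \<delta> x \<partial>?M) = (\<integral>x. weak_grad \<Omega> \<xi> x $ 1 $ 1 * cutoff \<delta> x + weak_grad \<Omega> \<xi> x $ 2 $ 2 * cutoff \<delta> x \<partial>?M)"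
    by (simp add: divg_def trace_def sum_2 distrib_right)
  also have "\<dots> = - (\<integral>x. \<xi> x $ 1 * D 1 x \<partial>?M) + - (\<integral>x. \<xi> x $ 2 * D 2 x \<partial>?M)"
    by (simp only: Bochner_Integration.integral_add[OF i1 i1] ibp)
  also have "\<dots> = (\<integral>x. - (\<xi> x $ 1 * D 1 x) + - (\<xi> x $ 2 * D 2 x) \<partial>?M)"
    using i2[of 1 1] i2[of 2 2] by simp
  also have "\<dots> = (\<integral>x. (\<Sum>k<N. (1 / \<delta>) * ((\<xi> x \<bullet> nrm k) * strip \<delta> k x)) \<partial>?M)"
  proof (rule Bochner_Integration.integral_cong[OF refl])
    fix x
    have "- (\<xi> x $ 1 * D 1 x) + - (\<xi> x $ 2 * D 2 x)
        = (\<Sum>k<N. \<xi> x $ 1 * ((nrm k \<bullet> axis 1 1) / \<delta> * strip \<delta> k x) + \<xi> x $ 2 * ((nrm k \<bullet> axis 2 1) / \<delta> * strip \<delta> k x))"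
      unfolding D_def by (simp add: sum_negf sum_distrib_left sum.distrib)
    also have "\<dots> = (\<Sum>k<N. (1 / \<delta>) * ((\<xi> x \<bullet> nrm k) * strip \<delta> k x))"
      by (intro sum.cong refl) (simp add: inner_axis axis_def inner_2 add_divide_distrib algebra_simps)
    finally show "- (\<xi> x $ 1 * D 1 x) + - (\<xi> x $ 2 * D 2 x) = (\<Sum>k<N. (1 / \<delta>) * ((\<xi> x \<bullet> nrm k) * strip \<delta> k x))" .
  qed
  also have "\<dots> = (\<Sum>k<N. (1 / \<delta>) * (\<integral>x. (\<xi> x \<bullet> nrm k) * strip \<delta> k x \<partial>?M))"
  proof -
    have "integrable ?M (\<lambda>x. (\<xi> x \<bullet> nrm k) * strip \<delta> k x)" for k
    proof -
      have "integrable ?M (\<lambda>x. nrm k $ 1 * (\<xi> x $ 1 * strip \<delta> k x) + nrm k $ 2 * (\<xi> x $ 2 * strip \<delta> k x))"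
        using i3[of 1 k] i3[of 2 k] by simp
      then show ?thesis by (simp add: inner_2 algebra_simps)
    qed
    then show ?thesis by (subst Bochner_Integration.integral_sum) auto
  qed
  also have "\<dots> = (\<Sum>k<N. (1 / \<delta>) * (\<integral>x. flux \<xi> \<delta> k x \<partial>lborel))"
  proof (intro sum.cong refl arg_cong[where f = "(*) (1 / \<delta>)"])
    fix k
    have "(\<integral>x. (\<xi> x \<bullet> nrm k) * strip \<delta> k x \<partial>?M) = (\<integral>x. flux \<xi> \<delta> k x \<partial>lebesgue)"
      using integral_restrict_space[of \<Omega> lebesgue "\<lambda>x. (\<xi> x \<bullet> nrm k) * strip \<delta> k x"] op
      by (simp add: flux_def[abs_def] mult.assoc)
    then show "(\<integral>x. (\<xi> x \<bullet> nrm k) * strip \<delta> k x \<partial>?M) = (\<integral>x. flux \<xi> \<delta> k x \<partial>lborel)"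
      using measurable_flux[OF cont] by (simp add: integral_completion)
  qed
  finally show ?thesis .
qed

text \<open>The coordinates along the edge and inward, the latter in units of \<delta>, have
  Jacobian side * \<delta>. The \<delta> cancels, and the strip no longer shrinks.\<close>

lemma integral_flux_rescaled:
  assumes cont: "continuous_on (closure \<Omega>) \<xi>" and \<delta>: "\<delta> > 0" and k: "k < N"
  shows "(1 / \<delta>) * (\<integral>x. flux \<xi> \<delta> k x \<partial>lborel)
    = side * (\<integral>w. flux \<xi> \<delta> k (edge_point k (w $ 1) - (\<delta> * w $ 2) *\<^sub>R nrm k) \<partial>(lborel :: (real^2) measure))"
proof -
  define L where "L w = (w $ 1 * side) *\<^sub>R tangent k - (\<delta> * w $ 2) *\<^sub>R nrm k" for w :: "real^2"
  have L: "linear L" by (auto intro!: linearI simp: L_def algebra_simps)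
  define C S where "C = cos (phase (real k + 1 / 2))" "S = sin (phase (real k + 1 / 2))"
  have CS: "C * C + S * S = 1" by (simp add: C_S_def flip: power2_eq_square)
  have "det (matrix L) = side * \<delta> * (C * C + S * S)"
    by (simp add: det_2 matrix_def L_def axis_def tangent_def nrm_def perp_def dir_def C_S_def[symmetric] algebra_simps)
  then have det: "det (matrix L) = side * \<delta>" by (simp add: CS)
  have "(\<integral>x. flux \<xi> \<delta> k x \<partial>lborel) = \<bar>det (matrix L)\<bar> * (\<integral>w. flux \<xi> \<delta> k (vertex k + L w) \<partial>lborel)"
    by (rule integral_affine_change_of_variables[OF measurable_flux[OF cont] integrable_flux[OF cont \<delta> k] L])
      (use det side_pos \<delta> in simp)
  moreover have "vertex k + L w = edge_point k (w $ 1) - (\<delta> * w $ 2) *\<^sub>R nrm k" for w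
    by (simp add: L_def edge_point_def)
  ultimately show ?thesis using det side_pos \<delta> by simp
qed

lemma depth_shifted: "depth l (edge_point k t - s *\<^sub>R nrm k) = depth l (edge_point k t) + s * (nrm k \<bullet> nrm l)"
  by (simp add: depth_def inner_diff_left)

text \<open>At an interior point of the edge all other edge lines are at positive distance, so their
  clipped factors become 1. Beyond the ends of the edge some other depth is negative and its factor
  becomes 0.\<close>

lemma strip_limit:
  assumes k: "k < N" and t: "t \<noteq> 0" "t \<noteq> 1" and s: "s \<noteq> 0" "s \<noteq> 1"
  shows "\<forall>\<^sub>F m in sequentially. strip (1 / real (Suc m)) k (edge_point k t - (1 / real (Suc m) * s) *\<^sub>R nrm k)
     = indicator {0..1} t * indicator {0<..<1} s"
proof -
  define \<delta> where "\<delta> m = 1 / real (Suc m)" for m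
  have \<delta>: "\<delta> m > 0" for m by (simp add: \<delta>_def)
  have \<delta>0: "\<delta> \<longlonglongrightarrow> 0" unfolding \<delta>_def by (rule LIMSEQ_Suc[OF lim_const_over_n])
  define y where "y m = edge_point k t - (\<delta> m * s) *\<^sub>R nrm k" for m
  have dk: "depth k (y m) = \<delta> m * s" for m
    using depth_shifted[of k k t "\<delta> m * s"] by (simp add: y_def nrm_tangent depth_def[of k "edge_point k t"] edge_point_nrm_self)
  have i: "indicator {0<..<\<delta> m} (depth k (y m)) = (indicator {0<..<1} s :: real)" for m
    using \<delta>[of m] by (auto simp: dk indicator_def zero_less_mult_iff)
  have dl: "(\<lambda>m. depth l (y m)) \<longlonglongrightarrow> depth l (edge_point k t)" for l
  proof -
    have "(\<lambda>m. depth l (edge_point k t) + (\<delta> m * s) * (nrm k \<bullet> nrm l)) \<longlonglongrightarrow> depth l (edge_point k t) + (0 * s) * (nrm k \<bullet> nrm l)"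
      by (intro tendsto_intros \<delta>0)
    then show ?thesis by (simp add: y_def depth_shifted)
  qed
  have "\<forall>\<^sub>F m in sequentially. strip (\<delta> m) k (y m) = indicator {0..1} t * indicator {0<..<1} s"
  proof (cases "t \<in> {0..1}")
    case True
    have "\<forall>\<^sub>F m in sequentially. clip (depth l (y m) / \<delta> m) = 1" if l: "l \<in> {..<N} - {k}" for l
    proof -
      define e where "e = depth l (edge_point k t)"
      have e: "e > 0" using edge_point_nrm_less[of k l t] k l t True by (simp add: depth_def e_def)
      have "\<forall>\<^sub>F m in sequentially. depth l (y m) > e / 2" using order_tendstoD(1)[OF dl[of l], of "e / 2"] e by (simp add: e_def)
      moreover have "\<forall>\<^sub>F m in sequentially. \<delta> m < e / 2" using order_tendstoD(2)[OF \<delta>0, of "e / 2"] e by simp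
      ultimately show ?thesis
      proof eventually_elim
        case (elim m)
        then have "1 \<le> depth l (y m) / \<delta> m" using \<delta>[of m] by (simp add: pos_le_divide_eq)
        then show ?case by (simp add: clip_def)
      qed
    qed
    then have "\<forall>\<^sub>F m in sequentially. \<forall>l\<in>{..<N} - {k}. clip (depth l (y m) / \<delta> m) = 1"
      by (intro eventually_ball_finite) auto
    then show ?thesis by eventually_elim (use True in \<open>simp add: strip_def i\<close>)
  next
    case False
    \<comment> \<open>Otherwise the point would be in \<open>region\<close> and on the line of edge
      \<open>k\<close>, hence on the edge itself.\<close>
    have "\<exists>l<N. depth l (edge_point k t) < 0"
    proof (rule ccontr)
      assume "\<not> (\<exists>l<N. depth l (edge_point k t) < 0)"
      then have "edge_point k t \<in> region" unfolding region_depth by (meson not_less)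
      then obtain t' where "t' \<in> {0..1}" "edge_point k t = edge_point k t'"
        using region_face[OF _ k edge_point_nrm_self] by blast
      then have "t = t'" using side_pos nrm_tangent(3)[of k] by (auto simp: edge_point_def)
      then show False using False \<open>t' \<in> {0..1}\<close> by simp
    qed
    then obtain l where l: "l < N" "depth l (edge_point k t) < 0" by blast
    then have "l \<noteq> k" by (auto simp: depth_def edge_point_nrm_self)
    have "\<forall>\<^sub>F m in sequentially. depth l (y m) < 0" using order_tendstoD(2)[OF dl l(2)] .
    then show ?thesis
    proof eventually_elim
      case (elim m)
      then have "clip (depth l (y m) / \<delta> m) = 0" using \<delta>[of m] by (simp add: clip_def max_def min_def zero_le_divide_iff)
      then have "(\<Prod>l\<in>{..<N} - {k}. clip (depth l (y m) / \<delta> m)) = 0"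
        using l \<open>l \<noteq> k\<close> by (intro prod_zero) auto
      then show ?case using False by (simp add: strip_def)
    qed
  qed
  then show ?thesis by (simp add: y_def \<delta>_def)
qed

lemma AE_component_not_in_finite:
  assumes "finite B" shows "AE w in (lborel :: (real^2) measure). w $ i \<notin> B"
proof -
  have "AE w in (lborel :: (real^2) measure). w $ i \<noteq> b" for b
  proof -
    have "{w :: real^2. w $ i = b} = {w. axis i 1 \<bullet> w = b}" by (simp add: inner_axis')
    then have "negligible {w :: real^2. w $ i = b}" by (simp add: negligible_hyperplane axis_eq_0_iff)
    moreover have "closed {w :: real^2. w $ i = b}" by (intro closed_Collect_eq continuous_intros)
    ultimately have "{w :: real^2. w $ i = b} \<in> null_sets lborel"
      by (simp add: negligible_iff_null_sets null_sets_completion_iff borel_closed)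
    then show ?thesis using AE_not_in by fastforce
  qed
  then have "AE w in (lborel :: (real^2) measure). \<forall>b\<in>B. w $ i \<noteq> b"
    using assms by (subst AE_ball_countable) (auto intro: countable_finite)
  then show ?thesis by eventually_elim auto
qed

text \<open>After rescaling, dominated convergence leaves a pointwise limit along the inward normal,
  which \<open>one_sided_limit\<close> provides for all but finitely many edge parameters. The
  doubled fraction is 1 / \<delta> for \<delta> = 1/(m+1), as it comes from
  \<open>integral_divg_cutoff\<close>.\<close>

lemma flux_limit:
  assumes \<xi>: "\<xi> \<in> H10 \<Omega>" and cont: "continuous_on (closure \<Omega>) \<xi>" and k: "k < N"
  shows "(\<lambda>m. (1 / (1 / real (Suc m))) * (\<integral>x. flux \<xi> (1 / real (Suc m)) k x \<partial>lborel))
     \<longlonglongrightarrow> side * integral {0..1} (\<lambda>t. \<xi> (edge_point k t) \<bullet> nrm k)"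
proof -
  define \<delta> where "\<delta> m = 1 / real (Suc m)" for m
  have \<delta>: "\<delta> m > 0" "\<delta> m \<le> 1" for m by (simp_all add: \<delta>_def)
  have \<delta>0: "\<delta> \<longlonglongrightarrow> 0" unfolding \<delta>_def by (rule LIMSEQ_Suc[OF lim_const_over_n])
  define A where "A m w = edge_point k (w $ 1) - (\<delta> m * w $ 2) *\<^sub>R nrm k" for m and w :: "real^2"
  define lim where "lim w = (indicator {0..1} (w $ 1) * (\<xi> (edge_point k (w $ 1)) \<bullet> nrm k)) * indicator {0<..<1} (w $ 2)" for w :: "real^2"
  obtain B where B: "B \<ge> 0" "\<And>\<delta> k x. \<bar>flux \<xi> \<delta> k x\<bar> \<le> B" using flux_bound[OF cont] by blast
  obtain bad where bad: "finite bad" "\<And>t. t \<notin> bad \<Longrightarrow>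
     (\<forall>\<^sub>F x in nhds (edge_point k t). x \<in> frontier \<Omega> \<longrightarrow> (x - edge_point k t) \<bullet> nrm k = 0)"
    using frontier_near_edge[of k] by blast
  have pc: "edge_point k t \<in> closure \<Omega>" if "t \<in> {0..1}" for t
    using edge_point_in_polygon[OF k that] polygon_subset by blast
  have ec: "continuous_on {0..1} (\<lambda>t. \<xi> (edge_point k t) \<bullet> nrm k)"
    by (intro continuous_intros continuous_on_compose2[OF cont continuous_on_edge_point]) (use pc in auto)
  \<comment> \<open>The strip and vertex \<open>k\<close> lie in the ball of radius \<open>r\<close>
    about the centre, so the tangential coordinate is at most 2 r, or \<open>K\<close> in units of
    \<open>side\<close>. This gives a majorant supported in one fixed box.\<close>
  define K where "K = (2 * r) / side"
  define w where "w = (\<lambda>x :: real^2. B * indicator (cbox (vector [- K, 0]) (vector [K, 1])) x :: real)"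
  have Am: "A m \<in> borel_measurable borel" for m
    unfolding A_def[abs_def] edge_point_def by (intro borel_measurable_continuous_onI continuous_intros)
  have meas: "(\<lambda>x. flux \<xi> (\<delta> m) k (A m x)) \<in> borel_measurable lborel" for m
    using measurable_compose[OF Am measurable_flux[OF cont]] by simp
  have "(\<lambda>m. \<integral>x. flux \<xi> (\<delta> m) k (A m x) \<partial>lborel) \<longlonglongrightarrow> (\<integral>x. lim x \<partial>lborel)"
  proof (rule integral_dominated_convergence[where w = w])
    show limit: "AE x in lborel. (\<lambda>m. flux \<xi> (\<delta> m) k (A m x)) \<longlonglongrightarrow> lim x"
    proof -
      have fin1: "finite (bad \<union> {0, 1})" using bad(1) by simp
      have fin2: "finite {0, 1 :: real}" by simp
      show ?thesis using AE_component_not_in_finite[OF fin1, of 1] AE_component_not_in_finite[OF fin2, of 2]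
      proof eventually_elim
        case (elim x)
        then have x: "x $ 2 \<noteq> 0 \<and> x $ 2 \<noteq> 1" "x $ 1 \<noteq> 0 \<and> x $ 1 \<noteq> 1 \<and> x $ 1 \<notin> bad" by auto
        have ev: "\<forall>\<^sub>F m in sequentially. strip (\<delta> m) k (A m x) = indicator {0..1} (x $ 1) * indicator {0<..<1} (x $ 2)"
          using strip_limit[OF k, of "x $ 1" "x $ 2"] x by (simp add: A_def \<delta>_def)
        show ?case
        proof (cases "x $ 1 \<in> {0..1} \<and> x $ 2 \<in> {0<..<1}")
          case False
          then have "\<forall>\<^sub>F m in sequentially. flux \<xi> (\<delta> m) k (A m x) = lim x"
            using ev by (auto elim!: eventually_mono simp: flux_def lim_def)
          then show ?thesis by (rule tendsto_eventually)
        next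
          case True
          have "(\<lambda>m. A m x) \<longlonglongrightarrow> edge_point k (x $ 1) - (0 * x $ 2) *\<^sub>R nrm k"
            unfolding A_def by (intro tendsto_intros \<delta>0)
          then have Al: "(\<lambda>m. A m x) \<longlonglongrightarrow> edge_point k (x $ 1)" by simp
          have "(\<lambda>m. indicator \<Omega> (A m x) * (\<xi> (A m x) \<bullet> nrm k)) \<longlonglongrightarrow> \<xi> (edge_point k (x $ 1)) \<bullet> nrm k"
            by (rule one_sided_limit[OF \<xi> cont pc nrm_tangent(2) bad(2) Al])
              (use True x \<delta> in \<open>auto simp: A_def nrm_tangent\<close>)
          moreover have "\<forall>\<^sub>F m in sequentially. indicator \<Omega> (A m x) * (\<xi> (A m x) \<bullet> nrm k) = flux \<xi> (\<delta> m) k (A m x)"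
            using ev by eventually_elim (use True in \<open>simp add: flux_def\<close>)
          ultimately show ?thesis using True by (simp add: lim_def Lim_transform_eventually)
        qed
      qed
    qed
    show "AE x in lborel. norm (flux \<xi> (\<delta> m) k (A m x)) \<le> w x" for m
    proof (rule AE_I2)
      fix x :: "real^2"
      show "norm (flux \<xi> (\<delta> m) k (A m x)) \<le> w x"
      proof (cases "strip (\<delta> m) k (A m x) = 0")
        case True
        then show ?thesis using B(1) by (simp add: flux_def w_def)
      next
        case False
        have "depth k (A m x) = \<delta> m * x $ 2"
          unfolding A_def depth_shifted by (simp add: nrm_tangent depth_def edge_point_nrm_self)
        then have "0 < \<delta> m * x $ 2" "\<delta> m * x $ 2 < \<delta> m"
          using False by (auto simp: strip_def indicator_def split: if_splits)
        then have x2: "0 < x $ 2" "x $ 2 < 1" using \<delta>[of m] by (auto simp: zero_less_mult_iff)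
        have "A m x \<in> cball c r" using strip_support[OF \<delta>(1) k False] region_bounded by blast
        moreover have "vertex k \<in> cball c r" using r by (simp add: vertex_def dist_norm norm_dir)
        ultimately have "norm (A m x - vertex k) \<le> 2 * r"
          using dist_triangle[of "A m x" "vertex k" c] by (simp add: dist_norm norm_minus_commute)
        moreover have "(A m x - vertex k) \<bullet> tangent k = x $ 1 * side"
          by (simp add: A_def edge_point_def inner_diff_left nrm_tangent)
        ultimately have "\<bar>x $ 1 * side\<bar> \<le> 2 * r"
          using Cauchy_Schwarz_ineq2[of "A m x - vertex k" "tangent k"] by (simp add: nrm_tangent)
        then have "\<bar>x $ 1\<bar> \<le> K" using side_pos by (simp add: K_def abs_mult pos_le_divide_eq)
        then have "x \<in> cbox (vector [- K, 0]) (vector [K, 1])" using x2 by (auto simp: mem_box_cart forall_2)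
        then show ?thesis using B(2) by (simp add: w_def)
      qed
    qed
    show "integrable lborel w" unfolding w_def
      by (intro integrable_mult_right integrable_real_indicator) (auto simp: emeasure_lborel_cbox_eq)
    show "lim \<in> borel_measurable lborel"
    proof -
      have "(\<lambda>t. indicator {0..1} t *\<^sub>R (\<xi> (edge_point k t) \<bullet> nrm k)) \<in> borel_measurable borel"
        by (rule borel_measurable_continuous_on_indicator[OF _ ec]) simp
      then have "(\<lambda>t. indicator {0..1} t * (\<xi> (edge_point k t) \<bullet> nrm k)) \<in> borel_measurable borel" by simp
      moreover have p: "(\<lambda>w :: real^2. w $ i) \<in> borel_measurable borel" for i
        by (intro borel_measurable_continuous_onI continuous_intros)
      ultimately have "(\<lambda>w :: real^2. indicator {0..1} (w $ 1) * (\<xi> (edge_point k (w $ 1)) \<bullet> nrm k)) \<in> borel_measurable borel"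
        using measurable_compose by fast
      moreover have "(\<lambda>w :: real^2. indicator {0<..<1} (w $ 2) :: real) \<in> borel_measurable borel"
        by (rule measurable_compose[OF p]) simp
      ultimately show ?thesis unfolding lim_def by (simp add: borel_measurable_times)
    qed
  qed (rule meas)
  then have "(\<lambda>m. side * (\<integral>x. flux \<xi> (\<delta> m) k (A m x) \<partial>lborel)) \<longlonglongrightarrow> side * integral {0..1} (\<lambda>t. \<xi> (edge_point k t) \<bullet> nrm k)"
    unfolding lim_def integral_unit_square[OF ec] by (intro tendsto_intros)
  then show ?thesis
    using integral_flux_rescaled[OF cont \<delta>(1) k] by (simp only: A_def \<delta>_def)
qed

text \<open>The cutoff identity for \<delta> = 1/(m+1) is passed to the limit: the bulk side is
  dominated by the modulus of the divergence, the boundary side converges edge by edge.\<close>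

lemma divergence_theorem_polygon:
  assumes \<xi>: "\<xi> \<in> H10 \<Omega>" and cont: "continuous_on (closure \<Omega>) \<xi>"
  shows "(\<integral>x. divg \<Omega> \<xi> x * indicator (interior region) x \<partial>lebesgue_on \<Omega>)
    = (\<Sum>k<N. side * integral {0..1} (\<lambda>t. \<xi> (edge_point k t) \<bullet> nrm k))"
proof -
  let ?M = "lebesgue_on \<Omega>"
  define \<delta> where "\<delta> m = 1 / real (Suc m)" for m
  have \<delta>: "\<delta> m > 0" for m by (simp add: \<delta>_def)
  have \<delta>0: "\<delta> \<longlonglongrightarrow> 0" unfolding \<delta>_def by (rule LIMSEQ_Suc[OF lim_const_over_n])
  have dsq: "square_integrable ?M (divg \<Omega> \<xi>)"
    unfolding divg_def[abs_def] trace_def sum_2 by (intro square_integrable_add L2_component2[OF H10_D(3)[OF \<xi>]])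
  then have di: "integrable ?M (divg \<Omega> \<xi>)" by (rule fin.square_integrable_imp_integrable)
  have "(\<lambda>m. \<integral>x. divg \<Omega> \<xi> x * cutoff (\<delta> m) x \<partial>?M) \<longlonglongrightarrow> (\<integral>x. divg \<Omega> \<xi> x * indicator (interior region) x \<partial>?M)"
  proof (rule integral_dominated_convergence[where w = "\<lambda>x. norm (divg \<Omega> \<xi> x)"])
    show "AE x in ?M. (\<lambda>m. divg \<Omega> \<xi> x * cutoff (\<delta> m) x) \<longlonglongrightarrow> divg \<Omega> \<xi> x * indicator (interior region) x"
    proof (intro AE_I2 tendsto_mult tendsto_const)
      fix x
      show "(\<lambda>m. cutoff (\<delta> m) x) \<longlonglongrightarrow> indicator (interior region) x"
      proof (cases "x \<in> interior region")
        case True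
        have "\<forall>\<^sub>F m in sequentially. clip (depth k x / \<delta> m) = 1" if "k \<in> {..<N}" for k
        proof -
          have d: "depth k x > 0" using True that by (simp add: interior_region_depth)
          have "\<forall>\<^sub>F m in sequentially. \<delta> m < depth k x" by (rule order_tendstoD(2)[OF \<delta>0 d])
          then show ?thesis
          proof eventually_elim
            case (elim m)
            then have "1 \<le> depth k x / \<delta> m" using \<delta>[of m] by (simp add: pos_le_divide_eq)
            then show ?case by (simp add: clip_def)
          qed
        qed
        then have "\<forall>\<^sub>F m in sequentially. \<forall>k\<in>{..<N}. clip (depth k x / \<delta> m) = 1"
          by (intro eventually_ball_finite) auto
        then have "\<forall>\<^sub>F m in sequentially. cutoff (\<delta> m) x = 1"
          by eventually_elim (simp add: cutoff_def)
        then show ?thesis using True by (simp add: tendsto_eventually)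
      next
        case False
        then obtain k where k: "k < N" "depth k x \<le> 0" by (auto simp: interior_region_depth not_less)
        have "cutoff (\<delta> m) x = 0" for m
        proof -
          have "depth k x / \<delta> m \<le> 0" using k \<delta>[of m] by (simp add: divide_le_0_iff)
          then have "clip (depth k x / \<delta> m) = 0" by (simp add: clip_def)
          then show ?thesis unfolding cutoff_def using k(1) by (intro prod_zero) auto
        qed
        then show ?thesis using False by simp
      qed
    qed
    show "(\<lambda>x. divg \<Omega> \<xi> x * indicator (interior region) x) \<in> borel_measurable ?M"
      by (intro borel_measurable_times[OF borel_measurable_integrable[OF di] measurable_lebesgue_on[OF borel_measurable_indicator]]) auto
    show "(\<lambda>x. divg \<Omega> \<xi> x * cutoff (\<delta> m) x) \<in> borel_measurable ?M" for m
    proof -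
      obtain L where "L-lipschitz_on UNIV (cutoff (\<delta> m))" using cutoff_lipschitz[OF \<delta>] by blast
      then have "cutoff (\<delta> m) \<in> borel_measurable ?M"
        by (intro measurable_lebesgue_on borel_measurable_continuous_onI lipschitz_on_continuous_on)
      then show ?thesis using di by auto
    qed
    show "AE x in ?M. norm (divg \<Omega> \<xi> x * cutoff (\<delta> m) x) \<le> norm (divg \<Omega> \<xi> x)" for m
      using cutoff_bounds by (intro AE_I2) (simp add: abs_mult mult_left_le)
  qed (use di in auto)
  moreover have "(\<lambda>m. \<integral>x. divg \<Omega> \<xi> x * cutoff (\<delta> m) x \<partial>?M) \<longlonglongrightarrow> (\<Sum>k<N. side * integral {0..1} (\<lambda>t. \<xi> (edge_point k t) \<bullet> nrm k))"
    unfolding integral_divg_cutoff[OF \<xi> cont \<delta>] unfolding \<delta>_def by (intro tendsto_sum flux_limit[OF \<xi> cont]) auto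
  ultimately show ?thesis by (rule LIMSEQ_unique)
qed

end

section \<open>The reduced system\<close>

lemma fin_dim_space_combination:
  assumes V: "fin_dim_space V" and uv: "u \<in> V" "v \<in> V"
  shows "(\<lambda>x. u x + a *\<^sub>R v x) \<in> V"
proof -
  obtain B where B: "finite B" "V = {(\<lambda>x. \<Sum>b\<in>B. d b *\<^sub>R b x) | d. True}"
    using V by (auto simp: fin_dim_space_def)
  obtain d d' where "u = (\<lambda>x. \<Sum>b\<in>B. d b *\<^sub>R b x)" "v = (\<lambda>x. \<Sum>b\<in>B. d' b *\<^sub>R b x)"
    using uv unfolding B by blast
  then have "(\<lambda>x. u x + a *\<^sub>R v x) = (\<lambda>x. \<Sum>b\<in>B. (d b + a * d' b) *\<^sub>R b x)"
    by (simp add: fun_eq_iff scaleR_add_left sum.distrib scaleR_sum_right)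
  then show ?thesis unfolding B by (auto intro!: exI[of _ "\<lambda>b. d b + a * d' b"])
qed

lemma fin_dim_space_zero: "fin_dim_space V \<Longrightarrow> (\<lambda>x. 0) \<in> V"
proof -
  assume "fin_dim_space V"
  then obtain B where B: "V = {(\<lambda>x. \<Sum>b\<in>B. d b *\<^sub>R b x) | d. True}" by (auto simp: fin_dim_space_def)
  show "(\<lambda>x. 0) \<in> V" unfolding B by (intro CollectI exI[of _ "\<lambda>b. 0"]) simp
qed

text \<open>Each open triangle is the interior of its closure, so finiteness passes from the closed
  triangles to the open ones. What they leave uncovered lies in finitely many boundaries of convex
  sets.\<close>

lemma regular_partitioning_cover:
  assumes "regular_partitioning \<Omega> \<T>"
  shows "finite \<T>" "\<And>A. A \<in> \<T> \<Longrightarrow> open A \<and> connected A \<and> A \<subseteq> \<Omega>" "negligible (closure \<Omega> - \<Union>\<T>)"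
proof -
  have conv: "open A \<and> convex A" if "A \<in> \<T>" for A
  proof -
    obtain K where K: "2 simplex K" "A = interior K" using assms \<open>A \<in> \<T>\<close> unfolding regular_partitioning_def by blast
    have "convex K" using K(1) by (rule convex_simplex)
    then show ?thesis by (simp add: K(2) convex_interior)
  qed
  show "open A \<and> connected A \<and> A \<subseteq> \<Omega>" if "A \<in> \<T>" for A
    using conv[OF that] assms that by (simp add: convex_connected regular_partitioning_def)
  have "interior (closure A) = A" if "A \<in> \<T>" for A
    using conv[OF that] by (simp add: convex_interior_closure interior_open)
  then have "inj_on closure \<T>" by (rule inj_on_inverseI)
  moreover have "finite (closure ` \<T>)" using assms by (simp add: regular_partitioning_def triangulation_def)
  ultimately show fin: "finite \<T>" by (simp add: finite_image_iff)
  have "negligible (closure A - A)" if "A \<in> \<T>" for A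
    using conv[OF that] negligible_convex_frontier[of A] by (simp add: frontier_def interior_open)
  then have "negligible (\<Union>A\<in>\<T>. closure A - A)" using fin by (intro negligible_Union) auto
  moreover have "closure \<Omega> = (\<Union>A\<in>\<T>. closure A)" using assms by (simp add: regular_partitioning_def)
  then have "closure \<Omega> - \<Union>\<T> \<subseteq> (\<Union>A\<in>\<T>. closure A - A)" by blast
  ultimately show "negligible (closure \<Omega> - \<Union>\<T>)" by (rule negligible_subset)
qed

section \<open>Viscosity and total flux\<close>

context ngon_in_domain begin

text \<open>The three cases of the definition are exhaustive: a connected triangle that misses the
  polygon lies in one phase.\<close>

lemma discrete_viscosity_on_triangle:
  assumes T: "regular_partitioning \<Omega> \<T>" and \<mu>: "is_discrete_viscosity \<Omega> \<T> N q \<mu>m \<mu>p \<mu>" and A: "A \<in> \<T>"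
  shows "\<exists>v\<in>{\<mu>m, \<mu>p, (\<mu>m + \<mu>p) / 2}. \<forall>x\<in>A. \<mu> x = v"
proof -
  have A': "connected A" "A \<subseteq> \<Omega>" using regular_partitioning_cover(2)[OF T A] by auto
  consider "A \<inter> polygon N q \<noteq> {}" | "A \<inter> polygon N q = {}" "A \<inter> region = {}" | "A \<inter> polygon N q = {}" "A \<subseteq> region"
    using connected_Int_frontier[OF A'(1), of region] polygon_eq_frontier by blast
  then show ?thesis
  proof cases
    case 1
    then show ?thesis using \<mu> A unfolding is_discrete_viscosity_def by blast
  next
    case 2
    then have "A \<subseteq> exterior_phase \<Omega> N q" using A'(2) by (auto simp: exterior_phase_def outside_polygon)
    then show ?thesis using \<mu> A unfolding is_discrete_viscosity_def by blast
  next
    case 3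
    then have "A \<subseteq> interior region"
      using region_closed by (auto simp: polygon_eq_frontier frontier_def)
    then have "A \<subseteq> interior_phase N q" by (simp add: interior_phase_def inside_polygon)
    then show ?thesis using \<mu> A unfolding is_discrete_viscosity_def by blast
  qed
qed

lemma discrete_viscosity_AE:
  assumes T: "regular_partitioning \<Omega> \<T>" and \<mu>: "is_discrete_viscosity \<Omega> \<T> N q \<mu>m \<mu>p \<mu>"
  shows "AE x in lebesgue_on \<Omega>. \<mu> x \<in> {\<mu>m, \<mu>p, (\<mu>m + \<mu>p) / 2}"
proof -
  have "AE x in lebesgue. x \<notin> closure \<Omega> - \<Union>\<T>"
    using regular_partitioning_cover(3)[OF T] by (intro AE_not_in) (simp add: negligible_iff_null_sets)
  then have "AE x in lebesgue. x \<in> \<Omega> \<longrightarrow> \<mu> x \<in> {\<mu>m, \<mu>p, (\<mu>m + \<mu>p) / 2}"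
  proof eventually_elim
    case (elim x)
    then show ?case using discrete_viscosity_on_triangle[OF T \<mu>] closure_subset[of \<Omega>] by blast
  qed
  then show ?thesis using AE_restrict_space_iff[of \<Omega> lebesgue] op by simp
qed

text \<open>A preimage is a union of open triangles together with a part of the null set off the
  triangles, where the values are arbitrary; completeness of Lebesgue measure absorbs that
  part.\<close>

lemma discrete_viscosity_measurable:
  assumes T: "regular_partitioning \<Omega> \<T>" and \<mu>: "is_discrete_viscosity \<Omega> \<T> N q \<mu>m \<mu>p \<mu>"
  shows "\<mu> \<in> borel_measurable (lebesgue_on \<Omega>)"
proof (rule borel_measurableI)
  fix S :: "real set" assume "open S"
  define I where "I = {A\<in>\<T>. \<exists>x\<in>A. \<mu> x \<in> S}"
  define R where "R = {x\<in>\<Omega>. \<mu> x \<in> S} - \<Union>\<T>"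
  have "{x\<in>\<Omega>. \<mu> x \<in> S} = \<Union>I \<union> R"
  proof (intro set_eqI iffI)
    fix x assume "x \<in> {x\<in>\<Omega>. \<mu> x \<in> S}"
    then show "x \<in> \<Union>I \<union> R" by (auto simp: I_def R_def)
  next
    fix x assume "x \<in> \<Union>I \<union> R"
    then consider "x \<in> R" | A y where "A \<in> \<T>" "x \<in> A" "y \<in> A" "\<mu> y \<in> S" by (auto simp: I_def)
    then show "x \<in> {x\<in>\<Omega>. \<mu> x \<in> S}"
    proof cases
      case 2
      then obtain v where "\<forall>x\<in>A. \<mu> x = v" using discrete_viscosity_on_triangle[OF T \<mu>, of A] by blast
      then have "\<mu> x = \<mu> y" using 2 by simp
      then show ?thesis using 2 regular_partitioning_cover(2)[OF T] by auto
    qed (simp add: R_def)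
  qed
  moreover have "open (\<Union>I)" using regular_partitioning_cover(2)[OF T] by (auto simp: I_def)
  moreover have "negligible R"
    by (rule negligible_subset[OF regular_partitioning_cover(3)[OF T]]) (use closure_subset[of \<Omega>] in \<open>auto simp: R_def\<close>)
  ultimately have "{x\<in>\<Omega>. \<mu> x \<in> S} \<in> sets lebesgue" by (simp add: negligible_imp_sets sets.Un)
  moreover have "\<mu> -` S \<inter> space (lebesgue_on \<Omega>) = {x\<in>\<Omega>. \<mu> x \<in> S}" by (auto simp: space_restrict_space)
  ultimately show "\<mu> -` S \<inter> space (lebesgue_on \<Omega>) \<in> sets (lebesgue_on \<Omega>)"
    using op by (simp add: sets_restrict_space_iff)
qed

lemma curve_inner_outer_normal:
  assumes \<nu>: "is_outer_unit_normal N q \<nu>"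
  shows "curve_inner N q (\<lambda>x. d *\<^sub>R \<nu> x) \<xi> = d * (\<Sum>k<N. side * integral {0..1} (\<lambda>t. \<xi> (edge_point k t) \<bullet> nrm k))"
proof -
  have "edge_integral N q k (\<lambda>x. (d *\<^sub>R \<nu> x) \<bullet> \<xi> x) = d * (side * integral {0..1} (\<lambda>t. \<xi> (edge_point k t) \<bullet> nrm k))" if k: "k < N" for k
  proof -
    have "edge_integral N q k (\<lambda>x. (d *\<^sub>R \<nu> x) \<bullet> \<xi> x) = side * integral {0..1} (\<lambda>t. d * (\<xi> (edge_point k t) \<bullet> nrm k))"
    proof (rule edge_integral_cong[OF k])
      fix t :: real assume "0 < t" "t < 1"
      then have "edge_point k t \<in> edge N q k" using edge_eq[OF k] by simp
      then show "(d *\<^sub>R \<nu> (edge_point k t)) \<bullet> \<xi> (edge_point k t) = d * (\<xi> (edge_point k t) \<bullet> nrm k)"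
        by (simp add: outer_unit_normal_eq[OF \<nu> k] inner_commute)
    qed
    then show ?thesis by simp
  qed
  then show ?thesis by (simp add: curve_inner_def sum_distrib_left)
qed

text \<open>The factor \<open>d\<close> lets the same fact serve the curvature term of the
  stationary solution and, with \<open>d\<close> = 1, the test of the velocity equation by a
  constant.\<close>

lemma curve_inner_div_free:
  assumes \<nu>: "is_outer_unit_normal N q \<nu>" and ne: "\<Omega> \<noteq> {}"
    and U: "finite_element_space \<Omega> \<T> \<U>" "\<U> \<subseteq> H10 \<Omega>" and P: "fin_dim_space \<P>" "\<P> \<subseteq> L2 \<Omega>"
    and P1: "contains_ae \<Omega> \<P> (\<lambda>x. 1)" and PI: "contains_ae \<Omega> \<P> (indicator (interior_phase N q))"
    and \<xi>: "\<xi> \<in> div_free \<Omega> \<U> \<P>"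
  shows "curve_inner N q (\<lambda>x. d *\<^sub>R \<nu> x) \<xi> = 0"
proof -
  let ?M = "lebesgue_on \<Omega>"
  have \<xi>H: "\<xi> \<in> H10 \<Omega>" and cont: "continuous_on (closure \<Omega>) \<xi>"
    using \<xi> U by (auto simp: div_free_def finite_element_space_def)
  obtain \<phi>1 where \<phi>1: "\<phi>1 \<in> \<P>" "AE x in ?M. \<phi>1 x = 1" using P1 by (auto simp: contains_ae_def)
  obtain \<phi>2 where \<phi>2: "\<phi>2 \<in> \<P>" "AE x in ?M. \<phi>2 x = indicator (interior region) x"
    using PI by (auto simp: contains_ae_def interior_phase_def inside_polygon)
  have mi: "(indicator (interior region) :: _ \<Rightarrow> real) \<in> borel_measurable ?M"
    by (intro measurable_lebesgue_on borel_measurable_indicator) auto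
  \<comment> \<open>The mean over \<Omega> of the indicator of the interior phase.\<close>
  define a where "a = (\<integral>x. indicator (interior region) x \<partial>?M) / measure ?M (space ?M)"
  have pos: "measure ?M (space ?M) > 0"
  proof -
    have "measure ?M (space ?M) = measure lebesgue \<Omega>" using op by (simp add: space_restrict_space measure_restrict_space)
    moreover have "\<not> negligible \<Omega>" using open_not_negligible[OF op] ne by blast
    then have "measure lebesgue \<Omega> \<noteq> 0" using lmeas by (simp add: negligible_iff_measure)
    ultimately show ?thesis using measure_nonneg[of lebesgue \<Omega>] by linarith
  qed
  define \<phi> where "\<phi> x = \<phi>2 x + (- a) *\<^sub>R \<phi>1 x" for x
  have \<phi>P: "\<phi> \<in> \<P>" unfolding \<phi>_def[abs_def] by (rule fin_dim_space_combination[OF P(1) \<phi>2(1) \<phi>1(1)])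
  have \<phi>ae: "AE x in ?M. \<phi> x = indicator (interior region) x - a"
    using \<phi>1(2) \<phi>2(2) by eventually_elim (simp add: \<phi>_def)
  have \<phi>m: "\<phi> \<in> borel_measurable ?M" using \<phi>P P(2) by (auto simp: L2_def)
  have ii: "integrable ?M (\<lambda>x. indicator (interior region) x :: real)"
    by (rule fin.integrable_const_bound[where B = 1]) (auto simp: mi)
  have "(\<integral>x. \<phi> x \<partial>?M) = (\<integral>x. indicator (interior region) x - a \<partial>?M)"
    using \<phi>ae \<phi>m mi by (intro integral_cong_AE) auto
  also have "\<dots> = (\<integral>x. indicator (interior region) x \<partial>?M) - a * measure ?M (space ?M)"
    using ii by (simp add: mult.commute)
  also have "\<dots> = 0" using pos by (simp add: a_def)
  finally have "\<phi> \<in> mean_free \<Omega> \<P>" using \<phi>P by (simp add: mean_free_def)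
  then have 0: "L2_inner \<Omega> (divg \<Omega> \<xi>) \<phi> = 0" using \<xi> by (simp add: div_free_def)
  have dsq: "square_integrable ?M (divg \<Omega> \<xi>)"
    unfolding divg_def[abs_def] trace_def sum_2 by (intro square_integrable_add L2_component2[OF H10_D(3)[OF \<xi>H]])
  have di: "integrable ?M (divg \<Omega> \<xi>)" by (rule fin.square_integrable_imp_integrable[OF dsq])
  \<comment> \<open>Zero boundary values make the total divergence vanish, so subtracting the mean
    from the pressure does not change its product with the divergence.\<close>
  have d0: "(\<integral>x. divg \<Omega> \<xi> x \<partial>?M) = 0"
  proof -
    have "integrable ?M (\<lambda>x. weak_grad \<Omega> \<xi> x $ i $ i)" for i
      by (rule fin.square_integrable_imp_integrable[OF L2_component2[OF H10_D(3)[OF \<xi>H]]])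
    then show ?thesis by (simp add: divg_def trace_def sum_2 integral_weak_grad_zero[OF \<xi>H])
  qed
  have isq: "square_integrable ?M (\<lambda>x. indicator (interior region) x :: real)"
    by (rule fin.square_integrable_bounded[where B = 1]) (auto simp: mi)
  have dii: "integrable ?M (\<lambda>x. divg \<Omega> \<xi> x * indicator (interior region) x)" by (rule square_integrable_mult[OF dsq isq])
  have "L2_inner \<Omega> (divg \<Omega> \<xi>) \<phi> = (\<integral>x. divg \<Omega> \<xi> x * indicator (interior region) x - a * divg \<Omega> \<xi> x \<partial>?M)"
    unfolding L2_inner_def
  proof (rule integral_cong_AE)
    show "(\<lambda>x. divg \<Omega> \<xi> x \<bullet> \<phi> x) \<in> borel_measurable ?M" using di \<phi>m by auto
    show "(\<lambda>x. divg \<Omega> \<xi> x * indicator (interior region) x - a * divg \<Omega> \<xi> x) \<in> borel_measurable ?M"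
      using di dii by auto
    show "AE x in ?M. divg \<Omega> \<xi> x \<bullet> \<phi> x = divg \<Omega> \<xi> x * indicator (interior region) x - a * divg \<Omega> \<xi> x"
      using \<phi>ae
    proof eventually_elim
      case (elim x)
      show ?case unfolding elim by (simp add: right_diff_distrib mult.commute)
    qed
  qed
  also have "\<dots> = (\<integral>x. divg \<Omega> \<xi> x * indicator (interior region) x \<partial>?M) - a * 0"
    using di dii by (simp add: d0)
  finally have "(\<integral>x. divg \<Omega> \<xi> x * indicator (interior region) x \<partial>?M) = 0" using 0 by simp
  then show ?thesis
    using divergence_theorem_polygon[OF \<xi>H cont] curve_inner_outer_normal[OF \<nu>] by simp
qed

section \<open>Existence and uniqueness for the reduced system\<close>

lemma vertex_sum_scale: "vertex_sum (\<lambda>x. d *\<^sub>R h x) = d * vertex_sum h"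
  by (simp add: vertex_sum_def sum_distrib_left)

lemma lumped_inner_curvature:
  assumes \<nu>: "is_outer_unit_normal N q \<nu>" and \<kappa>: "\<kappa> \<in> W_space N q" and \<eta>: "\<eta> \<in> V_space N q"
  shows "lumped_inner N q (\<lambda>x. \<kappa> x *\<^sub>R \<nu> x) \<eta> = side * cos (pi / real N) * vertex_sum (\<lambda>x. \<kappa> x *\<^sub>R \<eta> x)"
proof (rule lumped_inner_eq)
  show "continuous_on (polygon N q) (\<lambda>x. \<kappa> x *\<^sub>R \<eta> x)"
    using \<kappa> continuous_on_V_space[OF \<eta>] by (intro continuous_intros) (auto simp: W_space_def)
qed (simp add: outer_unit_normal_eq[OF \<nu>] inner_commute)

lemma lumped_inner_velocity:
  assumes \<nu>: "is_outer_unit_normal N q \<nu>" and \<zeta>: "\<zeta> \<in> W_space N q" and e: "e \<in> V_space N q"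
  shows "lumped_inner N q (\<lambda>x. d *\<^sub>R e x) (\<lambda>x. \<zeta> x *\<^sub>R \<nu> x) = d * (side * cos (pi / real N) * vertex_sum (\<lambda>x. \<zeta> x *\<^sub>R e x))"
proof -
  have "lumped_inner N q (\<lambda>x. d *\<^sub>R e x) (\<lambda>x. \<zeta> x *\<^sub>R \<nu> x) = side * cos (pi / real N) * vertex_sum (\<lambda>x. d *\<^sub>R (\<zeta> x *\<^sub>R e x))"
  proof (rule lumped_inner_eq)
    show "continuous_on (polygon N q) (\<lambda>x. d *\<^sub>R (\<zeta> x *\<^sub>R e x))"
      using \<zeta> continuous_on_V_space[OF e] by (intro continuous_intros) (auto simp: W_space_def)
  qed (simp add: outer_unit_normal_eq[OF \<nu>])
  then show ?thesis by (simp add: vertex_sum_scale del: scaleR_scaleR)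
qed

text \<open>Lumped products see nodal values only, so a hat function isolates the radial component
  at a single vertex.\<close>

lemma vertex_sum_hat:
  assumes "k < N" shows "vertex_sum (\<lambda>x. hat k x *\<^sub>R h x) = h (vertex k) \<bullet> dir (real k)"
proof -
  have "vertex_sum (\<lambda>x. hat k x *\<^sub>R h x) = (\<Sum>j<N. if j = k then h (vertex k) \<bullet> dir (real k) else 0)"
    unfolding vertex_sum_def by (intro sum.cong refl) (use assms hat_vertex in auto)
  then show ?thesis using assms by simp
qed

lemma sym_grad_zero: "AE x in lebesgue_on \<Omega>. sym_grad \<Omega> (\<lambda>x. 0) x = 0"
  using weak_grad_zero by eventually_elim (simp add: sym_grad_def transpose_def vec_eq_iff)

text \<open>With constant curvature the curve term of the momentum equation is a multiple of the
  total flux of the test velocity, which vanishes. The viscous terms vanish almost everywhere only,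
  since the gradient of the zero function is a chosen representative.\<close>

lemma stationary_solution:
  assumes \<nu>: "is_outer_unit_normal N q \<nu>" and ne: "\<Omega> \<noteq> {}"
    and U: "finite_element_space \<Omega> \<T> \<U>" "\<U> \<subseteq> H10 \<Omega>" and P: "fin_dim_space \<P>" "\<P> \<subseteq> L2 \<Omega>"
    and P1: "contains_ae \<Omega> \<P> (\<lambda>x. 1)" and PI: "contains_ae \<Omega> \<P> (indicator (interior_phase N q))"
  shows "reduced_system_solution \<Omega> \<U> \<P> N q \<nu> \<mu> \<gamma> \<tau> (\<lambda>x. 0) (\<lambda>x. 0, \<lambda>x. x, \<lambda>x. - (1 / apothem))"
  unfolding reduced_system_solution_def case_prod_conv
proof (intro conjI ballI)
  show "(\<lambda>x. 0) \<in> div_free \<Omega> \<U> \<P>" unfolding div_free_def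
  proof (intro CollectI conjI ballI)
    show "(\<lambda>x. 0) \<in> \<U>" using U by (intro fin_dim_space_zero) (simp add: finite_element_space_def)
    fix \<phi> assume "\<phi> \<in> mean_free \<Omega> \<P>"
    have "AE x in lebesgue_on \<Omega>. divg \<Omega> (\<lambda>x. 0) x \<bullet> \<phi> x = 0"
      using weak_grad_zero by eventually_elim (simp add: divg_def trace_def)
    then show "L2_inner \<Omega> (divg \<Omega> (\<lambda>x. 0)) \<phi> = 0" unfolding L2_inner_def by (rule integral_eq_zero_AE)
  qed
  show "(\<lambda>x. x) \<in> V_space N q" by (rule id_in_V_space)
  show "(\<lambda>x. - (1 / apothem)) \<in> W_space N q" by (rule const_in_W_space)
next
  fix \<xi> assume \<xi>: "\<xi> \<in> div_free \<Omega> \<U> \<P>"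
  have "AE x in lebesgue_on \<Omega>. (\<mu> x *\<^sub>R sym_grad \<Omega> (\<lambda>x. 0) x) \<bullet> sym_grad \<Omega> \<xi> x = 0"
    using sym_grad_zero by eventually_elim simp
  then have "L2_inner \<Omega> (\<lambda>x. \<mu> x *\<^sub>R sym_grad \<Omega> (\<lambda>x. 0) x) (sym_grad \<Omega> \<xi>) = 0"
    unfolding L2_inner_def by (rule integral_eq_zero_AE)
  moreover have "curve_inner N q (\<lambda>x. - (1 / apothem) *\<^sub>R \<nu> x) \<xi> = 0"
    by (rule curve_inner_div_free[OF \<nu> ne U P P1 PI \<xi>])
  ultimately show "2 * L2_inner \<Omega> (\<lambda>x. \<mu> x *\<^sub>R sym_grad \<Omega> (\<lambda>x. 0) x) (sym_grad \<Omega> \<xi>)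
      - \<gamma> * curve_inner N q (\<lambda>x. - (1 / apothem) *\<^sub>R \<nu> x) \<xi> = L2_inner \<Omega> (\<lambda>x. 0) \<xi>"
    by (simp add: L2_inner_def)
next
  fix \<zeta> assume "\<zeta> \<in> W_space N q"
  have "lumped_inner N q (\<lambda>x. (1 / \<tau>) *\<^sub>R (x - x)) (\<lambda>x. \<zeta> x *\<^sub>R \<nu> x) = side * cos (pi / real N) * vertex_sum (\<lambda>x. 0)"
    by (rule lumped_inner_eq) auto
  then show "lumped_inner N q (\<lambda>x. (1 / \<tau>) *\<^sub>R (x - x)) (\<lambda>x. \<zeta> x *\<^sub>R \<nu> x) - curve_inner N q (\<lambda>x. 0) (\<lambda>x. \<zeta> x *\<^sub>R \<nu> x) = 0"
    by (simp add: vertex_sum_def curve_inner_def edge_integral_def)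
next
  fix \<eta> assume \<eta>: "\<eta> \<in> V_space N q"
  have "lumped_inner N q (\<lambda>x. - (1 / apothem) *\<^sub>R \<nu> x) \<eta> = - (1 / apothem) * curve_inner N q \<nu> \<eta>"
    using lumped_inner_curvature[OF \<nu> const_in_W_space \<eta>, of "- (1 / apothem)"] curve_inner_normal_eq[OF \<nu> \<eta>]
      vertex_sum_scale[of "- (1 / apothem)" \<eta>] by simp
  then show "lumped_inner N q (\<lambda>x. - (1 / apothem) *\<^sub>R \<nu> x) \<eta> + surface_grad_inner N q (\<lambda>x. x) \<eta> = 0"
    using constant_discrete_curvature[OF \<nu> \<eta>] by simp
qed

lemma sym_grad_zero_imp_zero:
  assumes u: "u \<in> H10 \<Omega>" and cont: "continuous_on (closure \<Omega>) u" and 0: "AE x in lebesgue_on \<Omega>. sym_grad \<Omega> u x = 0"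
  shows "\<forall>x\<in>closure \<Omega>. u x = 0"
proof (rule continuous_AE_zero_imp_zero_on_closure[OF cont])
  have "AE x in lebesgue_on \<Omega>. weak_grad \<Omega> u x $ k $ k = 0" for k
    using 0
  proof eventually_elim
    case (elim x)
    then have "sym_grad \<Omega> u x $ k $ k = 0" by simp
    then show ?case by (simp add: sym_grad_def transpose_def)
  qed
  then have "AE x in lebesgue_on \<Omega>. u x $ k = 0" for k
    by (intro H10_zero_if_diagonal_derivative_zero[OF u])
  from this[of 1] this[of 2] show "AE x in lebesgue_on \<Omega>. u x = 0"
    by eventually_elim (simp add: vec_eq_iff forall_2)
qed

text \<open>Positivity of the viscosity turns zero energy into a zero symmetric gradient; its upper
  bound makes the energy density integrable, as the criterion for a zero integral requires.\<close>

lemma energy_nonneg: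
  assumes T: "regular_partitioning \<Omega> \<T>" and \<mu>: "is_discrete_viscosity \<Omega> \<T> N q \<mu>m \<mu>p \<mu>"
    and pos: "\<mu>m > 0" "\<mu>p > 0" and u: "u \<in> H10 \<Omega>"
  shows "0 \<le> L2_inner \<Omega> (\<lambda>x. \<mu> x *\<^sub>R sym_grad \<Omega> u x) (sym_grad \<Omega> u)"
    "L2_inner \<Omega> (\<lambda>x. \<mu> x *\<^sub>R sym_grad \<Omega> u x) (sym_grad \<Omega> u) = 0 \<Longrightarrow> AE x in lebesgue_on \<Omega>. sym_grad \<Omega> u x = 0"
proof -
  let ?M = "lebesgue_on \<Omega>"
  define f where "f x = \<mu> x * (sym_grad \<Omega> u x \<bullet> sym_grad \<Omega> u x)" for x
  have If: "L2_inner \<Omega> (\<lambda>x. \<mu> x *\<^sub>R sym_grad \<Omega> u x) (sym_grad \<Omega> u) = (\<integral>x. f x \<partial>?M)"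
    by (simp add: L2_inner_def f_def)
  have \<mu>b: "AE x in ?M. 0 < \<mu> x \<and> \<mu> x \<le> \<mu>m + \<mu>p"
    using discrete_viscosity_AE[OF T \<mu>] by eventually_elim (use pos in auto)
  have nn: "AE x in ?M. 0 \<le> f x" using \<mu>b by eventually_elim (simp add: f_def)
  show "0 \<le> L2_inner \<Omega> (\<lambda>x. \<mu> x *\<^sub>R sym_grad \<Omega> u x) (sym_grad \<Omega> u)"
    unfolding If by (rule integral_nonneg_AE[OF nn])
  have entry: "square_integrable ?M (\<lambda>x. sym_grad \<Omega> u x $ i $ j)" for i j
  proof -
    have "square_integrable ?M (\<lambda>x. (1 / 2) * (weak_grad \<Omega> u x $ i $ j + weak_grad \<Omega> u x $ j $ i))"
      by (intro square_integrable_cmult square_integrable_add L2_component2[OF H10_D(3)[OF u]])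
    then show ?thesis by (simp add: sym_grad_def transpose_def)
  qed
  have L: "sym_grad \<Omega> u \<in> L2 \<Omega>" by (rule L2_matI[OF entry])
  have sm: "(\<lambda>x. sym_grad \<Omega> u x \<bullet> sym_grad \<Omega> u x) \<in> borel_measurable ?M" "integrable ?M (\<lambda>x. sym_grad \<Omega> u x \<bullet> sym_grad \<Omega> u x)"
    using L by (auto simp: L2_def power2_norm_eq_inner)
  have fi: "integrable ?M f"
  proof (rule Bochner_Integration.integrable_bound)
    show "integrable ?M (\<lambda>x. (\<mu>m + \<mu>p) * (sym_grad \<Omega> u x \<bullet> sym_grad \<Omega> u x))" using sm by simp
    show "f \<in> borel_measurable ?M" unfolding f_def[abs_def]
      by (intro borel_measurable_times discrete_viscosity_measurable[OF T \<mu>] sm)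
    show "AE x in ?M. norm (f x) \<le> norm ((\<mu>m + \<mu>p) * (sym_grad \<Omega> u x \<bullet> sym_grad \<Omega> u x))"
      using \<mu>b by eventually_elim (use pos in \<open>auto simp: f_def abs_mult intro!: mult_right_mono\<close>)
  qed
  assume "L2_inner \<Omega> (\<lambda>x. \<mu> x *\<^sub>R sym_grad \<Omega> u x) (sym_grad \<Omega> u) = 0"
  then have "AE x in ?M. f x = 0" using integral_nonneg_eq_0_iff_AE[OF fi nn] If by simp
  then show "AE x in ?M. sym_grad \<Omega> u x = 0"
    using \<mu>b by eventually_elim (simp add: f_def)
qed

lemma solution_unique:
  assumes \<nu>: "is_outer_unit_normal N q \<nu>" and ne: "\<Omega> \<noteq> {}"
    and T: "regular_partitioning \<Omega> \<T>"
    and U: "finite_element_space \<Omega> \<T> \<U>" "\<U> \<subseteq> H10 \<Omega>" and P: "fin_dim_space \<P>" "\<P> \<subseteq> L2 \<Omega>"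
    and P1: "contains_ae \<Omega> \<P> (\<lambda>x. 1)" and PI: "contains_ae \<Omega> \<P> (indicator (interior_phase N q))"
    and pos: "\<gamma> > 0" "\<mu>m > 0" "\<mu>p > 0" "\<tau> > 0" and \<mu>: "is_discrete_viscosity \<Omega> \<T> N q \<mu>m \<mu>p \<mu>"
    and sol: "reduced_system_solution \<Omega> \<U> \<P> N q \<nu> \<mu> \<gamma> \<tau> (\<lambda>x. 0) (u, X, \<kappa>)"
  shows "\<forall>x\<in>closure \<Omega>. u x = 0" "\<forall>x\<in>polygon N q. X x = x \<and> \<kappa> x = - (1 / apothem)"
proof -
  have u: "u \<in> div_free \<Omega> \<U> \<P>" and X: "X \<in> V_space N q" and \<kappa>: "\<kappa> \<in> W_space N q"
    and eqa: "\<And>\<xi>. \<xi> \<in> div_free \<Omega> \<U> \<P> \<Longrightarrow> 2 * L2_inner \<Omega> (\<lambda>x. \<mu> x *\<^sub>R sym_grad \<Omega> u x) (sym_grad \<Omega> \<xi>)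
          - \<gamma> * curve_inner N q (\<lambda>x. \<kappa> x *\<^sub>R \<nu> x) \<xi> = L2_inner \<Omega> (\<lambda>x. 0) \<xi>"
    and eqc: "\<And>\<zeta>. \<zeta> \<in> W_space N q \<Longrightarrow> lumped_inner N q (\<lambda>x. (1 / \<tau>) *\<^sub>R (X x - x)) (\<lambda>x. \<zeta> x *\<^sub>R \<nu> x)
          - curve_inner N q u (\<lambda>x. \<zeta> x *\<^sub>R \<nu> x) = 0"
    and eqd: "\<And>\<eta>. \<eta> \<in> V_space N q \<Longrightarrow> lumped_inner N q (\<lambda>x. \<kappa> x *\<^sub>R \<nu> x) \<eta> + surface_grad_inner N q X \<eta> = 0"
    using sol unfolding reduced_system_solution_def by auto
  have uH: "u \<in> H10 \<Omega>" and uc: "continuous_on (closure \<Omega>) u"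
    using u U by (auto simp: div_free_def finite_element_space_def)
  define e where "e x = X x - x" for x
  have eV: "e \<in> V_space N q" unfolding e_def[abs_def] by (rule V_space_diff[OF X id_in_V_space])
  define K where "K = side * cos (pi / real N)"
  have K: "K > 0" using side_pos cos_pos by (simp add: K_def)
  have comm: "curve_inner N q v w = curve_inner N q w v" for v w by (simp add: curve_inner_def inner_commute)
  have c: "(1 / \<tau>) * (K * vertex_sum (\<lambda>x. \<zeta> x *\<^sub>R e x)) = curve_inner N q u (\<lambda>x. \<zeta> x *\<^sub>R \<nu> x)" if "\<zeta> \<in> W_space N q" for \<zeta>
    using eqc[OF that] lumped_inner_velocity[OF \<nu> that eV, of "1 / \<tau>"] by (simp add: e_def K_def)
  \<comment> \<open>Testing the velocity equation with the constant 1 leaves the total flux of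
    \<open>u\<close>, which vanishes.\<close>
  have S0: "vertex_sum e = 0"
  proof -
    have "(1 / \<tau>) * (K * vertex_sum (\<lambda>x. 1 *\<^sub>R e x)) = curve_inner N q u (\<lambda>x. 1 *\<^sub>R \<nu> x)"
      using c[OF const_in_W_space, of 1] .
    also have "\<dots> = 0" using curve_inner_div_free[OF \<nu> ne U P P1 PI u, of 1] comm by simp
    finally show ?thesis using K pos by simp
  qed
  \<comment> \<open>The squared norm of the surface gradient of the displacement
    \<open>e\<close>.\<close>
  define Q where "Q = (\<Sum>j<N. ((e (vertex (Suc j)) - e (vertex j)) \<bullet> (e (vertex (Suc j)) - e (vertex j))) / side)"
  have XQ: "surface_grad_inner N q X \<eta> = surface_grad_inner N q e \<eta> + surface_grad_inner N q (\<lambda>x. x) \<eta>" if "\<eta> \<in> V_space N q" for \<eta>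
    unfolding surface_grad_inner_eq[OF X that] surface_grad_inner_eq[OF eV that] surface_grad_inner_eq[OF id_in_V_space that]
      sum.distrib[symmetric]
    by (intro sum.cong refl) (simp add: e_def inner_diff_left inner_diff_right flip: add_divide_distrib)
  \<comment> \<open>The cross term with the identity is a multiple of \<open>vertex_sum e\<close>,
    hence zero by \<open>S0\<close>.\<close>
  have "surface_grad_inner N q X e = Q"
    unfolding XQ[OF eV] surface_grad_inner_id[OF eV] S0 by (simp add: Q_def surface_grad_inner_eq[OF eV eV])
  then have d: "K * vertex_sum (\<lambda>x. \<kappa> x *\<^sub>R e x) = - Q"
    using eqd[OF eV] lumped_inner_curvature[OF \<nu> \<kappa> eV] by (simp add: K_def)
  define I where "I = L2_inner \<Omega> (\<lambda>x. \<mu> x *\<^sub>R sym_grad \<Omega> u x) (sym_grad \<Omega> u)"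
  have "2 * I = \<gamma> * curve_inner N q (\<lambda>x. \<kappa> x *\<^sub>R \<nu> x) u" using eqa[OF u] by (simp add: I_def L2_inner_def)
  also have "curve_inner N q (\<lambda>x. \<kappa> x *\<^sub>R \<nu> x) u = (1 / \<tau>) * - Q" using c[OF \<kappa>] d comm by simp
  \<comment> \<open>The velocity equation with the test function \<kappa> and the curvature equation
    with the test function \<open>e\<close> express the same lumped product; eliminating it leaves a
    sum of two nonnegative terms.\<close>
  finally have en: "2 * I + (\<gamma> / \<tau>) * Q = 0" by (simp add: field_simps)
  have I0: "I \<ge> 0" unfolding I_def by (rule energy_nonneg(1)[OF T \<mu> pos(2,3) uH])
  have Q0: "Q \<ge> 0" unfolding Q_def using side_pos by (intro sum_nonneg) simp
  have "(\<gamma> / \<tau>) * Q \<ge> 0" using pos Q0 by simp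
  then have "I = 0" "(\<gamma> / \<tau>) * Q = 0" using en I0 by linarith+
  then have "Q = 0" using pos by simp
  show u0: "\<forall>x\<in>closure \<Omega>. u x = 0"
    by (rule sym_grad_zero_imp_zero[OF uH uc]) (rule energy_nonneg(2)[OF T \<mu> pos(2,3) uH], use \<open>I = 0\<close> in \<open>simp add: I_def\<close>)
  have step: "e (vertex (Suc j)) = e (vertex j)" if "j < N" for j
  proof -
    have "((e (vertex (Suc j)) - e (vertex j)) \<bullet> (e (vertex (Suc j)) - e (vertex j))) / side = 0"
      using \<open>Q = 0\<close> that side_pos unfolding Q_def by (subst (asm) sum_nonneg_eq_0_iff) auto
    then show ?thesis using side_pos by simp
  qed
  define b where "b = e (vertex 0)"
  have eb: "e (vertex j) = b" if "j \<le> N" for j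
    using that by (induction j) (simp_all add: b_def step)
  \<comment> \<open>Now that \<open>u\<close> vanishes, the velocity equation with a hat function
    reads off the radial component of the displacement at vertex \<open>k\<close>.\<close>
  have "b \<bullet> dir (real k) = 0" if k: "k < N" for k
  proof -
    have "curve_inner N q u (\<lambda>x. hat k x *\<^sub>R \<nu> x) = 0"
    proof -
      have "edge_integral N q j (\<lambda>x. u x \<bullet> (hat k x *\<^sub>R \<nu> x)) = side * integral {0..1::real} (\<lambda>t. 0)" if j: "j < N" for j
      proof (rule edge_integral_cong[OF j])
        fix t :: real assume "0 < t" "t < 1"
        then have "edge_point j t \<in> closure \<Omega>" using edge_point_in_polygon[OF j, of t] polygon_subset by auto
        then show "u (edge_point j t) \<bullet> (hat k (edge_point j t) *\<^sub>R \<nu> (edge_point j t)) = 0" using u0 by simp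
      qed
      then show ?thesis by (simp add: curve_inner_def)
    qed
    then have "vertex_sum (\<lambda>x. hat k x *\<^sub>R e x) = 0" using c[OF hat_in_W_space[OF k]] K pos by simp
    then show ?thesis using vertex_sum_hat[OF k, of e] eb[of k] k by simp
  qed
  \<comment> \<open>Two adjacent radial directions already span the plane, because 0 < 2 pi / N <
    pi.\<close>
  from this[of 0] this[of 1] have b01: "b \<bullet> dir 0 = 0" "b \<bullet> dir 1 = 0" using N3 by auto
  have "b = 0"
  proof -
    have bp: "b = (b \<bullet> perp 0) *\<^sub>R perp 0" using orthonormal_expansion[of b 0] b01(1) by simp
    have "dir 1 \<bullet> perp 0 = sin (2 * pi / real N)" using dir_perp_inner[of 1 0] by simp
    moreover have "sin (2 * pi / real N) > 0"
    proof (rule sin_gt_zero)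
      show "0 < 2 * pi / real N" using N_pos by simp
      have "2 * (pi / real N) < 2 * (pi / 2)" using angle by linarith
      then show "2 * pi / real N < pi" by simp
    qed
    moreover have "0 = (b \<bullet> perp 0) * (dir 1 \<bullet> perp 0)"
      using b01(2) by (subst (asm) bp) (simp add: inner_commute)
    ultimately have "b \<bullet> perp 0 = 0" by simp
    then show "b = 0" using bp by simp
  qed
  have X_vertex: "X (vertex j) = vertex j" if "j \<le> N" for j
    using eb[OF that] \<open>b = 0\<close> by (simp add: e_def)
  have \<kappa>_vertex: "\<kappa> (vertex k) = - (1 / apothem)" if k: "k < N" for k
  proof -
    \<comment> \<open>The radial hat field makes the lumped curvature term depend on the value of
      \<kappa> at vertex \<open>k\<close> alone.\<close>
    define \<eta> where "\<eta> x = hat k x *\<^sub>R dir (real k)" for x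
    have \<eta>: "\<eta> \<in> V_space N q" unfolding \<eta>_def[abs_def] by (rule V_space_scaleR[OF hat_in_W_space[OF k]])
    have "surface_grad_inner N q e \<eta> = 0"
      unfolding surface_grad_inner_eq[OF eV \<eta>] using step by (intro sum.neutral) auto
    then have "surface_grad_inner N q X \<eta> = 2 * sin (pi / real N) * vertex_sum \<eta>"
      using XQ[OF \<eta>] surface_grad_inner_id[OF \<eta>] by simp
    moreover have "vertex_sum \<eta> = 1"
      unfolding \<eta>_def[abs_def] vertex_sum_hat[OF k] using norm_dir by (simp add: norm_eq_1)
    moreover have "vertex_sum (\<lambda>x. \<kappa> x *\<^sub>R \<eta> x) = \<kappa> (vertex k)"
    proof -
      have "(\<lambda>x. \<kappa> x *\<^sub>R \<eta> x) = (\<lambda>x. hat k x *\<^sub>R (\<kappa> x *\<^sub>R dir (real k)))" by (simp add: \<eta>_def mult.commute)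
      then show ?thesis using vertex_sum_hat[OF k, of "\<lambda>x. \<kappa> x *\<^sub>R dir (real k)"] norm_dir[of "real k"] by (simp add: norm_eq_1)
    qed
    ultimately have "K * \<kappa> (vertex k) + 2 * sin (pi / real N) = 0"
      using eqd[OF \<eta>] lumped_inner_curvature[OF \<nu> \<kappa> \<eta>] by (simp add: K_def)
    then have "sin (pi / real N) * (r * cos (pi / real N) * \<kappa> (vertex k) + 1) = 0"
      by (simp add: K_def side_def algebra_simps)
    then have "apothem * \<kappa> (vertex k) + 1 = 0" using sin_pos by (simp add: apothem_def)
    then show ?thesis using apothem_pos by (simp add: field_simps)
  qed
  then have \<kappa>_vertex': "\<kappa> (vertex j) = - (1 / apothem)" if "j \<le> N" for j
    using that vertex_period N3 by (cases "j = N") auto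
  show "\<forall>x\<in>polygon N q. X x = x \<and> \<kappa> x = - (1 / apothem)"
  proof
    fix x assume "x \<in> polygon N q"
    then obtain j t where jt: "j < N" "t \<in> {0..1}" "x = edge_point j t" by (auto simp: polygon_eq)
    have "X x = (1 - t) *\<^sub>R vertex j + t *\<^sub>R vertex (Suc j)"
      unfolding jt(3) V_space_edge_point[OF X jt(1,2)] using jt(1) by (simp add: X_vertex)
    then have "X x = x" by (simp add: jt(3) edge_point_convex)
    moreover have "\<kappa> x = - (1 / apothem)"
    proof -
      have "(1 - t) * d + t * d = d" for d :: real by (simp add: algebra_simps)
      then show ?thesis
        unfolding jt(3) W_space_edge_point[OF \<kappa> jt(1,2)] using jt(1) by (simp only: \<kappa>_vertex' less_imp_le Suc_le_eq)
    qed
    ultimately show "X x = x \<and> \<kappa> x = - (1 / apothem)" by simp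
  qed
qed

end

theorem mainTheorem8:
  fixes \<Omega> :: "(real^2) set" and \<T> :: "(real^2) set set"
    and \<U> :: "(real^2 \<Rightarrow> real^2) set" and \<P> :: "(real^2 \<Rightarrow> real) set"
    and t :: "nat \<Rightarrow> real" and T :: real and M m :: nat
    and N :: nat and q :: "nat \<Rightarrow> real^2" and \<nu> :: "real^2 \<Rightarrow> real^2"
    and \<gamma> \<mu>m \<mu>p :: real and \<mu> :: "real^2 \<Rightarrow> real"
  assumes "polygonal_domain \<Omega>"
    and "t 0 = 0" and "t M = T" and "\<forall>k<M. t k < t (Suc k)" and "m < M"
    and "regular_partitioning \<Omega> \<T>"
    and "finite_element_space \<Omega> \<T> \<U>" and "\<U> \<subseteq> H10 \<Omega>"
    and "fin_dim_space \<P>" and "\<P> \<subseteq> L2 \<Omega>"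
    and "regular_polygon N q" and "polygon N q \<subseteq> closure \<Omega>"
    and "is_outer_unit_normal N q \<nu>"
    and "\<gamma> > 0" and "\<mu>m > 0" and "\<mu>p > 0"
    and "is_discrete_viscosity \<Omega> \<T> N q \<mu>m \<mu>p \<mu>"
    and "\<forall>c. contains_ae \<Omega> \<P> (\<lambda>x. c)"
    and "contains_ae \<Omega> \<P> (indicator (interior_phase N q))"
  shows "\<exists>\<kappa>bar :: real.
      (\<forall>\<eta> \<in> V_space N q. \<kappa>bar * curve_inner N q \<nu> \<eta> + surface_grad_inner N q (\<lambda>x. x) \<eta> = 0) \<and>
      reduced_system_solution \<Omega> \<U> \<P> N q \<nu> \<mu> \<gamma> (t (Suc m) - t m) (\<lambda>x. 0)
        (\<lambda>x. 0, \<lambda>x. x, \<lambda>x. \<kappa>bar) \<and>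
      (\<forall>U X \<kappa>. reduced_system_solution \<Omega> \<U> \<P> N q \<nu> \<mu> \<gamma> (t (Suc m) - t m) (\<lambda>x. 0) (U, X, \<kappa>) \<longrightarrow>
         (\<forall>x \<in> closure \<Omega>. U x = 0) \<and> (\<forall>x \<in> polygon N q. X x = x \<and> \<kappa> x = \<kappa>bar))"
proof -
  obtain E where \<Omega>: "\<Omega> \<noteq> {}" "open \<Omega>" "bounded \<Omega>"
    and E: "finite E" "frontier \<Omega> = (\<Union>(a, b)\<in>E. closed_segment a b)"
    using assms(1) unfolding polygonal_domain_def by blast
  obtain c r \<theta> where "3 \<le> N" "0 < r" "\<forall>j<N. q j = c + r *\<^sub>R vector [cos (\<theta> + 2 * pi * real j / real N),
      sin (\<theta> + 2 * pi * real j / real N)]"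
    using \<open>regular_polygon N q\<close> unfolding regular_polygon_def by blast
  then have "regular_ngon N q c r \<theta>" by (intro regular_ngon.intro) simp_all
  moreover have "bounded_open_domain \<Omega>" using \<Omega> by (intro bounded_open_domain.intro)
  moreover have "ngon_in_domain_axioms \<Omega> N q E"
    using E \<open>polygon N q \<subseteq> closure \<Omega>\<close> by (intro ngon_in_domain_axioms.intro)
  ultimately interpret ngon_in_domain \<Omega> N q c r \<theta> E by (intro ngon_in_domain.intro)
  have P1: "contains_ae \<Omega> \<P> (\<lambda>x. 1)" using \<open>\<forall>c. contains_ae \<Omega> \<P> (\<lambda>x. c)\<close> by blast
  have \<tau>: "t (Suc m) - t m > 0" using \<open>\<forall>k<M. t k < t (Suc k)\<close> \<open>m < M\<close> by simp
  note \<nu> = \<open>is_outer_unit_normal N q \<nu>\<close>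
  note spaces = \<open>finite_element_space \<Omega> \<T> \<U>\<close> \<open>\<U> \<subseteq> H10 \<Omega>\<close> \<open>fin_dim_space \<P>\<close> \<open>\<P> \<subseteq> L2 \<Omega>\<close> P1
    \<open>contains_ae \<Omega> \<P> (indicator (interior_phase N q))\<close>
  show ?thesis
  \<comment> \<open>The discrete curvature is that of the inscribed circle, negative with respect to
    the outward normal.\<close>
  proof (intro exI[of _ "- (1 / apothem)"] conjI ballI allI impI)
    show "- (1 / apothem) * curve_inner N q \<nu> \<eta> + surface_grad_inner N q (\<lambda>x. x) \<eta> = 0" if "\<eta> \<in> V_space N q" for \<eta>
      by (rule constant_discrete_curvature[OF \<nu> that])
    show "reduced_system_solution \<Omega> \<U> \<P> N q \<nu> \<mu> \<gamma> (t (Suc m) - t m) (\<lambda>x. 0)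
        (\<lambda>x. 0, \<lambda>x. x, \<lambda>x. - (1 / apothem))"
      by (rule stationary_solution[OF \<nu> \<Omega>(1) spaces])
  next
    fix U X \<kappa>
    assume sol: "reduced_system_solution \<Omega> \<U> \<P> N q \<nu> \<mu> \<gamma> (t (Suc m) - t m) (\<lambda>x. 0) (U, X, \<kappa>)"
    note uniq = solution_unique[OF \<nu> \<Omega>(1) \<open>regular_partitioning \<Omega> \<T>\<close> spaces \<open>\<gamma> > 0\<close> \<open>\<mu>m > 0\<close> \<open>\<mu>p > 0\<close> \<tau>
        \<open>is_discrete_viscosity \<Omega> \<T> N q \<mu>m \<mu>p \<mu>\<close> sol]
    show "U x = 0" if "x \<in> closure \<Omega>" for x using uniq(1) that by blast
    show "X x = x" "\<kappa> x = - (1 / apothem)" if "x \<in> polygon N q" for x using uniq(2) that by blast+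
  qed
qed

end
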